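(* Let $\Phi$ be a thick morphism from $M_1$ to $M_2$ with generating function $S(x,q)=S_0(x)+\varphi^i(x)q_i+S^{ij}(x)q_iq_j+\cdots$ in local coordinates $x,y$ on $M_1,M_2$ (conjugate momenta $p,q$). Let $x=x(x')$, $y=y(y')$ be an invertible change of local coordinates, with conjugate momenta $p',q'$, and let $y'=y'(y)$, with components $y^{\alpha'}(y)$, be the inverse change of coordinates. Let $S'(x',q')$ be the generating function of $\Phi$ in the new coordinates, i.e. $$S'(x',q')=S(x(x'),\overline q)+y^{\alpha'}(\overline y)q_{\alpha'}-\overline y^\alpha\overline q_\alpha,\qquad \overline q_\alpha=\frac{\partial y^{\alpha'}}{\partial y^\alpha}(\overline y)\,q_{\alpha'},\quad \overline y^\alpha=\frac{\partial S}{\partial q_\alpha}(x(x'),\overline q),$$ where $\overline y=\overline y(x',q')$, $\overline q=\overline q(x',q')$ are the unique power series in $q'$ determined by this system. Then $$S'(x',q')=\sum_{t\in T^\circ}\frac{q'_{\alpha_t}}{|t|_\circ!\,|t|_\bullet!}\langle S,y';t\rangle^{\alpha_t}(x')=\sum_{t\in[T^\circ]}\frac{q'_{\alpha_t}}{|\mathrm{sym}(t)|}\langle S,y';t\rangle^{\alpha_t}(x').$$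
   Context: All manifolds are ordinary (non-super). A thick morphism from $M_1$ to $M_2$ is a formal canonical relation in $T^*M_2\times\overline{T^*M_1}$ (a Lagrangian submanifold of the formal neighbourhood of $M_2\times T^*M_1$) given in local coordinates by a generating function $S(x,q)$ via $y^i=\partial S/\partial q_i$, $p_a=\partial S/\partial x^a$; $S$ is a formal power series in $q$ with smooth coefficients symmetric in their indices. Only the local formulas are used. Repeated indices are summed. $S^{a_1\dots a_m}(x)$ is the coefficient of $q_{a_1}\cdots q_{a_m}$ ($S^i=\varphi^i$; no indices: $S_0$); $\varphi(x)=(\varphi^i(x))$. Here $q_{\alpha'}$ are the components of $q'$. Functions of $\overline y$ are Taylor expanded at $\varphi(x(x'))$, the value of $\overline y$ at $q'=0$. The identity is one of formal power series in $q'$. A bipartite graph is $t=(B_t,W_t,E_t)$ with black vertices $B_t=\{1,\dots,n\}$, white vertices $W_t=\{-1,\dots,-m\}$ and a finite multiset $E_t$ of elements of $B_t\times W_t$ (edges). A bipartite tree is a (nonempty) connected bipartite graph without cycles; $|t|_\bullet=|B_t|$, $|t|_\circ=|W_t|$. An isomorphism is a pair of permutations of the black and white vertices carrying edges to edges; $\mathrm{sym}(t)$ is the automorphism group. $T^\circ$ is the set of bipartite trees whose leaves (degree-one vertices) are all white, including the one-vertex trees $\bullet$ and $\circ$; $[T^\circ]$ is its set of isomorphism classes. To $t$ is attached the multi-index $\alpha_t=\prod_{w\in W_t}a_w$ of dummy labels, and $q'_{\alpha_t}=\prod_{w\in W_t}q'_{a_w}$. For a vertex $v$ let $e^v_1,\dots,e^v_{m_v}$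 be the edges attached to $v$, used as dummy summation indices, and define $$\langle S,y';t\rangle^{\alpha_t}(x'):=\Big(\prod_{v\in B_t}m_v!\,S^{e^v_1\dots e^v_{m_v}}(x(x'))\Big)\Big(\prod_{w\in W_t}\frac{\partial}{\partial y^{e^w_1}}\cdots\frac{\partial}{\partial y^{e^w_{m_w}}}y^{a_w'}\big(\varphi(x(x'))\big)\Big),$$ where $y^{a'_w}$ is the $a_w$-th component of $y'(y)$. In the formulas for $S'$ all labels $a_w$ are summed over. *)

theory Defs
  imports "HOL-Analysis.Analysis" "HOL-Library.Multiset" "HOL-Combinatorics.Permutations"
begin

section \<open>Formal power series in several variables\<close>

text \<open>The monomial \<open>q\<^sub>i\<^sub>1 \<cdots> q\<^sub>i\<^sub>m\<close> is encoded by the multiset of its indices.\<close>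

typedef 'v mps = "UNIV :: ('v multiset \<Rightarrow> real) set"
  morphisms mps_coeff Abs_mps by auto

setup_lifting type_definition_mps

lemma mps_eqI: "(\<And>\<mu>. mps_coeff f \<mu> = mps_coeff g \<mu>) \<Longrightarrow> f = g"
  by transfer auto

lemma finite_submultisets: "finite {\<alpha>. \<alpha> \<subseteq># (\<mu> :: 'v multiset)}"
proof (rule finite_subset)
  let ?L = "{xs. set xs \<subseteq> set_mset \<mu> \<and> length xs \<le> size \<mu>}"
  show "{\<alpha>. \<alpha> \<subseteq># \<mu>} \<subseteq> mset ` ?L"
  proof
    fix \<alpha> assume "\<alpha> \<in> {\<alpha>. \<alpha> \<subseteq># \<mu>}"
    then have *: "\<alpha> \<subseteq># \<mu>" by simp
    obtain xs where xs: "mset xs = \<alpha>" using ex_mset by blast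
    have "set xs \<subseteq> set_mset \<mu>" using set_mset_mono[OF *] xs by auto
    moreover have "length xs \<le> size \<mu>" using size_mset_mono[OF *] xs by auto
    ultimately show "\<alpha> \<in> mset ` ?L" using xs by blast
  qed
  show "finite (mset ` ?L)" by (intro finite_imageI finite_lists_length_le) simp
qed

lemma finite_splits: "finite {p. fst p + snd p = (\<mu> :: 'v multiset)}"
  by (rule finite_subset[of _ "{\<alpha>. \<alpha> \<subseteq># \<mu>} \<times> {\<alpha>. \<alpha> \<subseteq># \<mu>}"])
     (auto simp: finite_submultisets)

instantiation mps :: (type) comm_ring_1
begin

lift_definition zero_mps :: "'v mps" is "\<lambda>_. 0" .
lift_definition one_mps :: "'v mps" is "\<lambda>\<mu>. if \<mu> = {#} then 1 else 0" .
lift_definition plus_mps :: "'v mps \<Rightarrow> 'v mps \<Rightarrow> 'v mps" is "\<lambda>f g \<mu>. f \<mu> + g \<mu>" .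
lift_definition minus_mps :: "'v mps \<Rightarrow> 'v mps \<Rightarrow> 'v mps" is "\<lambda>f g \<mu>. f \<mu> - g \<mu>" .
lift_definition uminus_mps :: "'v mps \<Rightarrow> 'v mps" is "\<lambda>f \<mu>. - f \<mu>" .
lift_definition times_mps :: "'v mps \<Rightarrow> 'v mps \<Rightarrow> 'v mps" is
  "\<lambda>f g \<mu>. \<Sum>p | fst p + snd p = \<mu>. f (fst p) * g (snd p)" .

instance
proof
  fix a b c :: "'v mps"
  show "a * b * c = a * (b * c)"
  proof (rule mps_eqI)
    fix \<mu> :: "'v multiset"
    let ?P = "\<lambda>\<mu>::'v multiset. {p. fst p + snd p = \<mu>}"
    let ?h = "\<lambda>x y z. mps_coeff a x * mps_coeff b y * mps_coeff c z"
    have "mps_coeff (a * b * c) \<mu> =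
      (\<Sum>p\<in>?P \<mu>. \<Sum>r\<in>?P (fst p). ?h (fst r) (snd r) (snd p))"
      by transfer (simp add: sum_distrib_right)
    also have "\<dots> = (\<Sum>(p,r)\<in>Sigma (?P \<mu>) (\<lambda>p. ?P (fst p)). ?h (fst r) (snd r) (snd p))"
      by (rule sum.Sigma) (auto simp: finite_splits)
    also have "\<dots> = (\<Sum>(p,r)\<in>Sigma (?P \<mu>) (\<lambda>p. ?P (snd p)). ?h (fst p) (fst r) (snd r))"
      by (rule sum.reindex_bij_witness
          [of _ "\<lambda>(p,r). ((fst p + fst r, snd r), (fst p, fst r))"
                "\<lambda>(p,r). ((fst r, snd r + snd p), (snd r, snd p))"])
         (auto simp: add_ac)
    also have "\<dots> = (\<Sum>p\<in>?P \<mu>. \<Sum>r\<in>?P (snd p). ?h (fst p) (fst r) (snd r))"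
      by (rule sum.Sigma[symmetric]) (auto simp: finite_splits)
    also have "\<dots> = mps_coeff (a * (b * c)) \<mu>"
      by transfer (simp add: sum_distrib_left mult.assoc)
    finally show "mps_coeff (a * b * c) \<mu> = mps_coeff (a * (b * c)) \<mu>" .
  qed
  show "a * b = b * a"
  proof (transfer, rule ext)
    fix f g :: "'v multiset \<Rightarrow> real" and \<mu>
    show "(\<Sum>p | fst p + snd p = \<mu>. f (fst p) * g (snd p)) =
          (\<Sum>p | fst p + snd p = \<mu>. g (fst p) * f (snd p))"
      by (rule sum.reindex_bij_witness[of _ prod.swap prod.swap]) (auto simp: add_ac)
  qed
  show "1 * a = a"
  proof (transfer, rule ext)
    fix f :: "'v multiset \<Rightarrow> real" and \<mu>
    have "(\<Sum>p | fst p + snd p = \<mu>. (if fst p = {#} then 1 else 0) * f (snd p)) =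
          (\<Sum>p\<in>{({#} :: 'v multiset, \<mu>)}. (if fst p = {#} then 1 else 0) * f (snd p))"
      by (rule sum.mono_neutral_right) (auto simp: finite_splits)
    then show "(\<Sum>p | fst p + snd p = \<mu>. (if fst p = {#} then 1 else 0) * f (snd p)) = f \<mu>"
      by simp
  qed
  show "(a + b) * c = a * c + b * c"
    by transfer (simp add: distrib_right sum.distrib)
  show "(0 :: 'v mps) \<noteq> 1"
    by transfer (metis zero_neq_one)
qed (transfer; auto simp: fun_eq_iff)+

end

lift_definition mps_const :: "real \<Rightarrow> 'v mps" is "\<lambda>c \<mu>. if \<mu> = {#} then c else 0" .
lift_definition mps_var :: "'v \<Rightarrow> 'v mps" is "\<lambda>i \<mu>. if \<mu> = {#i#} then 1 else 0" .

lift_definition mps_deriv :: "'v \<Rightarrow> 'v mps \<Rightarrow> 'v mps" is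
  "\<lambda>i f \<mu>. real (Suc (count \<mu> i)) * f (add_mset i \<mu>)" .

text \<open>Formal summation: every coefficient receives only finitely many contributions.\<close>

definition formally_summable :: "('a \<Rightarrow> 'v mps) \<Rightarrow> 'a set \<Rightarrow> bool" where
  "formally_summable f A \<longleftrightarrow> (\<forall>\<mu>. finite {t \<in> A. mps_coeff (f t) \<mu> \<noteq> 0})"

definition formal_sum :: "('a \<Rightarrow> 'v mps) \<Rightarrow> 'a set \<Rightarrow> 'v mps" where
  "formal_sum f A =
     Abs_mps (\<lambda>\<mu>. \<Sum>t | t \<in> A \<and> mps_coeff (f t) \<mu> \<noteq> 0. mps_coeff (f t) \<mu>)"

definition formal_has_sum :: "('a \<Rightarrow> 'v mps) \<Rightarrow> 'a set \<Rightarrow> 'v mps \<Rightarrow> bool" where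
  "formal_has_sum f A s \<longleftrightarrow> formally_summable f A \<and> s = formal_sum f A"

text \<open>Substitution of \<open>g i\<close> for the \<open>i\<close>-th variable of \<open>f\<close>; meaningful when the \<open>g i\<close>
  have no constant term, so that the sum is formally summable.\<close>

definition mps_compose :: "'v mps \<Rightarrow> ('v \<Rightarrow> 'w mps) \<Rightarrow> 'w mps" where
  "mps_compose f g = formal_sum (\<lambda>\<nu>. mps_const (mps_coeff f \<nu>) * (\<Prod>i\<in>#\<nu>. g i)) UNIV"

text \<open>The series \<open>\<Sum>\<^sub>m \<Sum>\<^sub>i\<^sub>1\<^sub>\<dots>\<^sub>i\<^sub>m T [i\<^sub>1, \<dots>, i\<^sub>m] q\<^sub>i\<^sub>1 \<cdots> q\<^sub>i\<^sub>m\<close>, each index running independently.\<close>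

definition tensor_series :: "('v list \<Rightarrow> real) \<Rightarrow> 'v mps" where
  "tensor_series T = Abs_mps (\<lambda>\<mu>. \<Sum>is | mset is = \<mu>. T is)"


section \<open>Smooth functions and coordinate changes\<close>

definition pderiv_at :: "'k::finite \<Rightarrow> (real^'k \<Rightarrow> real) \<Rightarrow> real^'k \<Rightarrow> real" where
  "pderiv_at i f = (\<lambda>y. frechet_derivative f (at y) (axis i 1))"

definition pderivs :: "'k::finite list \<Rightarrow> (real^'k \<Rightarrow> real) \<Rightarrow> real^'k \<Rightarrow> real" where
  "pderivs is f = foldr pderiv_at is f"

text \<open>For open \<open>U\<close> this is \<open>C\<^sup>\<infinity>\<close> on \<open>U\<close>.\<close>

definition smooth_fun_on :: "(real^'k::finite) set \<Rightarrow> (real^'k \<Rightarrow> real) \<Rightarrow> bool" where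
  "smooth_fun_on U f \<longleftrightarrow> (\<forall>is. pderivs is f differentiable_on U)"

definition smooth_map_on :: "(real^'k::finite) set \<Rightarrow> (real^'k \<Rightarrow> real^'l::finite) \<Rightarrow> bool" where
  "smooth_map_on U f \<longleftrightarrow> (\<forall>i. smooth_fun_on U (\<lambda>x. f x $ i))"

definition coordinate_change ::
  "(real^'k::finite) set \<Rightarrow> (real^'k) set \<Rightarrow> (real^'k \<Rightarrow> real^'k) \<Rightarrow> (real^'k \<Rightarrow> real^'k) \<Rightarrow> bool" where
  "coordinate_change A B f g \<longleftrightarrow>
     open A \<and> open B \<and> smooth_map_on A f \<and> smooth_map_on B g \<and>
     (\<forall>a\<in>A. f a \<in> B \<and> g (f a) = a) \<and> (\<forall>b\<in>B. g b \<in> A \<and> f (g b) = b)"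

text \<open>Taylor series of \<open>f\<close> at \<open>y\<^sub>0\<close> in the variables \<open>y - y\<^sub>0\<close>, and the value of \<open>f\<close> at a
  power series \<open>Y\<close> with constant term \<open>y\<^sub>0\<close>.\<close>

definition taylor_series :: "(real^'k::finite \<Rightarrow> real) \<Rightarrow> real^'k \<Rightarrow> 'k mps" where
  "taylor_series f y0 = tensor_series (\<lambda>is. pderivs is f y0 / fact (length is))"

definition taylor_expand ::
  "(real^'k::finite \<Rightarrow> real) \<Rightarrow> real^'k \<Rightarrow> ('k \<Rightarrow> 'w mps) \<Rightarrow> 'w mps" where
  "taylor_expand f y0 Y = mps_compose (taylor_series f y0) (\<lambda>i. Y i - mps_const (y0 $ i))"


section \<open>Thick morphisms in local coordinates\<close>

text \<open>\<open>S [i\<^sub>1, \<dots>, i\<^sub>m] x\<close> is the symmetric coefficient \<open>S\<^bsup>i1...im\<^esup>(x)\<close>, the indices being those of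
  coordinates on the target; in particular \<open>S [] = S\<^sub>0\<close> and \<open>S [i] = \<phi>\<^sup>i\<close>.\<close>

definition base_map :: "('k::finite list \<Rightarrow> real^'n::finite \<Rightarrow> real) \<Rightarrow> real^'n \<Rightarrow> real^'k" where
  "base_map S x = (\<chi> i. S [i] x)"

definition gen_series :: "('k::finite list \<Rightarrow> real^'n::finite \<Rightarrow> real) \<Rightarrow> real^'n \<Rightarrow> 'k mps" where
  "gen_series S x = tensor_series (\<lambda>is. S is x)"

definition thick_morphism_generating_function ::
  "(real^'n::finite) set \<Rightarrow> (real^'k::finite) set \<Rightarrow> ('k list \<Rightarrow> real^'n \<Rightarrow> real) \<Rightarrow> bool" where
  "thick_morphism_generating_function U V S \<longleftrightarrow>
     open U \<and> open V \<and> (\<forall>is. smooth_fun_on U (S is)) \<and>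
     (\<forall>is js. \<forall>x\<in>U. mset is = mset js \<longrightarrow> S is x = S js x) \<and>
     (\<forall>x\<in>U. base_map S x \<in> V)"

text \<open>The system determining \<open>(\<bar>y, \<bar>q)\<close> as power series in \<open>q'\<close>, at the point \<open>x = x(x')\<close>;
  \<open>y'\<close> is the map from old to new coordinates. The conditions on constant terms are those
  under which the substitutions and Taylor expansions make sense.\<close>

definition coordinate_system_solution ::
  "('k::finite list \<Rightarrow> real^'n::finite \<Rightarrow> real) \<Rightarrow> (real^'k \<Rightarrow> real^'k) \<Rightarrow> real^'n \<Rightarrow>
   ('k \<Rightarrow> 'k mps) \<times> ('k \<Rightarrow> 'k mps) \<Rightarrow> bool" where
  "coordinate_system_solution S y' x = (\<lambda>(ybar, qbar).
     (\<forall>\<alpha>. mps_coeff (ybar \<alpha>) {#} = base_map S x $ \<alpha>) \<and>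
     (\<forall>\<alpha>. mps_coeff (qbar \<alpha>) {#} = 0) \<and>
     (\<forall>\<alpha>. qbar \<alpha> = (\<Sum>\<alpha>'\<in>UNIV.
        taylor_expand (pderiv_at \<alpha> (\<lambda>y. y' y $ \<alpha>')) (base_map S x) ybar * mps_var \<alpha>')) \<and>
     (\<forall>\<alpha>. ybar \<alpha> = mps_compose (mps_deriv \<alpha> (gen_series S x)) qbar))"

definition new_generating_function ::
  "('k::finite list \<Rightarrow> real^'n::finite \<Rightarrow> real) \<Rightarrow> (real^'n \<Rightarrow> real^'n) \<Rightarrow> (real^'k \<Rightarrow> real^'k) \<Rightarrow>
   real^'n \<Rightarrow> 'k mps" where
  "new_generating_function S x y' x' =
     (let (ybar, qbar) = (THE p. coordinate_system_solution S y' (x x') p) in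
       mps_compose (gen_series S (x x')) qbar
       + (\<Sum>\<alpha>'\<in>UNIV. taylor_expand (\<lambda>y. y' y $ \<alpha>') (base_map S (x x')) ybar * mps_var \<alpha>')
       - (\<Sum>\<alpha>\<in>UNIV. ybar \<alpha> * qbar \<alpha>))"


section \<open>Bipartite trees\<close>

text \<open>Vertices are integers: black ones positive, white ones negative.\<close>

datatype bigraph = Bigraph (nblack: nat) (nwhite: nat) (bedges: "(int \<times> int) multiset")

definition blacks :: "bigraph \<Rightarrow> int set" where
  "blacks t = {1..int (nblack t)}"

definition whites :: "bigraph \<Rightarrow> int set" where
  "whites t = {- int (nwhite t)..-1}"

definition wf_bigraph :: "bigraph \<Rightarrow> bool" where
  "wf_bigraph t \<longleftrightarrow> set_mset (bedges t) \<subseteq> blacks t \<times> whites t"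

definition adjacency :: "bigraph \<Rightarrow> (int \<times> int) set" where
  "adjacency t = {(u, v). (u, v) \<in># bedges t \<or> (v, u) \<in># bedges t}"

definition connected_bigraph :: "bigraph \<Rightarrow> bool" where
  "connected_bigraph t \<longleftrightarrow>
     (\<forall>u \<in> blacks t \<union> whites t. \<forall>v \<in> blacks t \<union> whites t. (u, v) \<in> (adjacency t)\<^sup>*)"

text \<open>A cycle is given by its cyclic sequence of distinct vertices. The edge joining \<open>u\<close> and
  \<open>v\<close> is \<open>(max u v, min u v)\<close>; as multiplicities count, two vertices joined by a multiple
  edge form a cycle of length 2, whereas a simple edge traversed back and forth does not.\<close>

definition is_cycle :: "bigraph \<Rightarrow> int list \<Rightarrow> bool" where
  "is_cycle t vs \<longleftrightarrow> 2 \<le> length vs \<and> distinct vs \<and>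
     mset (map (\<lambda>(u, v). (max u v, min u v)) (zip vs (rotate1 vs))) \<subseteq># bedges t"

definition bitree :: "bigraph \<Rightarrow> bool" where
  "bitree t \<longleftrightarrow> wf_bigraph t \<and> blacks t \<union> whites t \<noteq> {} \<and>
     connected_bigraph t \<and> (\<nexists>vs. is_cycle t vs)"

definition incident :: "bigraph \<Rightarrow> int \<Rightarrow> (int \<times> int) multiset" where
  "incident t v = {# e \<in># bedges t. fst e = v \<or> snd e = v #}"

definition vdegree :: "bigraph \<Rightarrow> int \<Rightarrow> nat" where
  "vdegree t v = size (incident t v)"

definition Tcirc :: "bigraph set" where
  "Tcirc = {t. bitree t \<and> (\<forall>v \<in> blacks t \<union> whites t. vdegree t v = 1 \<longrightarrow> v \<in> whites t)}"

definition bigraph_isos :: "bigraph \<Rightarrow> bigraph \<Rightarrow> ((int \<Rightarrow> int) \<times> (int \<Rightarrow> int)) set" where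
  "bigraph_isos s t = {(\<sigma>, \<tau>). nblack s = nblack t \<and> nwhite s = nwhite t \<and>
     \<sigma> permutes blacks s \<and> \<tau> permutes whites s \<and>
     image_mset (map_prod \<sigma> \<tau>) (bedges s) = bedges t}"

definition sym_group :: "bigraph \<Rightarrow> ((int \<Rightarrow> int) \<times> (int \<Rightarrow> int)) set" where
  "sym_group t = bigraph_isos t t"

definition Tcirc_iso :: "(bigraph \<times> bigraph) set" where
  "Tcirc_iso = {(s, t). s \<in> Tcirc \<and> t \<in> Tcirc \<and> bigraph_isos s t \<noteq> {}}"


section \<open>The contribution of a tree\<close>

text \<open>An enumeration \<open>e\<^sup>v\<^sub>1, \<dots>, e\<^sup>v\<^sub>m\<close> of the edges at \<open>v\<close>. Its order is immaterial below, since the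
  coefficients of \<open>S\<close> are symmetric and partial derivatives of smooth functions commute.\<close>

definition edge_list :: "bigraph \<Rightarrow> int \<Rightarrow> (int \<times> int) list" where
  "edge_list t v = (SOME es. mset es = incident t v)"

text \<open>\<open>\<langle>S, y'; t\<rangle>\<close> at \<open>x = x(x')\<close> with white labels \<open>a\<close>. Each edge carries an index \<open>e\<close> that is
  summed over; a tree has no multiple edges, so edges are the elements of \<open>set_mset (bedges t)\<close>.\<close>

definition tree_bracket ::
  "('k::finite list \<Rightarrow> real^'n::finite \<Rightarrow> real) \<Rightarrow> (real^'k \<Rightarrow> real^'k) \<Rightarrow> bigraph \<Rightarrow>
   (int \<Rightarrow> 'k) \<Rightarrow> real^'n \<Rightarrow> real" where
  "tree_bracket S y' t a x =
     (\<Sum>e \<in> set_mset (bedges t) \<rightarrow>\<^sub>E UNIV.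
        (\<Prod>v\<in>blacks t. fact (vdegree t v) * S (map e (edge_list t v)) x) *
        (\<Prod>w\<in>whites t. pderivs (map e (edge_list t w)) (\<lambda>y. y' y $ a w) (base_map S x)))"

text \<open>\<open>q'\<^sub>\<alpha>\<^sub>t \<langle>S, y'; t\<rangle>\<^sup>\<alpha>\<^sup>t\<close>, summed over the labels of the white vertices.\<close>

definition tree_term ::
  "('k::finite list \<Rightarrow> real^'n::finite \<Rightarrow> real) \<Rightarrow> (real^'k \<Rightarrow> real^'k) \<Rightarrow> bigraph \<Rightarrow>
   real^'n \<Rightarrow> 'k mps" where
  "tree_term S y' t x =
     (\<Sum>a \<in> whites t \<rightarrow>\<^sub>E UNIV. mps_const (tree_bracket S y' t a x) * (\<Prod>w\<in>whites t. mps_var (a w)))"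

end

theory Submission
  imports Defs "HOL-Combinatorics.Multiset_Permutations"
begin

text \<open>Put \<open>\<phi> = base_map S x\<close>, \<open>y = \<phi> + z\<close> and \<open>S(q) = S\<^sub>0 + \<phi> q + R(q)\<close>, where \<open>R\<close> has order at least two,
  and let \<open>f(z)\<close> be the Taylor series of \<open>y'(\<phi> + z) q'\<close>. Then \<open>S' - S\<^sub>0\<close> is the value of
  \<open>R(q) + f(z) - z q\<close> at the solution of \<open>z = dR/dq\<close>, \<open>q = df/dz\<close>. Expanding this fixed-point system
  produces trees: \<open>z\<close> is the exponential generating function of trees with a black root that
  carries one free index, \<open>q\<close> that of trees with a white root carrying one free index, and
  \<open>R(q)\<close>, \<open>f(z)\<close>, \<open>z q\<close> enumerate trees with a marked black vertex, a marked white vertex and a marked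
  edge. As a tree has one more vertex than edges, \<open>R(q) + f(z) - z q\<close> counts each tree once
  (\<open>dissymmetry\<close>), and \<open>S\<^sub>0\<close> is the contribution of the isolated black
  vertex. Black leaves do not occur because \<open>R\<close> has no terms of order below two.

  All enumeration is reduced to one bijection, the cutting of a tree along an edge into two trees
  on complementary vertex sets (\<open>sum_trees_with_marked_edge\<close>), under which the weights factorise
  (\<open>wt_join\<close>) and the exponential generating functions multiply (\<open>egf_mult\<close>). Cutting at an edge of
  the root relates root degree \<open>d + 1\<close> to root degree \<open>d\<close>; by induction on \<open>d\<close> the rooted series are
  the Taylor expansions above (\<open>rooted_gf_words\<close>), so the trees solve the system (\<open>trees_solve\<close>).
  The solution is unique because the coefficients are determined degree by degree
  (\<open>solution_unique\<close>).

  Indices are collected in multisets throughout. This is legitimate because the coefficients of \<open>S\<close>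
  are symmetric by assumption and the partial derivatives of \<open>y'\<close> by the theorem on mixed second
  derivatives (\<open>pderiv_at_commute\<close>). The formula over isomorphism classes follows from the
  labelled one by counting the orbits of the vertex permutations (\<open>card_iso_class\<close>).\<close>

section \<open>Formal power series and formal sums\<close>

lemma coeff_Abs_mps [simp]: "mps_coeff (Abs_mps f) = f"
  by (simp add: Abs_mps_inverse)

lemma coeff_zero [simp]: "mps_coeff 0 \<mu> = 0"
  by transfer simp

lemma coeff_one: "mps_coeff 1 \<mu> = (if \<mu> = {#} then 1 else 0)"
  by transfer simp

lemma coeff_add [simp]: "mps_coeff (f + g) \<mu> = mps_coeff f \<mu> + mps_coeff g \<mu>"
  by transfer simp

lemma coeff_diff [simp]: "mps_coeff (f - g) \<mu> = mps_coeff f \<mu> - mps_coeff g \<mu>"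
  by transfer simp

lemma coeff_mult:
  "mps_coeff (f * g) \<mu> = (\<Sum>p | fst p + snd p = \<mu>. mps_coeff f (fst p) * mps_coeff g (snd p))"
  by transfer simp

lemma coeff_const: "mps_coeff (mps_const c) \<mu> = (if \<mu> = {#} then c else 0)"
  by transfer simp

lemma coeff_var: "mps_coeff (mps_var i) \<mu> = (if \<mu> = {#i#} then 1 else 0)"
  by transfer simp

lemma coeff_deriv: "mps_coeff (mps_deriv i f) \<mu> = real (Suc (count \<mu> i)) * mps_coeff f (add_mset i \<mu>)"
  by transfer simp

lemma coeff_sum [simp]: "mps_coeff (\<Sum>x\<in>A. f x) \<mu> = (\<Sum>x\<in>A. mps_coeff (f x) \<mu>)"
  by (induction A rule: infinite_finite_induct) auto

lemma coeff_const_mult [simp]: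
  fixes f :: "'v mps"
  shows "mps_coeff (mps_const c * f) \<mu> = c * mps_coeff f \<mu>"
proof -
  have "mps_coeff (mps_const c * f) \<mu>
      = (\<Sum>p\<in>{({#} :: 'v multiset, \<mu>)}. mps_coeff (mps_const c) (fst p) * mps_coeff f (snd p))"
    unfolding coeff_mult by (rule sum.mono_neutral_right) (auto simp: finite_splits coeff_const)
  then show ?thesis by (simp add: coeff_const)
qed

lemma mps_const_add: "mps_const (a + b) = mps_const a + mps_const b"
  by (rule mps_eqI) (simp add: coeff_const)

lemma mps_const_mult: "mps_const (a * b) = mps_const a * mps_const b"
  by (rule mps_eqI) (simp add: coeff_const)

lemma mps_const_0 [simp]: "mps_const 0 = 0"
  by (rule mps_eqI) (simp add: coeff_const)

lemma mps_const_1 [simp]: "mps_const 1 = 1"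
  by (rule mps_eqI) (simp add: coeff_const coeff_one)

lemma mps_const_sum: "mps_const (\<Sum>x\<in>A. f x) = (\<Sum>x\<in>A. mps_const (f x))"
  by (induction A rule: infinite_finite_induct) (auto simp: mps_const_add)

lemma mps_const_prod: "mps_const (\<Prod>x\<in>A. f x) = (\<Prod>x\<in>A. mps_const (f x))"
  by (induction A rule: infinite_finite_induct) (auto simp: mps_const_mult)

lemma mps_const_of_nat: "mps_const (of_nat n) = of_nat n"
  by (induction n) (auto simp: mps_const_add)

text \<open>All sums of power series below are coefficientwise finite, so each fact about formal sums
  is a fact about finitely supported sums of reals.\<close>

definition fin_sum :: "('a \<Rightarrow> real) \<Rightarrow> 'a set \<Rightarrow> real \<Rightarrow> bool" where
  "fin_sum f A s \<longleftrightarrow> finite {t \<in> A. f t \<noteq> 0} \<and> s = (\<Sum>t | t \<in> A \<and> f t \<noteq> 0. f t)"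

lemma formal_has_sum_iff:
  "formal_has_sum f A s \<longleftrightarrow> (\<forall>\<mu>. fin_sum (\<lambda>t. mps_coeff (f t) \<mu>) A (mps_coeff s \<mu>))"
proof
  assume "formal_has_sum f A s"
  then show "\<forall>\<mu>. fin_sum (\<lambda>t. mps_coeff (f t) \<mu>) A (mps_coeff s \<mu>)"
    by (simp add: formal_has_sum_def formally_summable_def formal_sum_def fin_sum_def)
next
  assume *: "\<forall>\<mu>. fin_sum (\<lambda>t. mps_coeff (f t) \<mu>) A (mps_coeff s \<mu>)"
  then have "s = formal_sum f A"
    by (intro mps_eqI) (simp add: formal_sum_def fin_sum_def)
  with * show "formal_has_sum f A s"
    by (simp add: formal_has_sum_def formally_summable_def fin_sum_def)
qed

lemma fin_sumI:
  assumes "finite F" "F \<subseteq> A" "\<And>t. t \<in> A \<Longrightarrow> t \<notin> F \<Longrightarrow> f t = 0" "s = sum f F"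
  shows "fin_sum f A s"
proof -
  have "{t \<in> A. f t \<noteq> 0} \<subseteq> F" using assms(3) by blast
  moreover have "sum f F = sum f {t \<in> A. f t \<noteq> 0}"
    by (rule sum.mono_neutral_right) (use assms in auto)
  ultimately show ?thesis
    using assms(1,4) by (auto simp: fin_sum_def intro: finite_subset)
qed

lemma fin_sumD:
  assumes "fin_sum f A s"
  shows "finite {t \<in> A. f t \<noteq> 0}" "s = sum f {t \<in> A. f t \<noteq> 0}"
  using assms by (auto simp: fin_sum_def)

lemma fin_sum_superset:
  assumes "fin_sum f A s" "finite F" "{t \<in> A. f t \<noteq> 0} \<subseteq> F" "F \<subseteq> A"
  shows "s = sum f F"
  unfolding fin_sumD(2)[OF assms(1)] by (rule sum.mono_neutral_left) (use assms in auto)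

lemma fin_sum_reindex:
  assumes "bij_betw h A B"
  shows "fin_sum f B s \<longleftrightarrow> fin_sum (\<lambda>x. f (h x)) A s"
proof -
  have im: "{t \<in> B. f t \<noteq> 0} = h ` {t \<in> A. f (h t) \<noteq> 0}"
    using assms by (auto simp: bij_betw_def)
  have inj: "inj_on h {t \<in> A. f (h t) \<noteq> 0}"
    using assms by (auto simp: bij_betw_def inj_on_def)
  show ?thesis
    unfolding fin_sum_def im by (simp add: finite_image_iff inj sum.reindex)
qed

lemma fin_sum_Sigma:
  assumes "fin_sum f (Sigma A B) s"
    and "\<And>a. a \<in> A \<Longrightarrow> fin_sum (\<lambda>b. f (a, b)) (B a) (g a)"
  shows "fin_sum g A s"
proof -
  let ?N = "{t \<in> Sigma A B. f t \<noteq> 0}"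
  let ?F = "fst ` ?N"
  have fN: "finite ?N" using fin_sumD(1)[OF assms(1)] .
  define C where "C a = {b \<in> B a. f (a, b) \<noteq> 0}" for a
  have fC: "finite (C a)" if "a \<in> A" for a
    using fin_sumD(1)[OF assms(2)[OF that]] by (simp add: C_def)
  have gC: "g a = (\<Sum>b\<in>C a. f (a, b))" if "a \<in> A" for a
    using fin_sumD(2)[OF assms(2)[OF that]] by (simp add: C_def)
  have N: "?N = Sigma ?F C" by (force simp: C_def)
  have sub: "?F \<subseteq> A" by auto
  have "s = sum f (Sigma ?F C)" using fin_sumD(2)[OF assms(1)] N by simp
  also have "\<dots> = (\<Sum>a\<in>?F. \<Sum>b\<in>C a. f (a, b))"
    by (subst sum.Sigma) (use fN fC in auto)
  also have "\<dots> = sum g ?F" by (rule sum.cong) (use gC in auto)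
  finally show ?thesis
  proof (intro fin_sumI[of ?F])
    fix a assume "a \<in> A" "a \<notin> ?F"
    then have "C a = {}" by (force simp: C_def)
    then show "g a = 0" using gC \<open>a \<in> A\<close> by simp
  qed (use fN in auto)
qed

lemma formal_has_sum_unique:
  "formal_has_sum f A s \<Longrightarrow> formal_has_sum f A t \<Longrightarrow> s = t"
  by (simp add: formal_has_sum_def)

lemma formal_has_sum_summable:
  "formally_summable f A \<Longrightarrow> formal_has_sum f A (formal_sum f A)"
  by (simp add: formal_has_sum_def)

lemma formal_has_sum_cong:
  assumes "\<And>t. t \<in> A \<Longrightarrow> f t = g t" "formal_has_sum f A s"
  shows "formal_has_sum g A s"
proof -
  have "{t \<in> A. mps_coeff (g t) \<mu> \<noteq> 0} = {t \<in> A. mps_coeff (f t) \<mu> \<noteq> 0}" for \<mu>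
    using assms(1) by auto
  moreover have "(\<Sum>t | t \<in> A \<and> mps_coeff (g t) \<mu> \<noteq> 0. mps_coeff (g t) \<mu>)
      = (\<Sum>t | t \<in> A \<and> mps_coeff (f t) \<mu> \<noteq> 0. mps_coeff (f t) \<mu>)" for \<mu>
    by (rule sum.cong) (use assms(1) in auto)
  ultimately show ?thesis using assms(2) by (simp add: formal_has_sum_iff fin_sum_def)
qed

lemma formal_has_sum_reindex:
  assumes "bij_betw h A B"
  shows "formal_has_sum f B s \<longleftrightarrow> formal_has_sum (\<lambda>x. f (h x)) A s"
  unfolding formal_has_sum_iff by (subst fin_sum_reindex[OF assms]) simp

lemma formal_has_sum_Sigma:
  assumes "formal_has_sum f (Sigma A B) s"
    and "\<And>a. a \<in> A \<Longrightarrow> formal_has_sum (\<lambda>b. f (a, b)) (B a) (g a)"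
  shows "formal_has_sum g A s"
  unfolding formal_has_sum_iff
proof
  fix \<mu>
  show "fin_sum (\<lambda>t. mps_coeff (g t) \<mu>) A (mps_coeff s \<mu>)"
    by (rule fin_sum_Sigma[of "\<lambda>t. mps_coeff (f t) \<mu>" A B]) (use assms in \<open>auto simp: formal_has_sum_iff\<close>)
qed

lemma formal_has_sum_finite: "finite A \<Longrightarrow> formal_has_sum f A (sum f A)"
  unfolding formal_has_sum_iff by (auto intro!: fin_sumI[of A])

lemma formal_has_sum_neutral:
  assumes "B \<subseteq> A" "\<And>t. t \<in> A - B \<Longrightarrow> f t = 0"
  shows "formal_has_sum f A s \<longleftrightarrow> formal_has_sum f B s"
proof -
  have "{t \<in> A. mps_coeff (f t) \<mu> \<noteq> 0} = {t \<in> B. mps_coeff (f t) \<mu> \<noteq> 0}" for \<mu>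
    using assms by force
  then show ?thesis by (simp add: formal_has_sum_iff fin_sum_def)
qed

lemma formal_has_sum_add:
  assumes "formal_has_sum f A s" "formal_has_sum g A t"
  shows "formal_has_sum (\<lambda>x. f x + g x) A (s + t)"
  unfolding formal_has_sum_iff
proof
  fix \<mu>
  let ?f = "\<lambda>t. mps_coeff (f t) \<mu>" and ?g = "\<lambda>t. mps_coeff (g t) \<mu>"
  let ?F = "{x\<in>A. ?f x \<noteq> 0} \<union> {x\<in>A. ?g x \<noteq> 0}"
  have f: "fin_sum ?f A (mps_coeff s \<mu>)" and g: "fin_sum ?g A (mps_coeff t \<mu>)"
    using assms by (auto simp: formal_has_sum_iff)
  have fin: "finite ?F" using fin_sumD(1)[OF f] fin_sumD(1)[OF g] by simp
  have "mps_coeff s \<mu> = sum ?f ?F" "mps_coeff t \<mu> = sum ?g ?F"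
    by (rule fin_sum_superset[OF f fin], auto) (rule fin_sum_superset[OF g fin], auto)
  then show "fin_sum (\<lambda>x. mps_coeff (f x + g x) \<mu>) A (mps_coeff (s + t) \<mu>)"
    by (intro fin_sumI[OF fin]) (auto simp: sum.distrib)
qed

lemma formal_has_sum_sum:
  assumes "finite K" "\<And>k. k \<in> K \<Longrightarrow> formal_has_sum (f k) A (s k)"
  shows "formal_has_sum (\<lambda>x. \<Sum>k\<in>K. f k x) A (\<Sum>k\<in>K. s k)"
  using assms
proof (induction K rule: finite_induct)
  case empty
  show ?case unfolding formal_has_sum_iff by (auto intro!: fin_sumI[of "{}"])
next
  case (insert k K)
  then show ?case by (simp add: formal_has_sum_add)
qed

text \<open>A coefficient of a product involves finitely many splittings of its exponent, and for each of
  them only finitely many pairs of terms.\<close>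

lemma formal_has_sum_mult:
  fixes f :: "'a \<Rightarrow> 'c mps" and g :: "'b \<Rightarrow> 'c mps"
  assumes "formal_has_sum f A s" "formal_has_sum g B t"
  shows "formal_has_sum (\<lambda>(a, b). f a * g b) (A \<times> B) (s * t)"
  unfolding formal_has_sum_iff
proof
  fix \<mu> :: "'c multiset"
  let ?P = "{p :: 'c multiset \<times> 'c multiset. fst p + snd p = \<mu>}"
  let ?f = "\<lambda>\<nu> x. mps_coeff (f x) \<nu>" and ?g = "\<lambda>\<nu> x. mps_coeff (g x) \<nu>"
  define F where "F = (\<Union>p\<in>?P. {x\<in>A. ?f (fst p) x \<noteq> 0})"
  define G where "G = (\<Union>p\<in>?P. {x\<in>B. ?g (snd p) x \<noteq> 0})"
  have f: "fin_sum (?f \<nu>) A (mps_coeff s \<nu>)" and g: "fin_sum (?g \<nu>) B (mps_coeff t \<nu>)" for \<nu>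
    using assms by (auto simp: formal_has_sum_iff)
  have fin: "finite F" "finite G"
    using fin_sumD(1)[OF f] fin_sumD(1)[OF g] by (auto simp: F_def G_def finite_splits)
  have sub: "F \<subseteq> A" "G \<subseteq> B" by (auto simp: F_def G_def)
  have sf: "mps_coeff s (fst p) = sum (?f (fst p)) F" if "p \<in> ?P" for p
    by (rule fin_sum_superset[OF f fin(1) _ sub(1)]) (use that in \<open>auto simp: F_def\<close>)
  have sg: "mps_coeff t (snd p) = sum (?g (snd p)) G" if "p \<in> ?P" for p
    by (rule fin_sum_superset[OF g fin(2) _ sub(2)]) (use that in \<open>auto simp: G_def\<close>)
  have "mps_coeff (s * t) \<mu> = (\<Sum>p\<in>?P. (\<Sum>a\<in>F. ?f (fst p) a) * (\<Sum>b\<in>G. ?g (snd p) b))"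
    unfolding coeff_mult by (rule sum.cong) (auto simp: sf sg)
  also have "\<dots> = (\<Sum>p\<in>?P. \<Sum>x\<in>F\<times>G. ?f (fst p) (fst x) * ?g (snd p) (snd x))"
    by (simp add: sum_product sum.cartesian_product case_prod_unfold)
  also have "\<dots> = (\<Sum>x\<in>F\<times>G. \<Sum>p\<in>?P. ?f (fst p) (fst x) * ?g (snd p) (snd x))"
    by (rule sum.swap)
  also have "\<dots> = (\<Sum>x\<in>F\<times>G. mps_coeff (f (fst x) * g (snd x)) \<mu>)"
    by (simp add: coeff_mult)
  finally have eq: "mps_coeff (s * t) \<mu> = (\<Sum>x\<in>F\<times>G. mps_coeff (f (fst x) * g (snd x)) \<mu>)" .
  show "fin_sum (\<lambda>x. mps_coeff (case x of (a, b) \<Rightarrow> f a * g b) \<mu>) (A \<times> B) (mps_coeff (s * t) \<mu>)"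
  proof (rule fin_sumI[of "F \<times> G"])
    fix x assume x: "x \<in> A \<times> B" "x \<notin> F \<times> G"
    obtain a b where [simp]: "x = (a, b)" by force
    have "?f (fst p) a * ?g (snd p) b = 0" if "p \<in> ?P" for p
      using x that by (auto simp: F_def G_def)
    then show "mps_coeff (case x of (a, b) \<Rightarrow> f a * g b) \<mu> = 0"
      unfolding \<open>x = (a, b)\<close> prod.case coeff_mult by (intro sum.neutral) auto
  qed (use fin sub eq in \<open>auto simp: case_prod_unfold\<close>)
qed

lemma formal_has_sum_cmult:
  assumes "formal_has_sum f A s"
  shows "formal_has_sum (\<lambda>x. c * f x) A (c * s)"
proof -
  have "formal_has_sum (\<lambda>(u, x). c * f x) ({()} \<times> A) (c * s)"
    using formal_has_sum_mult[OF formal_has_sum_finite[of "{()}" "\<lambda>_. c"] assms] by simp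
  moreover have "bij_betw (\<lambda>x. ((), x)) A ({()} \<times> A)"
    by (auto simp: bij_betw_def inj_on_def)
  ultimately show ?thesis
    using formal_has_sum_reindex[of "\<lambda>x. ((), x)" A "{()} \<times> A" "\<lambda>(u, x). c * f x" "c * s"] by simp
qed

lemma formal_has_sum_diff:
  assumes "formal_has_sum f A s" "formal_has_sum g A t"
  shows "formal_has_sum (\<lambda>x. f x - g x) A (s - t)"
  using formal_has_sum_add[OF assms(1) formal_has_sum_cmult[OF assms(2), of "- 1"]] by simp


section \<open>Substitution into power series given by tensors\<close>

definition no_const :: "('v \<Rightarrow> 'w mps) \<Rightarrow> bool" where
  "no_const g \<longleftrightarrow> (\<forall>i. mps_coeff (g i) {#} = 0)"

lemma coeff_prod_list_eq_0:
  assumes "no_const g" "size \<mu> < length is"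
  shows "mps_coeff (\<Prod>i\<leftarrow>is. g i) \<mu> = 0"
  using assms(2)
proof (induction "is" arbitrary: \<mu>)
  case (Cons i "is")
  have "mps_coeff (g i) (fst p) * mps_coeff (\<Prod>i\<leftarrow>is. g i) (snd p) = 0" if "fst p + snd p = \<mu>" for p
  proof (cases "fst p = {#}")
    case True
    then show ?thesis using assms(1) by (simp add: no_const_def)
  next
    case False
    then have "size (snd p) < size \<mu>" using that by (auto simp: nonempty_has_size)
    then show ?thesis using Cons by simp
  qed
  then show ?case
    unfolding list.map prod_list.Cons coeff_mult by (intro sum.neutral) auto
qed simp

lemma formally_summable_words:
  fixes g :: "'v::finite \<Rightarrow> 'w mps"
  assumes "no_const g"
  shows "formally_summable (\<lambda>is. mps_const (T is) * (\<Prod>i\<leftarrow>is. g i)) UNIV"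
  unfolding formally_summable_def
proof
  fix \<mu>
  have "{is. mps_coeff (mps_const (T is) * (\<Prod>i\<leftarrow>is. g i)) \<mu> \<noteq> 0} \<subseteq> {is. set is \<subseteq> UNIV \<and> length is \<le> size \<mu>}"
    using coeff_prod_list_eq_0[OF assms] by (auto simp: not_less[symmetric])
  then show "finite {t \<in> UNIV. mps_coeff (mps_const (T t) * (\<Prod>i\<leftarrow>t. g i)) \<mu> \<noteq> 0}"
    using finite_lists_length_le[of "UNIV :: 'v set" "size \<mu>"] by (auto intro: finite_subset)
qed

lemma finite_words: "finite {is. mset is = \<mu>}"
  using finite_permutations_of_multiset[of \<mu>] by (simp add: permutations_of_multiset_def)

lemma finite_words_length: "finite {is :: 'v::finite list. length is = d}"
  using finite_lists_length_eq[of "UNIV :: 'v set" d] by simp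

text \<open>All words with the same underlying multiset give the same monomial, so summation over words
  absorbs the multiplicities in the coefficients of a tensor series.\<close>

theorem compose_tensor_series:
  fixes g :: "'v::finite \<Rightarrow> 'w mps"
  assumes "no_const g"
  shows "formal_has_sum (\<lambda>is. mps_const (T is) * (\<Prod>i\<leftarrow>is. g i)) UNIV (mps_compose (tensor_series T) g)"
proof -
  let ?f = "\<lambda>is. mps_const (T is) * (\<Prod>i\<leftarrow>is. g i)"
  let ?s = "formal_sum ?f UNIV"
  have *: "formal_has_sum ?f UNIV ?s"
    by (rule formal_has_sum_summable[OF formally_summable_words[OF assms]])
  have bij: "bij_betw snd (Sigma UNIV (\<lambda>\<nu>. {is. mset is = \<nu>})) (UNIV :: 'v list set)"
    by (auto simp: bij_betw_def inj_on_def image_iff)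
  have "formal_has_sum (\<lambda>x. ?f (snd x)) (Sigma UNIV (\<lambda>\<nu>. {is. mset is = \<nu>})) ?s"
    using * by (rule formal_has_sum_reindex[OF bij, of ?f, THEN iffD1])
  then have "formal_has_sum (\<lambda>\<nu>. mps_const (mps_coeff (tensor_series T) \<nu>) * (\<Prod>i\<in>#\<nu>. g i)) UNIV ?s"
  proof (rule formal_has_sum_Sigma)
    fix \<nu> :: "'v multiset"
    have "mps_const (mps_coeff (tensor_series T) \<nu>) * (\<Prod>i\<in>#\<nu>. g i)
        = (\<Sum>is | mset is = \<nu>. mps_const (T is) * (\<Prod>i\<in>#\<nu>. g i))"
      by (simp add: tensor_series_def mps_const_sum sum_distrib_right)
    also have "\<dots> = (\<Sum>is | mset is = \<nu>. ?f is)"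
      by (rule sum.cong) (auto simp flip: prod_mset_prod_list)
    finally show "formal_has_sum (\<lambda>b. ?f (snd (\<nu>, b))) {is. mset is = \<nu>}
        (mps_const (mps_coeff (tensor_series T) \<nu>) * (\<Prod>i\<in>#\<nu>. g i))"
      by (simp add: formal_has_sum_finite finite_words)
  qed
  then have "mps_compose (tensor_series T) g = ?s"
    by (simp add: mps_compose_def formal_has_sum_def)
  with * show ?thesis by simp
qed

corollary compose_tensor_series_by_degree:
  fixes g :: "'v::finite \<Rightarrow> 'w mps"
  assumes "no_const g"
  shows "formal_has_sum (\<lambda>d. \<Sum>is | length is = d. mps_const (T is) * (\<Prod>i\<leftarrow>is. g i)) UNIV
           (mps_compose (tensor_series T) g)"
proof -
  let ?f = "\<lambda>is. mps_const (T is) * (\<Prod>i\<leftarrow>is. g i)"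
  have bij: "bij_betw snd (Sigma UNIV (\<lambda>d. {is. length is = d})) (UNIV :: 'v list set)"
    by (auto simp: bij_betw_def inj_on_def image_iff)
  have "formal_has_sum (\<lambda>x. ?f (snd x)) (Sigma UNIV (\<lambda>d. {is. length is = d})) (mps_compose (tensor_series T) g)"
    using compose_tensor_series[OF assms, of T]
    by (rule formal_has_sum_reindex[OF bij, of ?f, THEN iffD1])
  then show ?thesis
    by (rule formal_has_sum_Sigma) (simp add: formal_has_sum_finite finite_words_length)
qed

text \<open>Differentiating lowers the degree by one and each of the interchangeable index slots
  of a symmetric tensor contributes once.\<close>

lemma deriv_tensor_series:
  fixes i :: 'v
  assumes sym: "\<And>is js. mset is = mset js \<Longrightarrow> T is = T js"
  shows "mps_deriv i (tensor_series T) = tensor_series (\<lambda>is. real (Suc (length is)) * T (i # is))"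
proof (rule mps_eqI)
  fix \<mu> :: "'v multiset"
  obtain xs where xs: "mset xs = \<mu>" using ex_mset by blast
  let ?p = "\<lambda>\<mu> :: 'v multiset. real (card {is. mset is = \<mu>})"
  have "(\<Sum>is | mset is = add_mset i \<mu>. T is) = (\<Sum>is | mset is = add_mset i \<mu>. T (i # xs))"
    by (rule sum.cong) (use xs in \<open>auto intro!: sym\<close>)
  then have 1: "mps_coeff (mps_deriv i (tensor_series T)) \<mu> = real (Suc (count \<mu> i)) * ?p (add_mset i \<mu>) * T (i # xs)"
    by (simp add: coeff_deriv tensor_series_def)
  have "T (i # is) = T (i # xs)" "length is = size \<mu>" if "mset is = \<mu>" for "is"
    using that xs by (auto intro!: sym)
  then have "(\<Sum>is | mset is = \<mu>. real (Suc (length is)) * T (i # is)) = (\<Sum>is | mset is = \<mu>. real (Suc (size \<mu>)) * T (i # xs))"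
    by (intro sum.cong) auto
  then have 2: "mps_coeff (tensor_series (\<lambda>is. real (Suc (length is)) * T (i # is))) \<mu>
      = real (Suc (size \<mu>)) * ?p \<mu> * T (i # xs)"
    by (simp add: tensor_series_def)
  have "card {is. mset is = add_mset i \<mu>} * Suc (count \<mu> i) = Suc (size \<mu>) * card {is. mset is = \<mu>}"
    using card_permutations_of_multiset_insert_aux[of \<mu> i] by (simp add: permutations_of_multiset_def)
  then have "real (Suc (count \<mu> i)) * ?p (add_mset i \<mu>) = real (Suc (size \<mu>)) * ?p \<mu>"
    by (metis mult.commute of_nat_mult)
  then show "mps_coeff (mps_deriv i (tensor_series T)) \<mu>
      = mps_coeff (tensor_series (\<lambda>is. real (Suc (length is)) * T (i # is))) \<mu>"
    using 1 2 by simp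
qed

section \<open>Bipartite trees on sets of integers\<close>

text \<open>Removing an edge from a tree on \<open>{1..n} \<union> {-m..-1}\<close> leaves trees on smaller vertex sets that
  need not be initial segments. Trees are therefore considered on an arbitrary set of integers,
  the sign of a vertex being its colour.\<close>

definition adj :: "(int \<times> int) set \<Rightarrow> (int \<times> int) set" where
  "adj E = {(u, v). (u, v) \<in> E \<or> (v, u) \<in> E}"

definition edges_on :: "int set \<Rightarrow> (int \<times> int) set" where
  "edges_on V = {(b, w). b \<in> V \<and> w \<in> V \<and> 0 < b \<and> \<not> 0 < w}"

definition edge :: "int \<Rightarrow> int \<Rightarrow> int \<times> int" where
  "edge u v = (max u v, min u v)"

text \<open>Acyclicity is required in the form that every edge is a bridge, because this is what cutting and
  joining along an edge preserve.\<close>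

definition tree :: "int set \<Rightarrow> (int \<times> int) set \<Rightarrow> bool" where
  "tree V E \<longleftrightarrow> finite V \<and> V \<noteq> {} \<and> E \<subseteq> edges_on V \<and>
     (\<forall>u\<in>V. \<forall>v\<in>V. (u, v) \<in> (adj E)\<^sup>*) \<and> (\<forall>u v. (u, v) \<in> E \<longrightarrow> (u, v) \<notin> (adj (E - {(u, v)}))\<^sup>*)"

definition trees :: "int set \<Rightarrow> (int \<times> int) set set" where
  "trees V = {E. tree V E}"

definition inc :: "(int \<times> int) set \<Rightarrow> int \<Rightarrow> (int \<times> int) set" where
  "inc E v = {e \<in> E. fst e = v \<or> snd e = v}"

lemma finite_edges_on: "finite V \<Longrightarrow> finite (edges_on V)"
  by (rule finite_subset[of _ "V \<times> V"]) (auto simp: edges_on_def)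

lemma finite_trees: "finite (trees V)"
proof (cases "finite V")
  case True
  then show ?thesis
    by (intro finite_subset[of "trees V" "Pow (edges_on V)"]) (auto simp: trees_def tree_def finite_edges_on)
qed (auto simp: trees_def tree_def)

lemma tree_finite_edges: "tree V E \<Longrightarrow> finite E"
  unfolding tree_def by (meson finite_edges_on finite_subset)

lemma tree_edges_subset: "tree V E \<Longrightarrow> E \<subseteq> V \<times> V"
  unfolding tree_def edges_on_def by blast

lemma adj_rtrancl_sym: "(u, v) \<in> (adj E)\<^sup>* \<Longrightarrow> (v, u) \<in> (adj E)\<^sup>*"
proof -
  have "sym (adj E)" by (auto simp: adj_def sym_def)
  then show "(u, v) \<in> (adj E)\<^sup>* \<Longrightarrow> (v, u) \<in> (adj E)\<^sup>*" by (meson sym_rtrancl symD)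
qed

lemma rtrancl_map:
  assumes "(x, y) \<in> R\<^sup>*" "\<And>x y. (x, y) \<in> R \<Longrightarrow> (h x, h y) \<in> S\<^sup>*"
  shows "(h x, h y) \<in> S\<^sup>*"
  using assms(1) by induction (auto intro: assms(2) rtrancl_trans)

lemma rtrancl_closed:
  assumes "(x, y) \<in> R\<^sup>*" "x \<in> X" "\<And>x y. x \<in> X \<Longrightarrow> (x, y) \<in> R \<Longrightarrow> y \<in> X \<and> (x, y) \<in> S"
  shows "y \<in> X \<and> (x, y) \<in> S\<^sup>*"
  using assms(1) by induction (use assms(2,3) in \<open>auto intro: rtrancl_into_rtrancl\<close>)

lemma adj_mono: "E \<subseteq> F \<Longrightarrow> (adj E)\<^sup>* \<subseteq> (adj F)\<^sup>*"
  by (intro rtrancl_mono) (auto simp: adj_def)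

lemma edge_commute: "edge u v = edge v u"
  by (simp add: edge_def max.commute min.commute)

lemma edge_black_white: "0 < b \<Longrightarrow> \<not> 0 < w \<Longrightarrow> edge b w = (b, w)"
  by (simp add: edge_def)

lemma edge_in_treeD:
  assumes "tree V E" "edge r s \<in> E" "(0 < r) \<noteq> (0 < s)"
  shows "r \<in> V" "s \<in> V" "(r, s) \<notin> (adj (E - {edge r s}))\<^sup>*"
proof -
  have *: "edge r s = (r, s) \<or> edge r s = (s, r)" by (auto simp: edge_def)
  then show "r \<in> V" "s \<in> V" using tree_edges_subset[OF assms(1)] assms(2) by auto
  show "(r, s) \<notin> (adj (E - {edge r s}))\<^sup>*"
    using * assms(1,2) unfolding tree_def by (metis adj_rtrancl_sym)
qed

lemma tree_join:
  assumes T: "tree V1 E1" "tree V2 E2" and dis: "V1 \<inter> V2 = {}"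
    and bw: "b \<in> V1" "w \<in> V2" "0 < b" "\<not> 0 < w"
  shows "tree (V1 \<union> V2) (insert (b, w) (E1 \<union> E2))"
  unfolding tree_def
proof (intro conjI ballI allI impI)
  let ?E = "insert (b, w) (E1 \<union> E2)"
  note sub = tree_edges_subset[OF T(1)] tree_edges_subset[OF T(2)]
  show "finite (V1 \<union> V2)" "V1 \<union> V2 \<noteq> {}" using T by (auto simp: tree_def)
  show "?E \<subseteq> edges_on (V1 \<union> V2)" using T bw by (fastforce simp: tree_def edges_on_def)
  have c1: "(u, b) \<in> (adj ?E)\<^sup>*" if "u \<in> V1" for u
    using T(1) bw that adj_mono[of E1 ?E] unfolding tree_def by blast
  have c2: "(u, w) \<in> (adj ?E)\<^sup>*" if "u \<in> V2" for u
    using T(2) bw that adj_mono[of E2 ?E] unfolding tree_def by blast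
  have c: "(u, b) \<in> (adj ?E)\<^sup>*" if "u \<in> V1 \<union> V2" for u
  proof (cases "u \<in> V1")
    case False
    have "(w, b) \<in> (adj ?E)\<^sup>*" by (rule r_into_rtrancl) (simp add: adj_def)
    then show ?thesis using False that c2 by (blast intro: rtrancl_trans)
  qed (use c1 in auto)
  show "(u, v) \<in> (adj ?E)\<^sup>*" if "u \<in> V1 \<union> V2" "v \<in> V1 \<union> V2" for u v
    using c[OF that(1)] adj_rtrancl_sym[OF c[OF that(2)]] by (rule rtrancl_trans)
  fix u v assume uv: "(u, v) \<in> ?E"
  show "(u, v) \<notin> (adj (?E - {(u, v)}))\<^sup>*"
  proof
    assume A: "(u, v) \<in> (adj (?E - {(u, v)}))\<^sup>*"
    consider "(u, v) = (b, w)" | "(u, v) \<in> E1" "(u, v) \<noteq> (b, w)" | "(u, v) \<in> E2" "(u, v) \<noteq> (b, w)"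
      using uv by auto
    then show False
    proof cases
      case 1
      have "v \<in> V1 \<and> (u, v) \<in> UNIV\<^sup>*"
        by (rule rtrancl_closed[OF A]) (use 1 bw sub dis in \<open>auto simp: adj_def\<close>)
      then show False using 1 bw dis by auto
    next
      case 2
      \<comment> \<open>Collapsing the other component to the endpoint of the joining edge turns a walk around
        the edge into a walk inside this component.\<close>
      let ?h = "\<lambda>x. if x \<in> V2 then b else x"
      have "(?h u, ?h v) \<in> (adj (E1 - {(u, v)}))\<^sup>*"
        by (rule rtrancl_map[OF A]) (use 2 bw sub dis in \<open>auto simp: adj_def\<close>)
      then have "(u, v) \<in> (adj (E1 - {(u, v)}))\<^sup>*" using 2 sub dis by (auto split: if_splits)
      then show False using T(1) 2 unfolding tree_def by blast
    next
      case 3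
      let ?h = "\<lambda>x. if x \<in> V1 then w else x"
      have "(?h u, ?h v) \<in> (adj (E2 - {(u, v)}))\<^sup>*"
        by (rule rtrancl_map[OF A]) (use 3 bw sub dis in \<open>auto simp: adj_def\<close>)
      then have "(u, v) \<in> (adj (E2 - {(u, v)}))\<^sup>*" using 3 sub dis by (auto split: if_splits)
      then show False using T(2) 3 unfolding tree_def by blast
    qed
  qed
qed

lemma tree_join_edge:
  assumes T: "tree V1 E1" "tree V2 E2" and dis: "V1 \<inter> V2 = {}"
    and rs: "r \<in> V1" "s \<in> V2" "(0 < r) \<noteq> (0 < s)"
  shows "tree (V1 \<union> V2) (insert (edge r s) (E1 \<union> E2))"
proof (cases "0 < r")
  case True
  then show ?thesis using tree_join[OF T dis, of r s] rs by (simp add: edge_black_white)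
next
  case False
  then have "tree (V2 \<union> V1) (insert (edge s r) (E2 \<union> E1))"
    using tree_join[OF T(2,1), of s r] dis rs by (simp add: edge_black_white Int_commute)
  then show ?thesis by (simp add: Un_commute edge_commute)
qed

definition component :: "(int \<times> int) set \<Rightarrow> int \<Rightarrow> int set" where
  "component E r = {v. (r, v) \<in> (adj E)\<^sup>*}"

text \<open>Since \<open>E\<close> is connected, every vertex is still reachable from one of the two ends after the
  edge is removed, and from only one because the edge is a bridge.\<close>

lemma tree_split:
  assumes T: "tree V E" and e: "edge r s \<in> E" and opp: "(0 < r) \<noteq> (0 < s)"
  defines "V1 \<equiv> component (E - {edge r s}) r"
  shows "V1 \<subseteq> V" "r \<in> V1" "s \<in> V - V1" "tree V1 (E \<inter> V1 \<times> V1)" "tree (V - V1) (E \<inter> (V - V1) \<times> (V - V1))"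
    "E = insert (edge r s) ((E \<inter> V1 \<times> V1) \<union> (E \<inter> (V - V1) \<times> (V - V1)))"
proof -
  let ?F = "E - {edge r s}" and ?V2 = "V - V1"
  let ?E1 = "E \<inter> V1 \<times> V1" and ?E2 = "E \<inter> ?V2 \<times> ?V2"
  note sub = tree_edges_subset[OF T]
  have rs: "r \<in> V" "s \<in> V" and br: "(r, s) \<notin> (adj ?F)\<^sup>*" using edge_in_treeD[OF T e opp] by auto
  have e_cases: "edge r s = (r, s) \<or> edge r s = (s, r)" by (auto simp: edge_def)
  have adjF: "(u, v) \<in> adj ?F" if "(u, v) \<in> adj E" "(u, v) \<noteq> (r, s)" "(u, v) \<noteq> (s, r)" for u v
    using that e_cases by (auto simp: adj_def)
  have V1I: "(r, v) \<in> (adj ?F)\<^sup>* \<longleftrightarrow> v \<in> V1" for v by (simp add: V1_def component_def)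
  have closed: "u \<in> V1 \<longleftrightarrow> v \<in> V1" if "(u, v) \<in> adj ?F" for u v
  proof -
    have "(v, u) \<in> adj ?F" using that by (auto simp: adj_def)
    then show ?thesis using that unfolding V1I[symmetric] by (meson rtrancl_into_rtrancl)
  qed
  show "r \<in> V1" by (simp flip: V1I)
  have sV1: "s \<notin> V1" using br V1I by simp
  show "s \<in> V - V1" using sV1 rs by simp
  show V1V: "V1 \<subseteq> V"
  proof
    fix v assume "v \<in> V1"
    then have "(r, v) \<in> (adj ?F)\<^sup>*" by (simp add: V1I)
    then have "v \<in> V \<and> (r, v) \<in> UNIV\<^sup>*"
      by (rule rtrancl_closed) (use rs sub in \<open>auto simp: adj_def\<close>)
    then show "v \<in> V" by simp
  qed
  have Fsplit: "?F = ?E1 \<union> ?E2"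
  proof (intro equalityI subsetI)
    fix x assume x: "x \<in> ?F"
    obtain u v where [simp]: "x = (u, v)" by force
    have "(u, v) \<in> adj ?F" using x by (simp add: adj_def)
    then show "x \<in> ?E1 \<union> ?E2" using closed[of u v] x sub by auto
  next
    fix x assume x: "x \<in> ?E1 \<union> ?E2"
    then have "x \<noteq> edge r s" using e_cases sV1 \<open>r \<in> V1\<close> by auto
    then show "x \<in> ?F" using x by auto
  qed
  show "E = insert (edge r s) (?E1 \<union> ?E2)"
    unfolding Fsplit[symmetric] using e by blast
  have reach2: "v \<in> V1 \<or> (s, v) \<in> (adj ?F)\<^sup>*" if "v \<in> V" for v
  proof -
    have "(r, v) \<in> (adj E)\<^sup>*" using T rs that unfolding tree_def by blast
    then show ?thesis
    proof induction
      case base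
      then show ?case using \<open>r \<in> V1\<close> by simp
    next
      case (step y z)
      consider "(y, z) = (r, s)" | "(y, z) = (s, r)" | "(y, z) \<in> adj ?F" using adjF step(2) by blast
      then show ?case
      proof cases
        case 3
        then show ?thesis using step(3) closed rtrancl_into_rtrancl by metis
      qed (use \<open>r \<in> V1\<close> in auto)
    qed
  qed
  have c1: "(r, v) \<in> (adj ?E1)\<^sup>*" if "v \<in> V1" for v
  proof -
    have "(r, v) \<in> (adj ?F)\<^sup>*" using that by (simp add: V1I)
    then have "v \<in> V1 \<and> (r, v) \<in> (adj ?E1)\<^sup>*"
      by (rule rtrancl_closed) (use \<open>r \<in> V1\<close> closed in \<open>auto simp: adj_def\<close>)
    then show ?thesis by simp
  qed
  have c2: "(s, v) \<in> (adj ?E2)\<^sup>*" if "v \<in> ?V2" for v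
  proof -
    have "(s, v) \<in> (adj ?F)\<^sup>*" using that reach2 by auto
    then have "v \<in> ?V2 \<and> (s, v) \<in> (adj ?E2)\<^sup>*"
      by (rule rtrancl_closed) (use \<open>s \<in> V - V1\<close> closed sub in \<open>auto simp: adj_def\<close>)
    then show ?thesis by simp
  qed
  have bridge: "(u, v) \<notin> (adj (D - {(u, v)}))\<^sup>*" if "(u, v) \<in> D" "D \<subseteq> E" for u v D
  proof -
    have "(u, v) \<notin> (adj (E - {(u, v)}))\<^sup>*" using T that unfolding tree_def by blast
    then show ?thesis using adj_mono[of "D - {(u, v)}" "E - {(u, v)}"] that by blast
  qed
  show "tree V1 ?E1" unfolding tree_def
  proof (intro conjI ballI allI impI)
    show "finite V1" using V1V T by (auto simp: tree_def intro: finite_subset)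
    show "V1 \<noteq> {}" using \<open>r \<in> V1\<close> by auto
    show "?E1 \<subseteq> edges_on V1" using T by (auto simp: tree_def edges_on_def)
    show "(u, v) \<in> (adj ?E1)\<^sup>*" if "u \<in> V1" "v \<in> V1" for u v
      using adj_rtrancl_sym[OF c1[OF that(1)]] c1[OF that(2)] by (rule rtrancl_trans)
    show "(u, v) \<notin> (adj (?E1 - {(u, v)}))\<^sup>*" if "(u, v) \<in> ?E1" for u v
      using that by (rule bridge) auto
  qed
  show "tree ?V2 ?E2" unfolding tree_def
  proof (intro conjI ballI allI impI)
    show "finite ?V2" using T by (auto simp: tree_def)
    show "?V2 \<noteq> {}" using \<open>s \<in> V - V1\<close> by auto
    show "?E2 \<subseteq> edges_on ?V2" using T by (auto simp: tree_def edges_on_def)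
    show "(u, v) \<in> (adj ?E2)\<^sup>*" if "u \<in> ?V2" "v \<in> ?V2" for u v
      using adj_rtrancl_sym[OF c2[OF that(1)]] c2[OF that(2)] by (rule rtrancl_trans)
    show "(u, v) \<notin> (adj (?E2 - {(u, v)}))\<^sup>*" if "(u, v) \<in> ?E2" for u v
      using that by (rule bridge) auto
  qed
qed

lemma component_join:
  assumes T: "tree V1 E1" "tree V2 E2" and dis: "V1 \<inter> V2 = {}"
    and rs: "r \<in> V1" "s \<in> V2" "(0 < r) \<noteq> (0 < s)"
  shows "edge r s \<notin> E1" "edge r s \<notin> E2" "E1 \<inter> E2 = {}"
    "component (insert (edge r s) (E1 \<union> E2) - {edge r s}) r = V1"
    "insert (edge r s) (E1 \<union> E2) \<inter> V1 \<times> V1 = E1" "insert (edge r s) (E1 \<union> E2) \<inter> V2 \<times> V2 = E2"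
proof -
  note sub = tree_edges_subset[OF T(1)] tree_edges_subset[OF T(2)]
  have e_cases: "edge r s = (r, s) \<or> edge r s = (s, r)" by (auto simp: edge_def)
  show n: "edge r s \<notin> E1" "edge r s \<notin> E2" using e_cases sub dis rs by auto
  show "E1 \<inter> E2 = {}" using sub dis by auto
  show "insert (edge r s) (E1 \<union> E2) \<inter> V1 \<times> V1 = E1" "insert (edge r s) (E1 \<union> E2) \<inter> V2 \<times> V2 = E2"
    using e_cases sub dis rs by auto
  have "insert (edge r s) (E1 \<union> E2) - {edge r s} = E1 \<union> E2" using n by auto
  moreover have "component (E1 \<union> E2) r = V1"
  proof (intro equalityI subsetI)
    fix v assume "v \<in> component (E1 \<union> E2) r"
    then have "(r, v) \<in> (adj (E1 \<union> E2))\<^sup>*" by (simp add: component_def)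
    then have "v \<in> V1 \<and> (r, v) \<in> UNIV\<^sup>*"
      by (rule rtrancl_closed) (use rs sub dis in \<open>auto simp: adj_def\<close>)
    then show "v \<in> V1" by simp
  next
    fix v assume "v \<in> V1"
    then have "(r, v) \<in> (adj E1)\<^sup>*" using T(1) rs unfolding tree_def by blast
    then show "v \<in> component (E1 \<union> E2) r" using adj_mono[of E1 "E1 \<union> E2"] by (auto simp: component_def)
  qed
  ultimately show "component (insert (edge r s) (E1 \<union> E2) - {edge r s}) r = V1" by simp
qed

definition coloured :: "bool \<Rightarrow> int set \<Rightarrow> int set" where
  "coloured c V = {v \<in> V. (0 < v) = c}"

lemma finite_coloured [simp]: "finite V \<Longrightarrow> finite (coloured c V)"
  by (simp add: coloured_def)

definition marked_edges :: "bool \<Rightarrow> (int \<times> int) set \<Rightarrow> (int \<times> int) set" where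
  "marked_edges c E = {(r, s). edge r s \<in> E \<and> (0 < r) = c \<and> (0 < s) = (\<not> c)}"

lemma finite_marked_edges: 
  assumes "tree V E"
  shows "finite (marked_edges c E)"
proof (rule finite_subset)
  show "marked_edges c E \<subseteq> V \<times> V"
    using edge_in_treeD(1,2)[OF assms] by (auto simp: marked_edges_def)
  show "finite (V \<times> V)" using assms by (simp add: tree_def)
qed

text \<open>Cutting and joining are inverse to each other. This bijection is the only decomposition of
  trees on which the enumeration rests.\<close>

theorem sum_trees_with_marked_edge:
  fixes F :: "(int \<times> int) set \<Rightarrow> int \<Rightarrow> int \<Rightarrow> 'r :: comm_monoid_add"
  assumes "finite V"
  shows "(\<Sum>E\<in>trees V. \<Sum>(r, s)\<in>marked_edges c E. F E r s) =
    (\<Sum>V1\<in>Pow V. \<Sum>E1\<in>trees V1. \<Sum>E2\<in>trees (V - V1). \<Sum>r\<in>coloured c V1. \<Sum>s\<in>coloured (\<not> c) (V - V1).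
        F (insert (edge r s) (E1 \<union> E2)) r s)"
proof -
  let ?L = "Sigma (trees V) (marked_edges c)"
  let ?R = "Sigma (Pow V) (\<lambda>V1. trees V1 \<times> trees (V - V1) \<times> coloured c V1 \<times> coloured (\<not> c) (V - V1))"
  let ?f = "\<lambda>(E, r, s). let V1 = component (E - {edge r s}) r in
      (V1, E \<inter> V1 \<times> V1, E \<inter> (V - V1) \<times> (V - V1), r, s)"
  let ?g = "\<lambda>(V1, E1, E2, r, s). (insert (edge r s) (E1 \<union> E2), r, s)"
  have "(\<Sum>E\<in>trees V. \<Sum>(r, s)\<in>marked_edges c E. F E r s) = (\<Sum>(E, r, s)\<in>?L. F E r s)"
    by (subst sum.Sigma) (use finite_trees finite_marked_edges in \<open>auto simp: trees_def\<close>)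
  also have "\<dots> = (\<Sum>(V1, E1, E2, r, s)\<in>?R. F (insert (edge r s) (E1 \<union> E2)) r s)"
  proof (rule sum.reindex_bij_witness[of _ ?g ?f])
    fix x assume "x \<in> ?L"
    then obtain E r s where x: "x = (E, r, s)" "tree V E" "edge r s \<in> E" "(0 < r) = c" "(0 < s) = (\<not> c)"
      by (auto simp: trees_def marked_edges_def)
    then have o: "(0 < r) \<noteq> (0 < s)" by simp
    note sp = tree_split[OF x(2,3) o]
    show "?g (?f x) = x" using sp(6) by (simp add: x(1) Let_def)
    show "?f x \<in> ?R" using sp x(4,5) by (simp add: x(1) Let_def trees_def coloured_def)
    show "(case ?f x of (V1, E1, E2, r, s) \<Rightarrow> F (insert (edge r s) (E1 \<union> E2)) r s)
        = (case x of (E, r, s) \<Rightarrow> F E r s)"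
      using sp(6) by (simp add: x(1) Let_def)
  next
    fix x assume "x \<in> ?R"
    then obtain V1 E1 E2 r s where x: "x = (V1, E1, E2, r, s)" "V1 \<subseteq> V" "tree V1 E1" "tree (V - V1) E2"
      "r \<in> V1" "s \<in> V - V1" "(0 < r) = c" "(0 < s) = (\<not> c)"
      by (auto simp: trees_def coloured_def)
    then have o: "(0 < r) \<noteq> (0 < s)" by simp
    note sp = component_join[OF x(3,4) _ x(5,6) o]
    have "tree (V1 \<union> (V - V1)) (insert (edge r s) (E1 \<union> E2))"
      by (rule tree_join_edge[OF x(3,4) _ x(5,6) o]) auto
    moreover have "V1 \<union> (V - V1) = V" using x(2) by auto
    ultimately show "?g x \<in> ?L" using x(7,8) by (simp add: x(1) trees_def marked_edges_def)
    show "?f (?g x) = x"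
      using sp(4-6) unfolding x(1) prod.case Let_def by (simp del: insert_Diff_single Int_insert_left_if0 Int_insert_left_if1)
  qed
  also have "\<dots> = (\<Sum>V1\<in>Pow V. \<Sum>(E1, E2, r, s)\<in>trees V1 \<times> trees (V - V1) \<times> coloured c V1 \<times> coloured (\<not> c) (V - V1).
        F (insert (edge r s) (E1 \<union> E2)) r s)"
  proof (subst sum.Sigma)
    show "\<forall>V1\<in>Pow V. finite (trees V1 \<times> trees (V - V1) \<times> coloured c V1 \<times> coloured (\<not> c) (V - V1))"
      using assms by (auto simp: finite_trees dest: finite_subset intro!: finite_cartesian_product)
  qed (use assms in auto)
  also have "\<dots> = (\<Sum>V1\<in>Pow V. \<Sum>E1\<in>trees V1. \<Sum>E2\<in>trees (V - V1). \<Sum>r\<in>coloured c V1. \<Sum>s\<in>coloured (\<not> c) (V - V1).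
        F (insert (edge r s) (E1 \<union> E2)) r s)"
    by (simp only: sum.cartesian_product' prod.case)
  finally show ?thesis .
qed

lemma tree_no_edges: "tree V {} \<longleftrightarrow> (\<exists>v. V = {v})"
proof
  assume T: "tree V {}"
  then obtain v where v: "v \<in> V" by (auto simp: tree_def)
  have "u = v" if "u \<in> V" for u
  proof -
    have "(u, v) \<in> (adj {})\<^sup>*" using T v that by (simp add: tree_def)
    then show ?thesis by (simp add: adj_def)
  qed
  then show "\<exists>v. V = {v}" using v by blast
qed (auto simp: tree_def)

lemma tree_card: "tree V E \<Longrightarrow> card V = Suc (card E)"
proof (induction "card V" arbitrary: V E rule: less_induct)
  case less
  note T = less.prems
  have finV: "finite V" using T by (simp add: tree_def)
  show ?case
  proof (cases "E = {}")
    case True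
    then show ?thesis using T tree_no_edges by auto
  next
    case False
    then obtain b w where bw: "(b, w) \<in> E" by force
    then have c: "0 < b" "\<not> 0 < w" using T by (auto simp: tree_def edges_on_def)
    define V1 where "V1 = component (E - {edge b w}) b"
    have e: "edge b w \<in> E" "(0 < b) \<noteq> (0 < w)" using bw c by (auto simp: edge_black_white)
    note sp = tree_split[OF T e, folded V1_def]
    let ?E1 = "E \<inter> V1 \<times> V1" and ?E2 = "E \<inter> (V - V1) \<times> (V - V1)"
    have cV: "card V = card V1 + card (V - V1)"
      using sp(1) finV by (metis card_Diff_subset card_mono finite_subset le_add_diff_inverse)
    have "b \<in> V1" "w \<in> V - V1" using sp(2,3) by auto
    then have "V1 \<subset> V" "V - V1 \<subset> V" using sp(1) by auto
    then have 1: "card V1 = Suc (card ?E1)" "card (V - V1) = Suc (card ?E2)"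
      using less.hyps[OF psubset_card_mono[OF finV] sp(4)] less.hyps[OF psubset_card_mono[OF finV] sp(5)] by auto
    have "V1 \<inter> (V - V1) = {}" by auto
    note j = component_join[OF sp(4,5) this sp(2,3) e(2)]
    have fE: "finite ?E1" "finite ?E2" using tree_finite_edges[OF sp(4)] tree_finite_edges[OF sp(5)] .
    have "card E = card (insert (edge b w) (?E1 \<union> ?E2))" by (rule arg_cong[OF sp(6)])
    also have "\<dots> = Suc (card (?E1 \<union> ?E2))" using fE j(1,2) by (subst card_insert_disjoint) auto
    also have "\<dots> = Suc (card ?E1 + card ?E2)" using fE j(3) by (subst card_Un_disjoint) auto
    finally show ?thesis using cV 1 by linarith
  qed
qed

lemma card_edges_black_degrees:
  assumes "E \<subseteq> edges_on V" "finite V"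
  shows "card E = (\<Sum>b\<in>coloured True V. card (inc E b))"
proof -
  have "finite E" using finite_subset[OF assms(1) finite_edges_on[OF assms(2)]] .
  have "E = (\<Union>b\<in>coloured True V. inc E b)"
    using assms(1) by (fastforce simp: inc_def edges_on_def coloured_def)
  then have "card E = card (\<Union>b\<in>coloured True V. inc E b)" by (rule arg_cong)
  also have "\<dots> = (\<Sum>b\<in>coloured True V. card (inc E b))"
    using assms \<open>finite E\<close> by (intro card_UN_disjoint) (auto simp: inc_def edges_on_def coloured_def)
  finally show ?thesis .
qed

text \<open>An edge has exactly one end of each colour, so orienting it by the colour of its first end
  involves no choice; sums over oriented edges therefore count edges, or degrees if the first end
  is fixed.\<close>

lemma card_marked_edges:
  assumes "E \<subseteq> edges_on V"
  shows "card (marked_edges c E) = card E"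
proof (rule bij_betw_same_card[of "\<lambda>(r, s). edge r s"])
  show "bij_betw (\<lambda>(r, s). edge r s) (marked_edges c E) E"
  proof (rule bij_betwI[of _ _ _ "\<lambda>(b, w). if c then (b, w) else (w, b)"])
    show "(\<lambda>(b, w). if c then (b, w) else (w, b)) \<in> E \<rightarrow> marked_edges c E"
      using assms by (cases c) (auto simp: marked_edges_def edges_on_def edge_def)
    show "(\<lambda>(r, s). edge r s) \<in> marked_edges c E \<rightarrow> E" by (auto simp: marked_edges_def)
  qed (use assms in \<open>cases c; auto simp: marked_edges_def edges_on_def edge_def\<close>)+
qed

lemma card_marked_edges_at:
  assumes "E \<subseteq> edges_on V" "(0 < r) = c"
  shows "card {s. (r, s) \<in> marked_edges c E} = card (inc E r)"
proof (rule bij_betw_same_card[of "edge r"])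
  show "bij_betw (edge r) {s. (r, s) \<in> marked_edges c E} (inc E r)"
    by (rule bij_betwI[of _ _ _ "\<lambda>(b, w). if c then w else b"])
       (use assms in \<open>auto simp: marked_edges_def edges_on_def edge_def inc_def split: if_splits\<close>)
qed

section \<open>Weights of trees\<close>

text \<open>The tensor \<open>\<tau>\<close> at a vertex is contracted along the edges; \<open>L v\<close> lists additional
  uncontracted indices at \<open>v\<close>. Tensors being symmetric, they are indexed by multisets.\<close>

definition wt :: "(bool \<Rightarrow> 'k multiset \<Rightarrow> 'r) \<Rightarrow> int set \<Rightarrow> (int \<times> int) set \<Rightarrow>
    (int \<Rightarrow> 'k multiset) \<Rightarrow> 'r :: comm_ring_1" where
  "wt \<tau> V E L = (\<Sum>e\<in>E \<rightarrow>\<^sub>E UNIV. \<Prod>v\<in>V. \<tau> (0 < v) (L v + image_mset e (mset_set (inc E v))))"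

lemma inc_join:
  assumes "E1 \<subseteq> V1 \<times> V1" "E2 \<subseteq> V2 \<times> V2" "V1 \<inter> V2 = {}" "s \<in> V2" "v \<in> V1"
  shows "inc (insert (edge r s) (E1 \<union> E2)) v = (if v = r then insert (edge r s) (inc E1 v) else inc E1 v)"
  using assms by (auto simp: inc_def edge_def max_def min_def split: if_splits)

lemma card_inc_join:
  assumes T: "tree V1 E1" "tree V2 E2" and dis: "V1 \<inter> V2 = {}"
    and rs: "r \<in> V1" "s \<in> V2" "(0 < r) \<noteq> (0 < s)"
  shows "card (inc (insert (edge r s) (E1 \<union> E2)) r) = Suc (card (inc E1 r))"
proof -
  have "inc (insert (edge r s) (E1 \<union> E2)) r = insert (edge r s) (inc E1 r)"
    using inc_join[OF tree_edges_subset[OF T(1)] tree_edges_subset[OF T(2)] dis rs(2,1)] by simp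
  moreover have "edge r s \<notin> inc E1 r" using component_join(1)[OF T dis rs] by (simp add: inc_def)
  moreover have "finite (inc E1 r)" using tree_finite_edges[OF T(1)] by (simp add: inc_def)
  ultimately show ?thesis by simp
qed

text \<open>Once the index on the joining edge is fixed the weight is a product, because every vertex sees
  only the edges of its own side; for the ends of the joining edge the fixed index becomes an
  additional one.\<close>

theorem wt_join:
  fixes \<tau> :: "bool \<Rightarrow> 'k::finite multiset \<Rightarrow> 'r :: comm_ring_1"
  assumes T: "tree V1 E1" "tree V2 E2" and dis: "V1 \<inter> V2 = {}"
    and rs: "r \<in> V1" "s \<in> V2" "(0 < r) \<noteq> (0 < s)"
  shows "wt \<tau> (V1 \<union> V2) (insert (edge r s) (E1 \<union> E2)) L =
    (\<Sum>k\<in>UNIV. wt \<tau> V1 E1 (L(r := add_mset k (L r))) * wt \<tau> V2 E2 (L(s := add_mset k (L s))))"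
proof -
  let ?e0 = "edge r s"
  let ?E = "insert ?e0 (E1 \<union> E2)"
  let ?L1 = "\<lambda>k. L(r := add_mset k (L r))" and ?L2 = "\<lambda>k. L(s := add_mset k (L s))"
  note j = component_join[OF T dis rs]
  note sub = tree_edges_subset[OF T(1)] tree_edges_subset[OF T(2)]
  have fin: "finite V1" "finite V2" "finite E1" "finite E2"
    using T tree_finite_edges by (auto simp: tree_def)
  have fin_inc: "finite (inc E1 v)" "finite (inc E2 v)" for v using fin by (auto simp: inc_def)
  have i1: "inc ?E v = (if v = r then insert ?e0 (inc E1 v) else inc E1 v)" if "v \<in> V1" for v
    by (rule inc_join) (use sub dis rs that in auto)
  have i2: "inc ?E v = (if v = s then insert ?e0 (inc E2 v) else inc E2 v)" if "v \<in> V2" for v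
    using inc_join[of E2 V2 E1 V1 r v s] sub dis rs that by (simp add: Un_commute edge_commute Int_commute)
  let ?P1 = "\<lambda>k g. \<Prod>v\<in>V1. \<tau> (0 < v) (?L1 k v + image_mset g (mset_set (inc E1 v)))"
  let ?P2 = "\<lambda>k g. \<Prod>v\<in>V2. \<tau> (0 < v) (?L2 k v + image_mset g (mset_set (inc E2 v)))"
  let ?i = "\<lambda>f. (f ?e0, restrict f E1, restrict f E2)"
  let ?j = "\<lambda>(k, g, h). \<lambda>x. if x = ?e0 then k else if x \<in> E1 then g x else if x \<in> E2 then h x else undefined"
  have v1: "L v + image_mset f (mset_set (inc ?E v)) = ?L1 (f ?e0) v + image_mset (restrict f E1) (mset_set (inc E1 v))"
    if "v \<in> V1" for v f
  proof -
    have "image_mset f (mset_set (inc E1 v)) = image_mset (restrict f E1) (mset_set (inc E1 v))"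
      by (rule image_mset_cong) (use fin_inc in \<open>auto simp: inc_def\<close>)
    moreover have "?e0 \<notin> inc E1 v" using j by (auto simp: inc_def)
    ultimately show ?thesis using i1[OF that] fin_inc by (cases "v = r") auto
  qed
  have v2: "L v + image_mset f (mset_set (inc ?E v)) = ?L2 (f ?e0) v + image_mset (restrict f E2) (mset_set (inc E2 v))"
    if "v \<in> V2" for v f
  proof -
    have "image_mset f (mset_set (inc E2 v)) = image_mset (restrict f E2) (mset_set (inc E2 v))"
      by (rule image_mset_cong) (use fin_inc in \<open>auto simp: inc_def\<close>)
    moreover have "?e0 \<notin> inc E2 v" using j by (auto simp: inc_def)
    ultimately show ?thesis using i2[OF that] fin_inc by (cases "v = s") auto
  qed
  have "wt \<tau> (V1 \<union> V2) ?E L = (\<Sum>f\<in>?E \<rightarrow>\<^sub>E UNIV. ?P1 (f ?e0) (restrict f E1) * ?P2 (f ?e0) (restrict f E2))"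
    unfolding wt_def
  proof (rule sum.cong[OF refl])
    fix f
    let ?h = "\<lambda>v. \<tau> (0 < v) (L v + image_mset f (mset_set (inc ?E v)))"
    have "prod ?h (V1 \<union> V2) = prod ?h V1 * prod ?h V2"
      by (rule prod.union_disjoint) (use fin dis in auto)
    moreover have "prod ?h V1 = ?P1 (f ?e0) (restrict f E1)" by (rule prod.cong) (simp_all only: v1)
    moreover have "prod ?h V2 = ?P2 (f ?e0) (restrict f E2)" by (rule prod.cong) (simp_all only: v2)
    ultimately show "prod ?h (V1 \<union> V2) = ?P1 (f ?e0) (restrict f E1) * ?P2 (f ?e0) (restrict f E2)" by simp
  qed
  also have "\<dots> = (\<Sum>(k, g, h)\<in>UNIV \<times> (E1 \<rightarrow>\<^sub>E UNIV) \<times> (E2 \<rightarrow>\<^sub>E UNIV). ?P1 k g * ?P2 k h)"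
  proof (rule sum.reindex_bij_witness[of _ ?j ?i])
    fix f :: "int \<times> int \<Rightarrow> 'k" assume f: "f \<in> ?E \<rightarrow>\<^sub>E UNIV"
    show "?j (?i f) = f" using f by (auto simp: PiE_def extensional_def fun_eq_iff)
    show "?i f \<in> UNIV \<times> (E1 \<rightarrow>\<^sub>E UNIV) \<times> (E2 \<rightarrow>\<^sub>E UNIV)" by auto
    show "(case ?i f of (k, g, h) \<Rightarrow> ?P1 k g * ?P2 k h) = ?P1 (f ?e0) (restrict f E1) * ?P2 (f ?e0) (restrict f E2)"
      by (simp only: prod.case)
  next
    fix y :: "'k \<times> (int \<times> int \<Rightarrow> 'k) \<times> (int \<times> int \<Rightarrow> 'k)"
    assume "y \<in> UNIV \<times> (E1 \<rightarrow>\<^sub>E UNIV) \<times> (E2 \<rightarrow>\<^sub>E UNIV)"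
    then obtain k g h where y: "y = (k, g, h)" "g \<in> E1 \<rightarrow>\<^sub>E UNIV" "h \<in> E2 \<rightarrow>\<^sub>E UNIV" by auto
    show "?i (?j y) = y"
      using y(2,3) j(1-3) unfolding y(1) by (auto simp: fun_eq_iff PiE_def extensional_def restrict_def)
    show "?j y \<in> ?E \<rightarrow>\<^sub>E UNIV" unfolding y(1) by (auto simp: PiE_def extensional_def)
  qed
  also have "\<dots> = (\<Sum>k\<in>UNIV. wt \<tau> V1 E1 (?L1 k) * wt \<tau> V2 E2 (?L2 k))"
    unfolding wt_def sum_product by (simp only: sum.cartesian_product' prod.case)
  finally show ?thesis .
qed

lemma wt_cong: "(\<And>v. v \<in> V \<Longrightarrow> L v = L' v) \<Longrightarrow> wt \<tau> V E L = wt \<tau> V E L'"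
  unfolding wt_def by (intro sum.cong prod.cong) auto

section \<open>Relabelling vertices\<close>

definition relabelling :: "(int \<Rightarrow> int) \<Rightarrow> int set \<Rightarrow> bool" where
  "relabelling f V \<longleftrightarrow> inj_on f V \<and> (\<forall>v\<in>V. (0 < f v) = (0 < v))"

lemma relabelling_inv_into:
  assumes "relabelling f V"
  shows "relabelling (inv_into V f) (f ` V)"
  using assms by (auto simp: relabelling_def inj_on_inv_into inv_into_f_f)

lemma map_prod_inv_into:
  assumes "inj_on f V" "E \<subseteq> V \<times> V"
  shows "map_prod (inv_into V f) (inv_into V f) ` map_prod f f ` E = E"
proof -
  have "map_prod (inv_into V f) (inv_into V f) (map_prod f f x) = x" if "x \<in> E" for x
    using that assms by (cases x) (auto simp: inv_into_f_f)
  then show ?thesis by (force simp: image_image)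
qed

lemma inj_on_map_prod: "inj_on f V \<Longrightarrow> E \<subseteq> V \<times> V \<Longrightarrow> inj_on (map_prod f f) E"
  by (rule inj_on_subset[OF map_prod_inj_on])

lemma adj_map: "(u, v) \<in> (adj E)\<^sup>* \<Longrightarrow> (f u, f v) \<in> (adj (map_prod f f ` E))\<^sup>*"
  by (rule rtrancl_map) (force simp: adj_def)+

lemma tree_relabel:
  assumes f: "relabelling f V" and T: "tree V E"
  shows "tree (f ` V) (map_prod f f ` E)"
  unfolding tree_def
proof (intro conjI ballI allI impI)
  let ?E = "map_prod f f ` E"
  note sub = tree_edges_subset[OF T]
  have inj: "inj_on f V" using f by (simp add: relabelling_def)
  show "finite (f ` V)" "f ` V \<noteq> {}" using T by (auto simp: tree_def)
  have "E \<subseteq> edges_on V" using T by (simp add: tree_def)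
  then show "?E \<subseteq> edges_on (f ` V)" using f by (auto simp: edges_on_def relabelling_def)
  show "(x, y) \<in> (adj ?E)\<^sup>*" if "x \<in> f ` V" "y \<in> f ` V" for x y
    using that T adj_map unfolding tree_def by (metis imageE)
  fix x y assume "(x, y) \<in> ?E"
  then obtain u v where uv: "(u, v) \<in> E" "x = f u" "y = f v" by auto
  then have V: "u \<in> V" "v \<in> V" using sub by auto
  let ?g = "inv_into V f"
  have "?E - {(x, y)} = map_prod f f ` (E - {(u, v)})"
    using inj_on_image_set_diff[OF inj_on_map_prod[OF inj sub], of E "{(u, v)}"] uv by simp
  moreover have "map_prod ?g ?g ` map_prod f f ` (E - {(u, v)}) = E - {(u, v)}"
    by (rule map_prod_inv_into[OF inj]) (use sub in auto)
  ultimately have "(x, y) \<in> (adj (?E - {(x, y)}))\<^sup>* \<Longrightarrow> (?g x, ?g y) \<in> (adj (E - {(u, v)}))\<^sup>*"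
    using adj_map[of x y "?E - {(x, y)}" ?g] by simp
  moreover have "?g x = u" "?g y = v" using uv V inj by (auto simp: inv_into_f_f)
  ultimately show "(x, y) \<notin> (adj (?E - {(x, y)}))\<^sup>*" using T uv unfolding tree_def by auto
qed

lemma trees_relabel:
  assumes f: "relabelling f V"
  shows "bij_betw (image (map_prod f f)) (trees V) (trees (f ` V))"
proof -
  have inj: "inj_on f V" using f by (simp add: relabelling_def)
  let ?g = "inv_into V f"
  have gf: "?g ` f ` V = V" using inj by simp
  have injg: "inj_on ?g (f ` V)" by (simp add: inj_on_inv_into)
  have fg: "map_prod f f ` map_prod ?g ?g ` E = E" if "E \<subseteq> f ` V \<times> f ` V" for E
  proof -
    have "map_prod f f (map_prod ?g ?g x) = x" if "x \<in> E" for x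
      using that \<open>E \<subseteq> f ` V \<times> f ` V\<close> by (cases x) (auto simp: f_inv_into_f)
    then show ?thesis by (force simp: image_image)
  qed
  show ?thesis
  proof (rule bij_betwI[of _ _ _ "image (map_prod ?g ?g)"])
    show "image (map_prod f f) \<in> trees V \<rightarrow> trees (f ` V)"
      using tree_relabel[OF f] by (auto simp: trees_def)
    show "image (map_prod ?g ?g) \<in> trees (f ` V) \<rightarrow> trees V"
      using tree_relabel[OF relabelling_inv_into[OF f]] unfolding gf by (auto simp: trees_def)
    show "map_prod ?g ?g ` map_prod f f ` E = E" if "E \<in> trees V" for E
      by (rule map_prod_inv_into[OF inj]) (use that tree_edges_subset in \<open>auto simp: trees_def\<close>)
    show "map_prod f f ` map_prod ?g ?g ` E = E" if "E \<in> trees (f ` V)" for E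
      by (rule fg) (use that tree_edges_subset in \<open>auto simp: trees_def\<close>)
  qed
qed

lemma inc_relabel:
  assumes "inj_on f V" "E \<subseteq> V \<times> V" "v \<in> V"
  shows "inc (map_prod f f ` E) (f v) = map_prod f f ` inc E v"
proof -
  have "fst (map_prod f f e) = f v \<longleftrightarrow> fst e = v" "snd (map_prod f f e) = f v \<longleftrightarrow> snd e = v" if "e \<in> E" for e
    using assms that by (cases e, auto dest: inj_onD)+
  then have "{e \<in> E. fst (map_prod f f e) = f v \<or> snd (map_prod f f e) = f v} = inc E v"
    by (auto simp: inc_def)
  then show ?thesis by (auto simp: inc_def)
qed

lemma card_inc_relabel:
  assumes "inj_on f V" "E \<subseteq> V \<times> V" "v \<in> V"
  shows "card (inc (map_prod f f ` E) (f v)) = card (inc E v)"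
  unfolding inc_relabel[OF assms]
  by (rule card_image) (rule inj_on_map_prod[OF assms(1)], use assms(2) in \<open>auto simp: inc_def\<close>)

lemma wt_relabel:
  fixes \<tau> :: "bool \<Rightarrow> 'k::finite multiset \<Rightarrow> 'r :: comm_ring_1"
  assumes f: "relabelling f V" and sub: "E \<subseteq> V \<times> V"
  shows "wt \<tau> (f ` V) (map_prod f f ` E) L = wt \<tau> V E (\<lambda>v. L (f v))"
proof -
  let ?F = "map_prod f f"
  have inj: "inj_on f V" using f by (simp add: relabelling_def)
  have injF: "inj_on ?F E" by (rule inj_on_map_prod[OF inj sub])
  let ?i = "\<lambda>e. restrict (\<lambda>x. e (?F x)) E" and ?j = "\<lambda>e. restrict (\<lambda>x. e (inv_into E ?F x)) (?F ` E)"
  show ?thesis unfolding wt_def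
  proof (rule sum.reindex_bij_witness[of _ ?j ?i])
    fix e :: "int \<times> int \<Rightarrow> 'k" assume e: "e \<in> ?F ` E \<rightarrow>\<^sub>E UNIV"
    show "?j (?i e) = e"
    proof
      fix x show "?j (?i e) x = e x"
        using PiE_arb[OF e, of x] inv_into_into[of x ?F E] f_inv_into_f[of x ?F E]
        by (cases "x \<in> ?F ` E") simp_all
    qed
    show "?i e \<in> E \<rightarrow>\<^sub>E UNIV" by auto
    have "(\<Prod>v\<in>f ` V. \<tau> (0 < v) (L v + image_mset e (mset_set (inc (?F ` E) v)))) =
      (\<Prod>v\<in>V. \<tau> (0 < f v) (L (f v) + image_mset e (mset_set (inc (?F ` E) (f v)))))"
      by (simp add: prod.reindex inj)
    also have "\<dots> = (\<Prod>v\<in>V. \<tau> (0 < v) (L (f v) + image_mset (?i e) (mset_set (inc E v))))"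
    proof (rule prod.cong[OF refl])
      fix v assume v: "v \<in> V"
      have "inj_on ?F (inc E v)" using injF by (auto simp: inc_def inj_on_def)
      then have "mset_set (inc (?F ` E) (f v)) = image_mset ?F (mset_set (inc E v))"
        by (simp add: inc_relabel[OF inj sub v] image_mset_mset_set)
      then have "image_mset e (mset_set (inc (?F ` E) (f v))) = image_mset (\<lambda>x. e (?F x)) (mset_set (inc E v))"
        by (simp add: image_mset.compositionality comp_def)
      also have "\<dots> = image_mset (?i e) (mset_set (inc E v))"
        by (cases "finite (inc E v)") (auto intro!: image_mset_cong simp: inc_def)
      finally show "\<tau> (0 < f v) (L (f v) + image_mset e (mset_set (inc (?F ` E) (f v)))) =
          \<tau> (0 < v) (L (f v) + image_mset (?i e) (mset_set (inc E v)))"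
        using f v by (simp add: relabelling_def)
    qed
    finally show "(\<Prod>v\<in>V. \<tau> (0 < v) (L (f v) + image_mset (?i e) (mset_set (inc E v)))) =
      (\<Prod>v\<in>f ` V. \<tau> (0 < v) (L v + image_mset e (mset_set (inc (?F ` E) v))))" by simp
  next
    fix e :: "int \<times> int \<Rightarrow> 'k" assume e: "e \<in> E \<rightarrow>\<^sub>E UNIV"
    show "?i (?j e) = e"
    proof
      fix x show "?i (?j e) x = e x"
        using PiE_arb[OF e, of x] inv_into_f_f[OF injF, of x] by (cases "x \<in> E") simp_all
    qed
    show "?j e \<in> ?F ` E \<rightarrow>\<^sub>E UNIV" by auto
  qed
qed

section \<open>Exponential generating functions of vertex-labelled structures\<close>

text \<open>The total weight of the structures on a vertex set \<open>V\<close>, as a function of \<open>V\<close>, depends only on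
  the numbers of black and of white vertices if the weights do not see the labels.\<close>

definition invariant :: "(int set \<Rightarrow> 'r) \<Rightarrow> bool" where
  "invariant A \<longleftrightarrow> (\<forall>V f. finite V \<longrightarrow> relabelling f V \<longrightarrow> A (f ` V) = A V)"

text \<open>With all white tensors linear in the variables, the total degree counts the white vertices; a
  bound on the number of black vertices then makes each coefficient a finite sum.\<close>

definition graded :: "nat \<Rightarrow> (int set \<Rightarrow> 'w mps) \<Rightarrow> bool" where
  "graded c A \<longleftrightarrow> (\<forall>V \<mu>. finite V \<longrightarrow> mps_coeff (A V) \<mu> \<noteq> 0 \<longrightarrow>
     size \<mu> = card (coloured False V) \<and> card (coloured True V) < card (coloured False V) + c)"

definition std :: "nat \<Rightarrow> nat \<Rightarrow> int set" where
  "std n m = {1..int n} \<union> {- int m..-1}"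

definition egf_term :: "(int set \<Rightarrow> 'w mps) \<Rightarrow> nat \<times> nat \<Rightarrow> 'w mps" where
  "egf_term A p = mps_const (1 / (fact (fst p) * fact (snd p))) * A (std (fst p) (snd p))"

definition egf :: "(int set \<Rightarrow> 'w mps) \<Rightarrow> 'w mps" where
  "egf A = formal_sum (egf_term A) UNIV"

lemma finite_std [simp]: "finite (std n m)"
  by (simp add: std_def)

lemma coloured_std: "coloured True (std n m) = {1..int n}" "coloured False (std n m) = {- int m..-1}"
  by (auto simp: coloured_def std_def)

lemma card_coloured_std [simp]: "card (coloured True (std n m)) = n" "card (coloured False (std n m)) = m"
  by (simp_all add: coloured_std)

lemma graded_egf_term:
  assumes "graded c A" "mps_coeff (egf_term A p) \<mu> \<noteq> 0"
  shows "snd p = size \<mu>" "fst p < size \<mu> + c"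
proof -
  have "mps_coeff (A (std (fst p) (snd p))) \<mu> \<noteq> 0" using assms(2) by (auto simp: egf_term_def)
  then show "snd p = size \<mu>" "fst p < size \<mu> + c"
    using assms(1) unfolding graded_def by (metis card_coloured_std finite_std)+
qed

lemma egf_has_sum:
  assumes "graded c A"
  shows "formal_has_sum (egf_term A) UNIV (egf A)"
  unfolding egf_def
proof (rule formal_has_sum_summable, unfold formally_summable_def, rule allI)
  fix \<mu>
  have "{t. mps_coeff (egf_term A t) \<mu> \<noteq> 0} \<subseteq> {..<size \<mu> + c} \<times> {size \<mu>}"
    using graded_egf_term[OF assms] by (auto simp: mem_Times_iff)
  then show "finite {t \<in> UNIV. mps_coeff (egf_term A t) \<mu> \<noteq> 0}"
    by (simp add: finite_subset)
qed

lemma egf_eqI: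
  assumes "graded c A" "formal_has_sum (egf_term A) UNIV s"
  shows "egf A = s"
  using formal_has_sum_unique[OF egf_has_sum[OF assms(1)] assms(2)] .

lemma relabelling_exists:
  assumes "finite V" "finite W" "\<And>c. card (coloured c V) = card (coloured c W)"
  obtains f where "relabelling f V" "f ` V = W"
proof -
  have "\<exists>f. bij_betw f (coloured c V) (coloured c W)" for c
    using assms by (intro finite_same_card_bij) auto
  then obtain f where f: "\<And>c. bij_betw (f c) (coloured c V) (coloured c W)" by metis
  let ?f = "\<lambda>v. f (0 < v) v"
  have sgn: "?f v \<in> W \<and> (0 < ?f v) = (0 < v)" if "v \<in> V" for v
    using bij_betw_apply[OF f[of "0 < v"], of v] that by (auto simp: coloured_def)
  have "inj_on ?f V"
  proof (rule inj_onI)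
    fix u v assume uv: "u \<in> V" "v \<in> V" "?f u = ?f v"
    then have "(0 < u) = (0 < v)" using sgn by metis
    then show "u = v"
      using uv bij_betw_imp_inj_on[OF f[of "0 < u"]] by (auto simp: inj_on_def coloured_def)
  qed
  moreover have "?f ` V = W"
  proof (intro equalityI subsetI)
    fix w assume "w \<in> W"
    then have "w \<in> coloured (0 < w) W" by (simp add: coloured_def)
    then have "w \<in> f (0 < w) ` coloured (0 < w) V" using f by (simp add: bij_betw_def)
    then obtain v where "v \<in> V" "(0 < v) = (0 < w)" "w = f (0 < w) v" by (auto simp: coloured_def)
    then show "w \<in> ?f ` V" by (intro image_eqI[of _ _ v]) auto
  qed (use sgn in auto)
  ultimately show thesis using sgn by (intro that) (auto simp: relabelling_def)
qed

lemma invariant_std: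
  assumes "invariant A" "finite V"
  shows "A V = A (std (card (coloured True V)) (card (coloured False V)))"
proof -
  have "card (coloured c V) = card (coloured c (std (card (coloured True V)) (card (coloured False V))))" for c
    by (cases c) auto
  then obtain f where "relabelling f V" "f ` V = std (card (coloured True V)) (card (coloured False V))"
    using relabelling_exists[OF assms(2) finite_std] by metis
  then show ?thesis using assms unfolding invariant_def by metis
qed

lemma sum_Pow_card:
  fixes h :: "nat \<Rightarrow> 'r :: comm_ring_1"
  assumes "finite X"
  shows "(\<Sum>Y\<in>Pow X. h (card Y)) = (\<Sum>i\<le>card X. of_nat (card X choose i) * h i)"
proof -
  have "(\<Sum>Y\<in>Pow X. h (card Y)) = (\<Sum>i\<le>card X. \<Sum>Y\<in>{Y \<in> Pow X. card Y = i}. h (card Y))"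
    by (rule sum.group[symmetric]) (use assms card_mono in auto)
  also have "\<dots> = (\<Sum>i\<le>card X. of_nat (card X choose i) * h i)"
  proof (rule sum.cong[OF refl])
    fix i
    have "(\<Sum>Y\<in>{Y \<in> Pow X. card Y = i}. h (card Y)) = (\<Sum>Y\<in>{Y. Y \<subseteq> X \<and> card Y = i}. h i)"
      by (rule sum.cong) auto
    then show "(\<Sum>Y\<in>{Y \<in> Pow X. card Y = i}. h (card Y)) = of_nat (card X choose i) * h i"
      by (simp add: n_subsets[OF assms])
  qed
  finally show ?thesis .
qed

lemma sum_Pow_std:
  fixes h :: "nat \<Rightarrow> nat \<Rightarrow> 'r :: comm_ring_1"
  shows "(\<Sum>V\<in>Pow (std n m). h (card (coloured True V)) (card (coloured False V))) =
    (\<Sum>i\<le>n. \<Sum>j\<le>m. of_nat (n choose i) * (of_nat (m choose j) * h i j))"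
proof -
  let ?B = "{1..int n}" and ?W = "{- int m..-1}"
  have "(\<Sum>V\<in>Pow (std n m). h (card (coloured True V)) (card (coloured False V))) =
      (\<Sum>(X, Y)\<in>Pow ?B \<times> Pow ?W. h (card X) (card Y))"
  proof (rule sum.reindex_bij_witness[of _ "\<lambda>(X, Y). X \<union> Y" "\<lambda>V. (coloured True V, coloured False V)"])
    fix p assume "p \<in> Pow ?B \<times> Pow ?W"
    then obtain X Y where p: "p = (X, Y)" "X \<subseteq> ?B" "Y \<subseteq> ?W" by auto
    have "coloured True (X \<union> Y) = X" "coloured False (X \<union> Y) = Y"
      using p(2,3) by (force simp: coloured_def)+
    then show "(coloured True (case p of (X, Y) \<Rightarrow> X \<union> Y), coloured False (case p of (X, Y) \<Rightarrow> X \<union> Y)) = p"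
      using p(1) by simp
    show "(case p of (X, Y) \<Rightarrow> X \<union> Y) \<in> Pow (std n m)" using p by (auto simp: std_def)
  qed (auto simp: std_def coloured_def)
  also have "\<dots> = (\<Sum>X\<in>Pow ?B. \<Sum>Y\<in>Pow ?W. h (card X) (card Y))"
    by (simp add: sum.cartesian_product')
  also have "\<dots> = (\<Sum>X\<in>Pow ?B. \<Sum>j\<le>m. of_nat (m choose j) * h (card X) j)"
    by (rule sum.cong[OF refl]) (use sum_Pow_card[of ?W] in simp)
  also have "\<dots> = (\<Sum>i\<le>n. of_nat (n choose i) * (\<Sum>j\<le>m. of_nat (m choose j) * h i j))"
    by (subst sum_Pow_card[where h = "\<lambda>i. \<Sum>j\<le>m. of_nat (m choose j) * h i j"]) simp_all
  also have "\<dots> = (\<Sum>i\<le>n. \<Sum>j\<le>m. of_nat (n choose i) * (of_nat (m choose j) * h i j))"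
    by (simp only: sum_distrib_left)
  finally show ?thesis .
qed

text \<open>The number of ways to distribute the labels over two structures is a product of binomial
  coefficients, and the factorials in the definition absorb it.\<close>

theorem egf_mult:
  fixes A B :: "int set \<Rightarrow> 'w mps"
  assumes inv: "invariant A" "invariant B" and gr: "graded a A" "graded b B"
  shows "formal_has_sum (egf_term (\<lambda>V. \<Sum>V1\<in>Pow V. A V1 * B (V - V1))) UNIV (egf A * egf B)"
proof -
  let ?D = "Sigma UNIV (\<lambda>p :: nat \<times> nat. {..fst p} \<times> {..snd p})"
  let ?h = "\<lambda>(p, q). (q, (fst p - fst q, snd p - snd q)) :: (nat \<times> nat) \<times> (nat \<times> nat)"
  have bij: "bij_betw ?h ?D (UNIV \<times> UNIV)"
    by (rule bij_betwI[of _ _ _ "\<lambda>(p, q). ((fst p + fst q, snd p + snd q), p)"]) auto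
  let ?f = "\<lambda>(p, q). egf_term A p * egf_term B q"
  have "formal_has_sum ?f (UNIV \<times> UNIV) (egf A * egf B)"
    by (rule formal_has_sum_mult[OF egf_has_sum[OF gr(1)] egf_has_sum[OF gr(2)]])
  then have "formal_has_sum (\<lambda>x. ?f (?h x)) ?D (egf A * egf B)"
    by (rule formal_has_sum_reindex[OF bij, of ?f, THEN iffD1])
  then show ?thesis
  proof (rule formal_has_sum_Sigma)
    fix p :: "nat \<times> nat"
    obtain n m where p: "p = (n, m)" by force
    let ?g = "\<lambda>i j. A (std i j) * B (std (n - i) (m - j))"
    have AB: "A V1 * B (std n m - V1) = ?g (card (coloured True V1)) (card (coloured False V1))"
      if "V1 \<in> Pow (std n m)" for V1
    proof -
      have fin: "finite V1" using that by (auto intro: finite_subset[OF _ finite_std])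
      have "card (coloured c (std n m - V1)) = card (coloured c (std n m)) - card (coloured c V1)" for c
      proof -
        have "coloured c (std n m - V1) = coloured c (std n m) - coloured c V1" by (auto simp: coloured_def)
        moreover have "coloured c V1 \<subseteq> coloured c (std n m)" using that by (auto simp: coloured_def)
        ultimately show ?thesis using fin by (simp add: card_Diff_subset)
      qed
      then show ?thesis
        using invariant_std[OF inv(1) fin] invariant_std[OF inv(2), of "std n m - V1"] by simp
    qed
    have "egf_term (\<lambda>V. \<Sum>V1\<in>Pow V. A V1 * B (V - V1)) p =
        mps_const (1 / (fact n * fact m)) * (\<Sum>V1\<in>Pow (std n m). ?g (card (coloured True V1)) (card (coloured False V1)))"
      unfolding egf_term_def p fst_conv snd_conv by (rule arg_cong[OF sum.cong[OF refl AB]])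
    also have "\<dots> = (\<Sum>i\<le>n. \<Sum>j\<le>m. mps_const (1 / (fact n * fact m)) * (of_nat (n choose i) * (of_nat (m choose j) * ?g i j)))"
      by (simp add: sum_Pow_std[where h = ?g] sum_distrib_left)
    also have "\<dots> = (\<Sum>i\<le>n. \<Sum>j\<le>m. egf_term A (i, j) * egf_term B (n - i, m - j))"
    proof (intro sum.cong refl)
      fix i j assume "i \<in> {..n}" "j \<in> {..m}"
      then have "1 / (fact n * fact m) * (real (n choose i) * real (m choose j)) =
          1 / (fact i * fact j) * (1 / (fact (n - i) * fact (m - j)))"
        by (simp add: binomial_fact field_simps)
      then have "mps_const (1 / (fact n * fact m)) * (of_nat (n choose i) * of_nat (m choose j)) =
          (mps_const (1 / (fact i * fact j)) * mps_const (1 / (fact (n - i) * fact (m - j))) :: 'w mps)"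
        unfolding mps_const_of_nat[symmetric] mps_const_mult[symmetric] by (rule arg_cong)
      then have "mps_const (1 / (fact n * fact m)) * (of_nat (n choose i) * of_nat (m choose j)) * ?g i j =
          mps_const (1 / (fact i * fact j)) * mps_const (1 / (fact (n - i) * fact (m - j))) * ?g i j"
        by (rule arg_cong)
      then show "mps_const (1 / (fact n * fact m)) * (of_nat (n choose i) * (of_nat (m choose j) * ?g i j)) =
          egf_term A (i, j) * egf_term B (n - i, m - j)"
        by (simp add: egf_term_def mult_ac)
    qed
    also have "\<dots> = (\<Sum>q\<in>{..fst p} \<times> {..snd p}. ?f (?h (p, q)))"
      by (simp add: p sum.cartesian_product')
    finally show "formal_has_sum (\<lambda>q. ?f (?h (p, q))) ({..fst p} \<times> {..snd p})
        (egf_term (\<lambda>V. \<Sum>V1\<in>Pow V. A V1 * B (V - V1)) p)"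
      by (simp only:) (rule formal_has_sum_finite, simp)
  qed
qed


section \<open>Rooted trees\<close>

abbreviation legs :: "int \<Rightarrow> 'k multiset \<Rightarrow> int \<Rightarrow> 'k multiset" where
  "legs r \<kappa> \<equiv> (\<lambda>_. {#})(r := \<kappa>)"

text \<open>Recording the degree \<open>d\<close> of the root makes the number of ways to cut an edge at the root
  known, so that no set partitions into subtrees have to be counted.\<close>

definition rooted_deg :: "(bool \<Rightarrow> 'k::finite multiset \<Rightarrow> 'r) \<Rightarrow> bool \<Rightarrow> 'k multiset \<Rightarrow> nat \<Rightarrow> int set \<Rightarrow> 'r::comm_ring_1" where
  "rooted_deg \<tau> c \<kappa> d V = (\<Sum>E\<in>trees V. \<Sum>r\<in>{r \<in> coloured c V. card (inc E r) = d}. wt \<tau> V E (legs r \<kappa>))"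

definition rooted :: "(bool \<Rightarrow> 'k::finite multiset \<Rightarrow> 'r) \<Rightarrow> bool \<Rightarrow> 'k multiset \<Rightarrow> int set \<Rightarrow> 'r::comm_ring_1" where
  "rooted \<tau> c \<kappa> V = (\<Sum>E\<in>trees V. \<Sum>r\<in>coloured c V. wt \<tau> V E (legs r \<kappa>))"

definition unrooted :: "(bool \<Rightarrow> 'k::finite multiset \<Rightarrow> 'r) \<Rightarrow> int set \<Rightarrow> 'r::comm_ring_1" where
  "unrooted \<tau> V = (\<Sum>E\<in>trees V. wt \<tau> V E (\<lambda>_. {#}))"

lemma rooted_deg_if:
  assumes "finite V"
  shows "rooted_deg \<tau> c \<kappa> d V =
    (\<Sum>E\<in>trees V. \<Sum>r\<in>coloured c V. if card (inc E r) = d then wt \<tau> V E (legs r \<kappa>) else 0)"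
  unfolding rooted_deg_def by (intro sum.cong[OF refl] sum.inter_filter) (use assms in simp)

lemma sum_index_last:
  fixes f :: "'k \<Rightarrow> 'a \<Rightarrow> 'b \<Rightarrow> 'r :: comm_ring_1"
  shows "(\<Sum>a\<in>A. \<Sum>b\<in>B. \<Sum>r\<in>R. \<Sum>s\<in>T. \<Sum>k\<in>K. f k a r * g k b s) =
    (\<Sum>k\<in>K. (\<Sum>a\<in>A. \<Sum>r\<in>R. f k a r) * (\<Sum>b\<in>B. \<Sum>s\<in>T. g k b s))"
  by (simp only: sum_product sum.swap[of _ K])

lemma wt_split_legs:
  fixes \<tau> :: "bool \<Rightarrow> 'k::finite multiset \<Rightarrow> 'r :: comm_ring_1"
  assumes "V1 \<subseteq> V" "E1 \<in> trees V1" "E2 \<in> trees (V - V1)" "r \<in> coloured c V1" "s \<in> coloured (\<not> c) (V - V1)"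
  shows "wt \<tau> V (insert (edge r s) (E1 \<union> E2)) (legs r \<kappa>) =
    (\<Sum>k\<in>UNIV. wt \<tau> V1 E1 (legs r (add_mset k \<kappa>)) * wt \<tau> (V - V1) E2 (legs s {#k#}))"
proof -
  have V: "V1 \<union> (V - V1) = V" using assms(1) by auto
  have rs: "r \<in> V1" "s \<in> V - V1" "(0 < r) \<noteq> (0 < s)" using assms(4,5) by (auto simp: coloured_def)
  have "wt \<tau> (V1 \<union> (V - V1)) (insert (edge r s) (E1 \<union> E2)) (legs r \<kappa>) =
     (\<Sum>k\<in>UNIV. wt \<tau> V1 E1 ((legs r \<kappa>)(r := add_mset k (legs r \<kappa> r)))
        * wt \<tau> (V - V1) E2 ((legs r \<kappa>)(s := add_mset k (legs r \<kappa> s))))"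
    by (rule wt_join[OF _ _ _ rs]) (use assms in \<open>auto simp: trees_def\<close>)
  also have "\<dots> = (\<Sum>k\<in>UNIV. wt \<tau> V1 E1 (legs r (add_mset k \<kappa>)) * wt \<tau> (V - V1) E2 (legs s {#k#}))"
    by (intro sum.cong refl arg_cong2[where f = "(*)"] wt_cong) (use rs in auto)
  finally show ?thesis by (simp only: V)
qed

lemma sum_marked_edges:
  fixes g :: "int \<Rightarrow> 'r :: comm_ring_1"
  assumes T: "E \<in> trees V"
  shows "(\<Sum>(r, s)\<in>marked_edges c E. g r) = (\<Sum>r\<in>coloured c V. of_nat (card (inc E r)) * g r)"
proof -
  have T': "tree V E" and finV: "finite V" using T by (auto simp: trees_def tree_def)
  have sub: "E \<subseteq> edges_on V" using T' by (simp add: tree_def)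
  let ?M = "Sigma (coloured c V) (\<lambda>r. {s. (r, s) \<in> marked_edges c E})"
  have eq: "marked_edges c E = ?M"
    using edge_in_treeD(1)[OF T'] by (auto simp: marked_edges_def coloured_def)
  have fin: "finite {s. (r, s) \<in> marked_edges c E}" for r
    by (rule finite_subset[of _ "snd ` marked_edges c E"]) (force simp: finite_marked_edges[OF T'])+
  have "(\<Sum>(r, s)\<in>marked_edges c E. g r) = (\<Sum>(r, s)\<in>?M. g r)"
    by (rule arg_cong[OF eq])
  also have "\<dots> = (\<Sum>r\<in>coloured c V. \<Sum>s | (r, s) \<in> marked_edges c E. g r)"
    by (rule sum.Sigma[symmetric]) (use finV fin in auto)
  also have "\<dots> = (\<Sum>r\<in>coloured c V. of_nat (card (inc E r)) * g r)"
  proof (rule sum.cong[OF refl])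
    fix r assume "r \<in> coloured c V"
    then have "(0 < r) = c" by (simp add: coloured_def)
    from card_marked_edges_at[OF sub this]
    show "(\<Sum>s | (r, s) \<in> marked_edges c E. g r) = of_nat (card (inc E r)) * g r" by simp
  qed
  finally show ?thesis .
qed

text \<open>Cutting a marked edge at the root: each tree with root degree \<open>d + 1\<close> arises \<open>d + 1\<close> times.\<close>

theorem rooted_deg_Suc:
  fixes \<tau> :: "bool \<Rightarrow> 'k::finite multiset \<Rightarrow> 'r :: comm_ring_1"
  assumes "finite V"
  shows "of_nat (Suc d) * rooted_deg \<tau> c \<kappa> (Suc d) V =
    (\<Sum>k\<in>UNIV. \<Sum>V1\<in>Pow V. rooted_deg \<tau> c (add_mset k \<kappa>) d V1 * rooted \<tau> (\<not> c) {#k#} (V - V1))"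
proof -
  let ?w = "\<lambda>E r. if card (inc E r) = Suc d then wt \<tau> V E (legs r \<kappa>) else 0"
  let ?w1 = "\<lambda>V1 E1 r k. if card (inc E1 r) = d then wt \<tau> V1 E1 (legs r (add_mset k \<kappa>)) else 0"
  let ?C = "\<lambda>V1. coloured c V1" and ?D = "\<lambda>V1. coloured (\<not> c) (V - V1)"
  have fin: "finite V1" if "V1 \<in> Pow V" for V1 using that assms by (auto intro: finite_subset)
  have "of_nat (Suc d) * rooted_deg \<tau> c \<kappa> (Suc d) V =
      (\<Sum>E\<in>trees V. \<Sum>r\<in>coloured c V. of_nat (card (inc E r)) * ?w E r)"
    unfolding rooted_deg_def sum_distrib_left
    by (intro sum.cong[OF refl], subst sum.inter_filter) (use assms in \<open>auto intro!: sum.cong\<close>)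
  also have "\<dots> = (\<Sum>E\<in>trees V. \<Sum>(r, s)\<in>marked_edges c E. ?w E r)"
    by (intro sum.cong refl) (simp only: sum_marked_edges)
  also have "\<dots> = (\<Sum>V1\<in>Pow V. \<Sum>E1\<in>trees V1. \<Sum>E2\<in>trees (V - V1). \<Sum>r\<in>?C V1. \<Sum>s\<in>?D V1.
        ?w (insert (edge r s) (E1 \<union> E2)) r)"
    by (rule sum_trees_with_marked_edge[OF assms])
  also have "\<dots> = (\<Sum>V1\<in>Pow V. \<Sum>E1\<in>trees V1. \<Sum>E2\<in>trees (V - V1). \<Sum>r\<in>?C V1. \<Sum>s\<in>?D V1.
        \<Sum>k\<in>UNIV. ?w1 V1 E1 r k * wt \<tau> (V - V1) E2 (legs s {#k#}))"
  proof (intro sum.cong refl)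
    fix V1 E1 E2 r s
    assume A: "V1 \<in> Pow V" "E1 \<in> trees V1" "E2 \<in> trees (V - V1)" "r \<in> ?C V1" "s \<in> ?D V1"
    have "card (inc (insert (edge r s) (E1 \<union> E2)) r) = Suc (card (inc E1 r))"
      by (rule card_inc_join[of V1 E1 "V - V1" E2]) (use A in \<open>auto simp: trees_def coloured_def\<close>)
    then show "?w (insert (edge r s) (E1 \<union> E2)) r = (\<Sum>k\<in>UNIV. ?w1 V1 E1 r k * wt \<tau> (V - V1) E2 (legs s {#k#}))"
      using wt_split_legs[OF _ A(2-5), of \<tau> \<kappa>] A(1) by simp
  qed
  also have "\<dots> = (\<Sum>V1\<in>Pow V. \<Sum>k\<in>UNIV. (\<Sum>E1\<in>trees V1. \<Sum>r\<in>?C V1. ?w1 V1 E1 r k) *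
      (\<Sum>E2\<in>trees (V - V1). \<Sum>s\<in>?D V1. wt \<tau> (V - V1) E2 (legs s {#k#})))"
    by (simp only: sum_index_last)
  also have "\<dots> = (\<Sum>V1\<in>Pow V. \<Sum>k\<in>UNIV. rooted_deg \<tau> c (add_mset k \<kappa>) d V1 * rooted \<tau> (\<not> c) {#k#} (V - V1))"
    by (intro sum.cong refl) (simp only: rooted_deg_if[OF fin] rooted_def)
  also have "\<dots> = (\<Sum>k\<in>UNIV. \<Sum>V1\<in>Pow V. rooted_deg \<tau> c (add_mset k \<kappa>) d V1 * rooted \<tau> (\<not> c) {#k#} (V - V1))"
    by (rule sum.swap)
  finally show ?thesis .
qed

text \<open>A tree has one more vertex than edges, so counting it once for each vertex and subtracting
  its count for each edge leaves it exactly once.\<close>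

theorem dissymmetry:
  fixes \<tau> :: "bool \<Rightarrow> 'k::finite multiset \<Rightarrow> 'r :: comm_ring_1"
  assumes "finite V"
  shows "unrooted \<tau> V = rooted \<tau> True {#} V + rooted \<tau> False {#} V
    - (\<Sum>k\<in>UNIV. \<Sum>V1\<in>Pow V. rooted \<tau> True {#k#} V1 * rooted \<tau> False {#k#} (V - V1))"
proof -
  let ?w = "\<lambda>E. wt \<tau> V E (\<lambda>_. {#})"
  let ?C = "\<lambda>V1. coloured True V1" and ?D = "\<lambda>V1. coloured False (V - V1)"
  have "(\<Sum>k\<in>UNIV. \<Sum>V1\<in>Pow V. rooted \<tau> True {#k#} V1 * rooted \<tau> False {#k#} (V - V1)) =
    (\<Sum>V1\<in>Pow V. \<Sum>k\<in>UNIV. (\<Sum>E1\<in>trees V1. \<Sum>r\<in>?C V1. wt \<tau> V1 E1 (legs r {#k#})) *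
      (\<Sum>E2\<in>trees (V - V1). \<Sum>s\<in>?D V1. wt \<tau> (V - V1) E2 (legs s {#k#})))"
    unfolding rooted_def by (rule sum.swap)
  also have "\<dots> = (\<Sum>V1\<in>Pow V. \<Sum>E1\<in>trees V1. \<Sum>E2\<in>trees (V - V1). \<Sum>r\<in>?C V1. \<Sum>s\<in>?D V1.
      ?w (insert (edge r s) (E1 \<union> E2)))"
  proof (rule sum.cong[OF refl])
    fix V1 assume V1: "V1 \<in> Pow V"
    let ?u = "\<lambda>k E1 r. wt \<tau> V1 E1 (legs r {#k#})" and ?v = "\<lambda>k E2 s. wt \<tau> (V - V1) E2 (legs s {#k#})"
    have "(\<Sum>k\<in>UNIV. (\<Sum>E1\<in>trees V1. \<Sum>r\<in>?C V1. ?u k E1 r) * (\<Sum>E2\<in>trees (V - V1). \<Sum>s\<in>?D V1. ?v k E2 s)) =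
       (\<Sum>E1\<in>trees V1. \<Sum>E2\<in>trees (V - V1). \<Sum>r\<in>?C V1. \<Sum>s\<in>?D V1. \<Sum>k\<in>UNIV. ?u k E1 r * ?v k E2 s)"
      by (simp only: sum_index_last)
    also have "\<dots> = (\<Sum>E1\<in>trees V1. \<Sum>E2\<in>trees (V - V1). \<Sum>r\<in>?C V1. \<Sum>s\<in>?D V1. ?w (insert (edge r s) (E1 \<union> E2)))"
    proof (intro sum.cong refl)
      fix E1 E2 r s
      assume A: "E1 \<in> trees V1" "E2 \<in> trees (V - V1)" "r \<in> ?C V1" "s \<in> ?D V1"
      have "legs r {#} = (\<lambda>_. {#} :: 'k multiset)" by (simp add: fun_eq_iff)
      then show "(\<Sum>k\<in>UNIV. ?u k E1 r * ?v k E2 s) = ?w (insert (edge r s) (E1 \<union> E2))"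
        using wt_split_legs[of V1 V E1 E2 r True s \<tau> "{#}"] A V1 by simp
    qed
    finally show "(\<Sum>k\<in>UNIV. (\<Sum>E1\<in>trees V1. \<Sum>r\<in>?C V1. ?u k E1 r) * (\<Sum>E2\<in>trees (V - V1). \<Sum>s\<in>?D V1. ?v k E2 s)) = \<dots>" .
  qed
  also have "\<dots> = (\<Sum>E\<in>trees V. \<Sum>(r, s)\<in>marked_edges True E. ?w E)"
    using sum_trees_with_marked_edge[OF assms, where c = True and F = "\<lambda>E r s. ?w E"] by simp
  also have "\<dots> = (\<Sum>E\<in>trees V. of_nat (card E) * ?w E)"
    using card_marked_edges[of _ V True] by (intro sum.cong) (auto simp: trees_def tree_def split_def)
  finally have edges: "(\<Sum>k\<in>UNIV. \<Sum>V1\<in>Pow V. rooted \<tau> True {#k#} V1 * rooted \<tau> False {#k#} (V - V1)) =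
    (\<Sum>E\<in>trees V. of_nat (card E) * ?w E)" .
  have l: "legs r {#} = (\<lambda>_. {#} :: 'k multiset)" for r by (simp add: fun_eq_iff)
  have "V = coloured True V \<union> coloured False V" "coloured True V \<inter> coloured False V = {}"
    by (auto simp: coloured_def)
  then have cV: "card V = card (coloured True V) + card (coloured False V)"
    using assms card_Un_disjoint finite_coloured by metis
  have "rooted \<tau> True {#} V + rooted \<tau> False {#} V = (\<Sum>E\<in>trees V. of_nat (card V) * ?w E)"
    unfolding rooted_def l cV by (simp add: sum_distrib_right distrib_right flip: sum.distrib)
  also have "\<dots> = (\<Sum>E\<in>trees V. of_nat (card E) * ?w E + ?w E)"
    by (rule sum.cong) (auto simp: trees_def algebra_simps dest!: tree_card)
  finally show ?thesis unfolding edges unrooted_def by (simp add: sum.distrib)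
qed

lemma invariant_rooted_aux:
  fixes \<tau> :: "bool \<Rightarrow> 'k::finite multiset \<Rightarrow> 'r :: comm_ring_1"
  assumes "finite V" and f: "relabelling f V"
  shows "(\<Sum>E\<in>trees (f ` V). \<Sum>r\<in>{r \<in> coloured c (f ` V). P (card (inc E r))}. wt \<tau> (f ` V) E (legs r \<kappa>)) =
     (\<Sum>E\<in>trees V. \<Sum>r\<in>{r \<in> coloured c V. P (card (inc E r))}. wt \<tau> V E (legs r \<kappa>))"
proof -
  let ?F = "map_prod f f"
  have inj: "inj_on f V" using f by (simp add: relabelling_def)
  have "(\<Sum>E\<in>trees (f ` V). \<Sum>r\<in>{r \<in> coloured c (f ` V). P (card (inc E r))}. wt \<tau> (f ` V) E (legs r \<kappa>)) =
    (\<Sum>E\<in>trees V. \<Sum>r\<in>{r \<in> coloured c (f ` V). P (card (inc (?F ` E) r))}. wt \<tau> (f ` V) (?F ` E) (legs r \<kappa>))"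
    by (rule sum.reindex_bij_betw[OF trees_relabel[OF f], symmetric])
  also have "\<dots> = (\<Sum>E\<in>trees V. \<Sum>r\<in>{r \<in> coloured c V. P (card (inc E r))}. wt \<tau> V E (legs r \<kappa>))"
  proof (rule sum.cong[OF refl])
    fix E assume "E \<in> trees V"
    then have sub: "E \<subseteq> V \<times> V" using tree_edges_subset by (auto simp: trees_def)
    let ?R = "{r \<in> coloured c V. P (card (inc E r))}"
    have P: "f r \<in> {r \<in> coloured c (f ` V). P (card (inc (?F ` E) r))} \<longleftrightarrow> r \<in> ?R" if "r \<in> V" for r
      using f that card_inc_relabel[OF inj sub that] by (simp add: coloured_def relabelling_def)
    have "{r \<in> coloured c (f ` V). P (card (inc (?F ` E) r))} = f ` ?R"
    proof (intro equalityI subsetI)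
      fix x assume x: "x \<in> {r \<in> coloured c (f ` V). P (card (inc (?F ` E) r))}"
      then obtain r where "r \<in> V" "x = f r" by (auto simp: coloured_def)
      then show "x \<in> f ` ?R" using x P by blast
    next
      fix x assume "x \<in> f ` ?R"
      then obtain r where r: "x = f r" "r \<in> ?R" by blast
      then have "r \<in> V" by (simp add: coloured_def)
      then show "x \<in> {r \<in> coloured c (f ` V). P (card (inc (?F ` E) r))}" using P r by blast
    qed
    moreover have "inj_on f ?R" by (rule inj_on_subset[OF inj]) (auto simp: coloured_def)
    ultimately have "(\<Sum>r\<in>{r \<in> coloured c (f ` V). P (card (inc (?F ` E) r))}. wt \<tau> (f ` V) (?F ` E) (legs r \<kappa>)) =
       (\<Sum>r\<in>?R. wt \<tau> (f ` V) (?F ` E) (legs (f r) \<kappa>))"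
      by (simp add: sum.reindex)
    also have "\<dots> = (\<Sum>r\<in>?R. wt \<tau> V E (legs r \<kappa>))"
    proof (rule sum.cong[OF refl])
      fix r assume "r \<in> ?R"
      then have r: "r \<in> V" by (simp add: coloured_def)
      have "wt \<tau> (f ` V) (?F ` E) (legs (f r) \<kappa>) = wt \<tau> V E (\<lambda>v. legs (f r) \<kappa> (f v))"
        by (rule wt_relabel[OF f sub])
      also have "\<dots> = wt \<tau> V E (legs r \<kappa>)"
        by (rule wt_cong) (use inj r in \<open>auto simp: inj_on_def\<close>)
      finally show "wt \<tau> (f ` V) (?F ` E) (legs (f r) \<kappa>) = wt \<tau> V E (legs r \<kappa>)" .
    qed
    finally show "(\<Sum>r\<in>{r \<in> coloured c (f ` V). P (card (inc (?F ` E) r))}. wt \<tau> (f ` V) (?F ` E) (legs r \<kappa>)) =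
       (\<Sum>r\<in>?R. wt \<tau> V E (legs r \<kappa>))" .
  qed
  finally show ?thesis .
qed

lemma invariant_rooted_deg: "invariant (rooted_deg \<tau> c \<kappa> d)"
  unfolding invariant_def rooted_deg_def using invariant_rooted_aux[where P = "\<lambda>n. n = d"] by blast

lemma invariant_rooted: "invariant (rooted \<tau> c \<kappa>)"
proof -
  have "rooted \<tau> c \<kappa> (f ` V) = rooted \<tau> c \<kappa> V" if "finite V" "relabelling f V" for V f
    using invariant_rooted_aux[OF that, where P = "\<lambda>_. True"] by (simp add: rooted_def)
  then show ?thesis by (simp add: invariant_def)
qed

section \<open>Generating functions of rooted trees\<close>

text \<open>These conditions exclude black leaves and make the degree in the variables equal to the number
  of white vertices, so that each coefficient of a series of trees is a finite sum.\<close>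

definition admissible :: "(bool \<Rightarrow> 'k multiset \<Rightarrow> 'w mps) \<Rightarrow> bool" where
  "admissible \<tau> \<longleftrightarrow> (\<forall>\<mu> \<nu>. mps_coeff (\<tau> True \<mu>) \<nu> \<noteq> 0 \<longrightarrow> \<nu> = {#} \<and> 2 \<le> size \<mu>) \<and>
     (\<forall>\<mu> \<nu>. mps_coeff (\<tau> False \<mu>) \<nu> \<noteq> 0 \<longrightarrow> size \<nu> = 1)"

lemma coeff_sum_nonzero:
  assumes "mps_coeff (\<Sum>x\<in>A. f x) \<mu> \<noteq> 0"
  obtains x where "x \<in> A" "mps_coeff (f x) \<mu> \<noteq> 0"
  using sum.not_neutral_contains_not_neutral[of "\<lambda>x. mps_coeff (f x) \<mu>" A] assms by auto

lemma coeff_prod_nonzero: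
  assumes "finite V" "mps_coeff (\<Prod>v\<in>V. f v) \<mu> \<noteq> 0"
    and "\<And>v \<nu>. v \<in> V \<Longrightarrow> mps_coeff (f v) \<nu> \<noteq> 0 \<Longrightarrow> size \<nu> = d v"
  shows "size \<mu> = (\<Sum>v\<in>V. d v)"
  using assms
proof (induction V arbitrary: \<mu> rule: finite_induct)
  case empty
  then show ?case by (simp add: coeff_one split: if_splits)
next
  case (insert v V)
  have "(\<Sum>p | fst p + snd p = \<mu>. mps_coeff (f v) (fst p) * mps_coeff (\<Prod>v\<in>V. f v) (snd p)) \<noteq> 0"
    using insert.prems(1) insert.hyps by (simp add: coeff_mult)
  then obtain p where "p \<in> {p. fst p + snd p = \<mu>}"
      "mps_coeff (f v) (fst p) * mps_coeff (\<Prod>v\<in>V. f v) (snd p) \<noteq> 0"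
    by (rule sum.not_neutral_contains_not_neutral)
  then have p: "fst p + snd p = \<mu>" "mps_coeff (f v) (fst p) \<noteq> 0" "mps_coeff (\<Prod>v\<in>V. f v) (snd p) \<noteq> 0"
    by auto
  have "size (snd p) = (\<Sum>v\<in>V. d v)" by (rule insert.IH[OF p(3)]) (use insert.prems in auto)
  moreover have "size (fst p) = d v" using insert.prems(2) p(2) by simp
  ultimately show ?case using insert.hyps p(1) by auto
qed

text \<open>If all black vertices have at least two indices, counting edges by their black ends bounds the
  number of black vertices.\<close>

lemma wt_nonzero:
  fixes \<tau> :: "bool \<Rightarrow> 'k::finite multiset \<Rightarrow> 'w mps"
  assumes ad: "admissible \<tau>" and T: "tree V E" and nz: "mps_coeff (wt \<tau> V E L) \<mu> \<noteq> 0"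
  shows "size \<mu> = card (coloured False V)"
    "card (coloured True V) < card (coloured False V) + (\<Sum>b\<in>coloured True V. size (L b))"
    "\<And>b. b \<in> coloured True V \<Longrightarrow> 2 \<le> size (L b) + card (inc E b)"
proof -
  have finV: "finite V" and subE: "E \<subseteq> edges_on V" using T by (auto simp: tree_def)
  have V: "V = coloured True V \<union> coloured False V" "coloured True V \<inter> coloured False V = {}"
    by (auto simp: coloured_def)
  let ?f = "\<lambda>e v. \<tau> (0 < v) (L v + image_mset e (mset_set (inc E v)))"
  obtain e where e: "mps_coeff (\<Prod>v\<in>V. ?f e v) \<mu> \<noteq> 0"
    using nz unfolding wt_def by (rule coeff_sum_nonzero)
  have "size \<mu> = (\<Sum>v\<in>V. if 0 < v then 0 else 1)"
  proof (rule coeff_prod_nonzero[OF finV e])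
    fix v \<nu> assume A: "v \<in> V" "mps_coeff (?f e v) \<nu> \<noteq> 0"
    show "size \<nu> = (if 0 < v then 0 else 1)"
      using ad A(2) by (cases "0 < v") (simp_all add: admissible_def)
  qed
  also have "\<dots> = card {v \<in> V. \<not> 0 < v}"
    using finV by (simp add: sum.If_cases Int_def)
  finally show "size \<mu> = card (coloured False V)" by (simp add: coloured_def)
  show deg: "2 \<le> size (L b) + card (inc E b)" if "b \<in> coloured True V" for b
  proof -
    have b: "b \<in> V" "0 < b" using that by (auto simp: coloured_def)
    have "?f e b \<noteq> 0"
    proof
      assume "?f e b = 0"
      then have "(\<Prod>v\<in>V. ?f e v) = 0" using prod.remove[OF finV b(1), of "?f e"] by simp
      then show False using e by simp
    qed
    then obtain \<nu> where nz: "mps_coeff (?f e b) \<nu> \<noteq> 0"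
      using mps_eqI[of "?f e b" 0] by auto
    have ge2: "2 \<le> size \<mu>" if "mps_coeff (\<tau> True \<mu>) \<nu> \<noteq> 0" for \<mu>
      using ad that unfolding admissible_def by blast
    have "2 \<le> size (L b + image_mset e (mset_set (inc E b)))"
      by (rule ge2) (use nz b(2) in simp)
    then show ?thesis by simp
  qed
  have "2 * card (coloured True V) = (\<Sum>b\<in>coloured True V. 2)" by simp
  also have "\<dots> \<le> (\<Sum>b\<in>coloured True V. size (L b) + card (inc E b))"
    by (rule sum_mono) (rule deg)
  also have "\<dots> = (\<Sum>b\<in>coloured True V. size (L b)) + card E"
    by (simp add: sum.distrib card_edges_black_degrees[OF subE finV])
  finally have "2 * card (coloured True V) \<le> (\<Sum>b\<in>coloured True V. size (L b)) + card E" .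
  moreover have "card V = card (coloured True V) + card (coloured False V)"
    using V card_Un_disjoint[of "coloured True V" "coloured False V"] finV by simp
  ultimately show "card (coloured True V) < card (coloured False V) + (\<Sum>b\<in>coloured True V. size (L b))"
    using tree_card[OF T] by linarith
qed

lemma sum_legs: "finite X \<Longrightarrow> (\<Sum>b\<in>X. size (legs r \<kappa> b)) \<le> size \<kappa>"
proof -
  assume "finite X"
  have "(\<Sum>b\<in>X. size (legs r \<kappa> b)) = (\<Sum>b\<in>X. if b = r then size \<kappa> else 0)"
    by (rule sum.cong) auto
  then show ?thesis using \<open>finite X\<close> by simp
qed

lemma wt_legs_nonzero:
  fixes \<tau> :: "bool \<Rightarrow> 'k::finite multiset \<Rightarrow> 'w mps"
  assumes "admissible \<tau>" "E \<in> trees V" "mps_coeff (wt \<tau> V E (legs r \<kappa>)) \<mu> \<noteq> 0"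
  shows "size \<mu> = card (coloured False V) \<and> card (coloured True V) < card (coloured False V) + size \<kappa>"
proof -
  have T: "tree V E" and "finite V" using assms(2) by (auto simp: trees_def tree_def)
  then have "(\<Sum>b\<in>coloured True V. size (legs r \<kappa> b)) \<le> size \<kappa>" by (intro sum_legs) simp
  then show ?thesis using wt_nonzero(1,2)[OF assms(1) T assms(3)] by linarith
qed

lemma graded_rooted_deg: "admissible \<tau> \<Longrightarrow> graded (size \<kappa>) (rooted_deg \<tau> c \<kappa> d)"
  unfolding graded_def rooted_deg_def
  by (intro allI impI; (erule coeff_sum_nonzero)+) (rule wt_legs_nonzero)

lemma graded_rooted: "admissible \<tau> \<Longrightarrow> graded (size \<kappa>) (rooted \<tau> c \<kappa>)"
  unfolding graded_def rooted_def
  by (intro allI impI; (erule coeff_sum_nonzero)+) (rule wt_legs_nonzero)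

lemma graded_unrooted: 
  assumes ad: "admissible \<tau>"
  shows "graded 0 (unrooted \<tau>)"
  unfolding graded_def unrooted_def
proof (intro allI impI, erule coeff_sum_nonzero)
  fix V \<mu> E assume "E \<in> trees V" "mps_coeff (wt \<tau> V E (\<lambda>_. {#})) \<mu> \<noteq> 0"
  then show "size \<mu> = card (coloured False V) \<and> card (coloured True V) < card (coloured False V) + 0"
    using wt_nonzero(1,2)[OF ad, of V E "\<lambda>_. {#}" \<mu>] by (simp add: trees_def)
qed

definition rooted_deg_gf :: "(bool \<Rightarrow> 'k::finite multiset \<Rightarrow> 'w mps) \<Rightarrow> bool \<Rightarrow> 'k multiset \<Rightarrow> nat \<Rightarrow> 'w mps" where
  "rooted_deg_gf \<tau> c \<kappa> d = egf (rooted_deg \<tau> c \<kappa> d)"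

definition rooted_gf :: "(bool \<Rightarrow> 'k::finite multiset \<Rightarrow> 'w mps) \<Rightarrow> bool \<Rightarrow> 'k multiset \<Rightarrow> 'w mps" where
  "rooted_gf \<tau> c \<kappa> = egf (rooted \<tau> c \<kappa>)"

lemma rooted_deg_gf_Suc:
  fixes \<tau> :: "bool \<Rightarrow> 'k::finite multiset \<Rightarrow> 'w mps"
  assumes ad: "admissible \<tau>"
  shows "of_nat (Suc d) * rooted_deg_gf \<tau> c \<kappa> (Suc d) =
    (\<Sum>k\<in>UNIV. rooted_deg_gf \<tau> c (add_mset k \<kappa>) d * rooted_gf \<tau> (\<not> c) {#k#})"
proof -
  let ?P = "\<lambda>k V. \<Sum>V1\<in>Pow V. rooted_deg \<tau> c (add_mset k \<kappa>) d V1 * rooted \<tau> (\<not> c) {#k#} (V - V1)"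
  have "formal_has_sum (\<lambda>p. \<Sum>k\<in>UNIV. egf_term (?P k) p) UNIV
      (\<Sum>k\<in>UNIV. rooted_deg_gf \<tau> c (add_mset k \<kappa>) d * rooted_gf \<tau> (\<not> c) {#k#})"
    unfolding rooted_deg_gf_def rooted_gf_def
    by (intro formal_has_sum_sum egf_mult[OF _ _ graded_rooted_deg[OF ad] graded_rooted[OF ad]]
        invariant_rooted_deg invariant_rooted) simp
  moreover have "(\<Sum>k\<in>UNIV. egf_term (?P k) p) = of_nat (Suc d) * egf_term (rooted_deg \<tau> c \<kappa> (Suc d)) p" for p
  proof -
    have "(\<Sum>k\<in>UNIV. egf_term (?P k) p) = mps_const (1 / (fact (fst p) * fact (snd p)))
        * (\<Sum>k\<in>UNIV. ?P k (std (fst p) (snd p)))"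
      by (simp only: egf_term_def sum_distrib_left)
    also have "\<dots> = of_nat (Suc d) * egf_term (rooted_deg \<tau> c \<kappa> (Suc d)) p"
      by (simp only: rooted_deg_Suc[OF finite_std, symmetric] egf_term_def mult_ac)
    finally show ?thesis .
  qed
  ultimately have "formal_has_sum (\<lambda>p. of_nat (Suc d) * egf_term (rooted_deg \<tau> c \<kappa> (Suc d)) p) UNIV
      (\<Sum>k\<in>UNIV. rooted_deg_gf \<tau> c (add_mset k \<kappa>) d * rooted_gf \<tau> (\<not> c) {#k#})"
    by (simp only:)
  moreover have "formal_has_sum (\<lambda>p. of_nat (Suc d) * egf_term (rooted_deg \<tau> c \<kappa> (Suc d)) p) UNIV
      (of_nat (Suc d) * rooted_deg_gf \<tau> c \<kappa> (Suc d))"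
    unfolding rooted_deg_gf_def
    by (intro formal_has_sum_cmult egf_has_sum[OF graded_rooted_deg[OF ad]])
  ultimately show ?thesis by (rule formal_has_sum_unique[symmetric])
qed

lemma trees_singleton: "trees {v} = {{}}"
proof -
  have "E = {}" if "tree {v} E" for E
  proof -
    have "E \<subseteq> edges_on {v}" using that by (simp add: tree_def)
    then show ?thesis by (auto simp: edges_on_def)
  qed
  then show ?thesis using tree_no_edges[of "{v}"] by (auto simp: trees_def)
qed

lemma tree_root_degree_0:
  assumes T: "tree V E" and r: "r \<in> V" "card (inc E r) = 0"
  shows "V = {r}"
proof -
  have "inc E r = {}" using r(2) tree_finite_edges[OF T] by (simp add: inc_def)
  then have no: "(r, y) \<notin> adj E" for y by (auto simp: inc_def adj_def)
  have "v = r" if "v \<in> V" for v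
  proof -
    have "(r, v) \<in> (adj E)\<^sup>*" using T r(1) that unfolding tree_def by blast
    then show ?thesis using no by (auto elim: converse_rtranclE)
  qed
  then show ?thesis using r(1) by blast
qed

lemma rooted_deg_0:
  fixes \<tau> :: "bool \<Rightarrow> 'k::finite multiset \<Rightarrow> 'r :: comm_ring_1"
  shows "rooted_deg \<tau> c \<kappa> 0 V = (if \<exists>r. V = {r} \<and> (0 < r) = c then \<tau> c \<kappa> else 0)"
proof (cases "\<exists>r. V = {r}")
  case True
  then obtain r where [simp]: "V = {r}" by blast
  have "{x \<in> coloured c {r}. card (inc {} x) = 0} = (if (0 < r) = c then {r} else {})"
    by (auto simp: coloured_def inc_def)
  moreover have "wt \<tau> {r} {} (legs r \<kappa>) = \<tau> (0 < r) \<kappa>" by (simp add: wt_def inc_def)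
  ultimately show ?thesis by (auto simp: rooted_deg_def trees_singleton)
next
  case False
  then have e: "{r \<in> coloured c V. card (inc E r) = 0} = {}" if "E \<in> trees V" for E
    using that tree_root_degree_0 unfolding trees_def coloured_def by blast
  have "rooted_deg \<tau> c \<kappa> 0 V = 0"
    unfolding rooted_deg_def by (rule sum.neutral, rule ballI) (simp only: e sum.empty)
  then show ?thesis using False by auto
qed

lemma rooted_deg_gf_0:
  fixes \<tau> :: "bool \<Rightarrow> 'k::finite multiset \<Rightarrow> 'w mps"
  assumes ad: "admissible \<tau>"
  shows "rooted_deg_gf \<tau> c \<kappa> 0 = \<tau> c \<kappa>"
  unfolding rooted_deg_gf_def
proof (rule egf_eqI[OF graded_rooted_deg[OF ad]])
  let ?p = "if c then (1, 0) else (0, 1) :: nat \<times> nat"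
  have std1: "std (Suc 0) 0 = {1}" "std 0 (Suc 0) = {-1}" by (auto simp: std_def)
  have "rooted_deg \<tau> c \<kappa> 0 (std n m) = 0" if "(n, m) \<noteq> ?p" for n m
  proof -
    have "False" if "std n m = {r}" "(0 < r) = c" for r
    proof -
      have "coloured True {r} = (if c then {r} else {})" "coloured False {r} = (if c then {} else {r})"
        using that(2) by (auto simp: coloured_def)
      then have "n = (if c then 1 else 0)" "m = (if c then 0 else 1)"
        using card_coloured_std[of n m] that(1) by auto
      then show False using \<open>(n, m) \<noteq> ?p\<close> by (cases c) auto
    qed
    then show ?thesis by (auto simp: rooted_deg_0)
  qed
  then have "egf_term (rooted_deg \<tau> c \<kappa> 0) p = 0" if "p \<in> UNIV - {?p}" for p
    using that by (cases p) (auto simp: egf_term_def)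
  moreover have "egf_term (rooted_deg \<tau> c \<kappa> 0) ?p = \<tau> c \<kappa>"
    by (cases c) (simp_all add: egf_term_def rooted_deg_0 std1)
  then have "formal_has_sum (egf_term (rooted_deg \<tau> c \<kappa> 0)) {?p} (\<tau> c \<kappa>)"
    using formal_has_sum_finite[of "{?p}" "egf_term (rooted_deg \<tau> c \<kappa> 0)"] by simp
  ultimately show "formal_has_sum (egf_term (rooted_deg \<tau> c \<kappa> 0)) UNIV (\<tau> c \<kappa>)"
    using formal_has_sum_neutral[of "{?p}" UNIV] by blast
qed

lemma sum_words_Suc:
  fixes f :: "'k::finite list \<Rightarrow> 'r :: comm_monoid_add"
  shows "(\<Sum>is | length is = Suc d. f is) = (\<Sum>k\<in>UNIV. \<Sum>is | length is = d. f (k # is))"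
proof -
  have "(\<Sum>is | length is = Suc d. f is) = (\<Sum>(k, is)\<in>UNIV \<times> {is. length is = d}. f (k # is))"
    by (rule sum.reindex_bij_witness[of _ "\<lambda>(k, is). k # is" "\<lambda>is. (hd is, tl is)"])
       (auto simp: length_Suc_conv)
  then show ?thesis by (simp add: sum.cartesian_product')
qed

text \<open>Iterating the cut at the root: a rooted tree is a root together with a set of rooted trees of
  the other colour.\<close>

theorem rooted_deg_gf_words:
  fixes \<tau> :: "bool \<Rightarrow> 'k::finite multiset \<Rightarrow> 'w mps"
  assumes ad: "admissible \<tau>"
  shows "of_nat (fact d) * rooted_deg_gf \<tau> c \<kappa> d =
    (\<Sum>is | length is = d. \<tau> c (\<kappa> + mset is) * (\<Prod>i\<leftarrow>is. rooted_gf \<tau> (\<not> c) {#i#}))"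
proof (induction d arbitrary: \<kappa>)
  case 0
  then show ?case by (simp add: rooted_deg_gf_0[OF ad])
next
  case (Suc d)
  let ?Z = "\<lambda>i. rooted_gf \<tau> (\<not> c) {#i#}"
  have "of_nat (fact (Suc d)) * rooted_deg_gf \<tau> c \<kappa> (Suc d) = of_nat (fact d) * (of_nat (Suc d) * rooted_deg_gf \<tau> c \<kappa> (Suc d))"
    by (simp add: algebra_simps)
  also have "\<dots> = (\<Sum>k\<in>UNIV. (of_nat (fact d) * rooted_deg_gf \<tau> c (add_mset k \<kappa>) d) * ?Z k)"
    by (simp only: rooted_deg_gf_Suc[OF ad] sum_distrib_left mult_ac)
  also have "\<dots> = (\<Sum>k\<in>UNIV. \<Sum>is | length is = d. \<tau> c (add_mset k \<kappa> + mset is) * (\<Prod>i\<leftarrow>is. ?Z i) * ?Z k)"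
    by (simp only: Suc.IH sum_distrib_right)
  also have "\<dots> = (\<Sum>is | length is = Suc d. \<tau> c (\<kappa> + mset is) * (\<Prod>i\<leftarrow>is. ?Z i))"
    by (simp add: sum_words_Suc mult_ac)
  finally show ?case .
qed

lemma rooted_deg_eq_0:
  assumes "card V \<le> d"
  shows "rooted_deg \<tau> c \<kappa> d V = 0"
proof -
  have e: "{r \<in> coloured c V. card (inc E r) = d} = {}" if "E \<in> trees V" for E
  proof -
    have T: "tree V E" using that by (simp add: trees_def)
    have "card (inc E r) \<le> card E" for r
      by (rule card_mono[OF tree_finite_edges[OF T]]) (auto simp: inc_def)
    then show ?thesis using tree_card[OF T] assms by (auto simp: not_le[symmetric] Suc_le_eq)
  qed
  show ?thesis unfolding rooted_deg_def by (rule sum.neutral, rule ballI) (simp only: e sum.empty)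
qed

lemma rooted_sum_deg:
  assumes "finite V"
  shows "rooted \<tau> c \<kappa> V = (\<Sum>d<card V. rooted_deg \<tau> c \<kappa> d V)"
proof -
  have "(\<Sum>d<card V. rooted_deg \<tau> c \<kappa> d V) =
     (\<Sum>E\<in>trees V. \<Sum>d<card V. \<Sum>r\<in>{r \<in> coloured c V. card (inc E r) = d}. wt \<tau> V E (legs r \<kappa>))"
    unfolding rooted_deg_def by (rule sum.swap)
  also have "\<dots> = rooted \<tau> c \<kappa> V"
    unfolding rooted_def
  proof (rule sum.cong[OF refl], rule sum.group)
    fix E assume "E \<in> trees V"
    then have T: "tree V E" by (simp add: trees_def)
    have "card (inc E r) \<le> card E" for r
      by (rule card_mono[OF tree_finite_edges[OF T]]) (auto simp: inc_def)
    then show "(\<lambda>r. card (inc E r)) ` coloured c V \<subseteq> {..<card V}"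
      using tree_card[OF T] by (auto simp: less_Suc_eq_le)
  qed (use assms in auto)
  finally show ?thesis by simp
qed

text \<open>Both groupings of the double sum over vertex numbers and root degrees are legitimate because
  the root degree is smaller than the number of vertices.\<close>

theorem rooted_gf_by_degree:
  fixes \<tau> :: "bool \<Rightarrow> 'k::finite multiset \<Rightarrow> 'w mps"
  assumes ad: "admissible \<tau>"
  shows "formal_has_sum (rooted_deg_gf \<tau> c \<kappa>) UNIV (rooted_gf \<tau> c \<kappa>)"
proof -
  let ?f = "\<lambda>(p, d). egf_term (rooted_deg \<tau> c \<kappa> d) p"
  have "formally_summable ?f (UNIV \<times> UNIV)"
    unfolding formally_summable_def
  proof
    fix \<mu> :: "'w multiset"
    let ?P = "{..<size \<mu> + size \<kappa>} \<times> {size \<mu>}"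
    have card_std: "card (std n m) = n + m" for n m
      unfolding std_def by (subst card_Un_disjoint) auto
    have "{t \<in> UNIV \<times> UNIV. mps_coeff (?f t) \<mu> \<noteq> 0} \<subseteq> Sigma ?P (\<lambda>p. {..<fst p + snd p})"
    proof
      fix t assume t: "t \<in> {t \<in> UNIV \<times> UNIV. mps_coeff (?f t) \<mu> \<noteq> 0}"
      obtain p d where [simp]: "t = (p, d)" by (cases t) blast
      have nz: "mps_coeff (egf_term (rooted_deg \<tau> c \<kappa> d) p) \<mu> \<noteq> 0" using t by simp
      then have "p \<in> ?P" using graded_egf_term[OF graded_rooted_deg[OF ad] nz] by (cases p) auto
      moreover have "rooted_deg \<tau> c \<kappa> d (std (fst p) (snd p)) \<noteq> 0" using nz by (auto simp: egf_term_def)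
      then have "d < fst p + snd p" using rooted_deg_eq_0[of "std (fst p) (snd p)" d] card_std by (metis not_le)
      ultimately show "t \<in> Sigma ?P (\<lambda>p. {..<fst p + snd p})" by simp
    qed
    then show "finite {t \<in> UNIV \<times> UNIV. mps_coeff (?f t) \<mu> \<noteq> 0}"
      by (rule finite_subset) auto
  qed
  then obtain s where s: "formal_has_sum ?f (UNIV \<times> UNIV) s"
    using formal_has_sum_summable by blast
  have "formal_has_sum (egf_term (rooted \<tau> c \<kappa>)) UNIV s"
  proof (rule formal_has_sum_Sigma[OF s])
    fix p :: "nat \<times> nat"
    let ?V = "std (fst p) (snd p)"
    have "egf_term (rooted \<tau> c \<kappa>) p = (\<Sum>d<card ?V. egf_term (rooted_deg \<tau> c \<kappa> d) p)"
      by (simp add: egf_term_def rooted_sum_deg sum_distrib_left)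
    then have "formal_has_sum (\<lambda>d. egf_term (rooted_deg \<tau> c \<kappa> d) p) {..<card ?V} (egf_term (rooted \<tau> c \<kappa>) p)"
      by (simp add: formal_has_sum_finite)
    then show "formal_has_sum (\<lambda>d. ?f (p, d)) UNIV (egf_term (rooted \<tau> c \<kappa>) p)"
      by (subst formal_has_sum_neutral[of "{..<card ?V}"]) (auto simp: egf_term_def rooted_deg_eq_0)
  qed
  then have s_eq: "s = rooted_gf \<tau> c \<kappa>"
    using egf_eqI[OF graded_rooted[OF ad]] by (simp add: rooted_gf_def)
  have "bij_betw prod.swap (UNIV \<times> UNIV) (UNIV \<times> UNIV :: ((nat \<times> nat) \<times> nat) set)"
    by (auto simp: bij_betw_def inj_on_def)
  then have "formal_has_sum (\<lambda>x. ?f (prod.swap x)) (UNIV \<times> UNIV) s"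
    using s by (rule formal_has_sum_reindex[of _ _ _ ?f, THEN iffD1])
  then have "formal_has_sum (rooted_deg_gf \<tau> c \<kappa>) UNIV s"
  proof (rule formal_has_sum_Sigma)
    fix d :: nat
    show "formal_has_sum (\<lambda>p. ?f (prod.swap (d, p))) UNIV (rooted_deg_gf \<tau> c \<kappa> d)"
      using egf_has_sum[OF graded_rooted_deg[OF ad]] by (simp add: rooted_deg_gf_def)
  qed
  then show ?thesis by (simp only: s_eq)
qed

corollary rooted_gf_words:
  fixes \<tau> :: "bool \<Rightarrow> 'k::finite multiset \<Rightarrow> 'w mps"
  assumes ad: "admissible \<tau>"
  shows "formal_has_sum (\<lambda>d. \<Sum>is | length is = d.
      mps_const (1 / fact d) * \<tau> c (\<kappa> + mset is) * (\<Prod>i\<leftarrow>is. rooted_gf \<tau> (\<not> c) {#i#})) UNIV (rooted_gf \<tau> c \<kappa>)"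
proof (rule formal_has_sum_cong[OF _ rooted_gf_by_degree[OF ad]])
  fix d :: nat
  have "mps_const (1 / fact d) * (of_nat (fact d) :: 'w mps) = mps_const (1 / fact d * real (fact d))"
    by (simp only: mps_const_mult mps_const_of_nat)
  then have "mps_const (1 / fact d) * (of_nat (fact d) :: 'w mps) = 1"
    by simp
  then have "rooted_deg_gf \<tau> c \<kappa> d = mps_const (1 / fact d) * (of_nat (fact d) * rooted_deg_gf \<tau> c \<kappa> d)"
    by (simp flip: mult.assoc)
  then show "rooted_deg_gf \<tau> c \<kappa> d = (\<Sum>is | length is = d.
      mps_const (1 / fact d) * \<tau> c (\<kappa> + mset is) * (\<Prod>i\<leftarrow>is. rooted_gf \<tau> (\<not> c) {#i#}))"
    by (simp add: rooted_deg_gf_words[OF ad] sum_distrib_left mult.assoc)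
qed

theorem unrooted_gf:
  fixes \<tau> :: "bool \<Rightarrow> 'k::finite multiset \<Rightarrow> 'w mps"
  assumes ad: "admissible \<tau>"
  shows "egf (unrooted \<tau>) = rooted_gf \<tau> True {#} + rooted_gf \<tau> False {#}
    - (\<Sum>k\<in>UNIV. rooted_gf \<tau> True {#k#} * rooted_gf \<tau> False {#k#})"
proof (rule egf_eqI[OF graded_unrooted[OF ad]])
  let ?P = "\<lambda>k V. \<Sum>V1\<in>Pow V. rooted \<tau> True {#k#} V1 * rooted \<tau> False {#k#} (V - V1)"
  have "formal_has_sum (\<lambda>p. egf_term (rooted \<tau> True {#}) p + egf_term (rooted \<tau> False {#}) p
      - (\<Sum>k\<in>UNIV. egf_term (?P k) p)) UNIV
    (rooted_gf \<tau> True {#} + rooted_gf \<tau> False {#} - (\<Sum>k\<in>UNIV. rooted_gf \<tau> True {#k#} * rooted_gf \<tau> False {#k#}))"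
    unfolding rooted_gf_def
    by (intro formal_has_sum_diff formal_has_sum_add formal_has_sum_sum
        egf_mult[OF _ _ graded_rooted[OF ad] graded_rooted[OF ad]] invariant_rooted
        egf_has_sum[OF graded_rooted[OF ad]]) simp
  then show "formal_has_sum (egf_term (unrooted \<tau>)) UNIV
    (rooted_gf \<tau> True {#} + rooted_gf \<tau> False {#} - (\<Sum>k\<in>UNIV. rooted_gf \<tau> True {#k#} * rooted_gf \<tau> False {#k#}))"
    by (rule formal_has_sum_cong[rotated])
       (simp add: egf_term_def dissymmetry[OF finite_std] sum_distrib_left algebra_simps)
qed

lemma no_const_rooted_gf:
  fixes \<tau> :: "bool \<Rightarrow> 'k::finite multiset \<Rightarrow> 'w mps"
  assumes ad: "admissible \<tau>"
  shows "no_const (\<lambda>i. rooted_gf \<tau> c {#i#})"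
  unfolding no_const_def
proof
  fix i
  have "mps_coeff (egf_term (rooted \<tau> c {#i#}) p) {#} = 0" for p
  proof (rule ccontr)
    assume nz: "mps_coeff (egf_term (rooted \<tau> c {#i#}) p) {#} \<noteq> 0"
    then have "snd p = 0" "fst p = 0"
      using graded_egf_term[OF graded_rooted[OF ad] nz] by auto
    moreover have "rooted \<tau> c {#i#} (std 0 0) = 0" by (simp add: rooted_def trees_def tree_def std_def)
    ultimately show False using nz by (simp add: egf_term_def)
  qed
  then show "mps_coeff (rooted_gf \<tau> c {#i#}) {#} = 0"
    by (simp add: rooted_gf_def egf_def formal_sum_def)
qed

section \<open>Symmetry of higher partial derivatives\<close>

lemma has_derivative_along_line:
  fixes f :: "'a::real_normed_vector \<Rightarrow> real"
  assumes "f differentiable (at (z + t *\<^sub>R u))"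
  shows "((\<lambda>s. f (z + s *\<^sub>R u)) has_real_derivative frechet_derivative f (at (z + t *\<^sub>R u)) u) (at t)"
proof -
  let ?D = "frechet_derivative f (at (z + t *\<^sub>R u))"
  have D: "(f has_derivative ?D) (at (z + t *\<^sub>R u))"
    using assms by (simp add: frechet_derivative_works)
  have "((\<lambda>s. z + s *\<^sub>R u) has_derivative (\<lambda>s. s *\<^sub>R u)) (at t)"
    by (auto intro!: derivative_eq_intros)
  from has_derivative_compose[OF this D]
  have "((\<lambda>s. f (z + s *\<^sub>R u)) has_derivative (\<lambda>s. ?D (s *\<^sub>R u))) (at t)" .
  moreover have "(\<lambda>s. ?D (s *\<^sub>R u)) = (*) (?D u)"
    using linear_frechet_derivative[OF assms] by (simp add: fun_eq_iff linear_cmul)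
  ultimately show ?thesis by (simp add: has_field_derivative_def)
qed

text \<open>The second difference quotient is symmetric in the two directions and converges to either
  iterated derivative; the mean value theorem is applied only in the direction of the inner
  derivative, so that differentiability of that derivative at the point suffices.\<close>

lemma second_difference_tendsto:
  fixes f :: "'a::real_normed_vector \<Rightarrow> real"
  assumes V: "open V" "y \<in> V" and f: "\<And>z. z \<in> V \<Longrightarrow> f differentiable (at z)"
    and G: "((\<lambda>z. frechet_derivative f (at z) u) has_derivative G') (at y)"
    and uv: "norm u = 1" "norm v = 1"
  shows "((\<lambda>h. (f (y + h *\<^sub>R u + h *\<^sub>R v) - f (y + h *\<^sub>R u) - f (y + h *\<^sub>R v) + f y) / h^2) \<longlongrightarrow> G' v) (at_right 0)"
    (is "(?q \<longlongrightarrow> _) _")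
proof (rule tendstoI)
  fix e :: real assume "0 < e"
  define e' where "e' = e / 4"
  have e': "0 < e'" using \<open>0 < e\<close> by (simp add: e'_def)
  let ?G = "\<lambda>z. frechet_derivative f (at z) u"
  have lin: "linear G'" using G by (rule has_derivative_linear)
  obtain d1 where d1: "0 < d1" "\<And>z. norm (z - y) < d1 \<Longrightarrow> norm (?G z - ?G y - G' (z - y)) \<le> e' * norm (z - y)"
    using G e' unfolding has_derivative_at_alt by blast
  obtain d2 where d2: "0 < d2" "ball y d2 \<subseteq> V" using V open_contains_ball by blast
  define d where "d = min d1 d2 / 2"
  have d: "0 < d" using d1(1) d2(1) by (simp add: d_def)
  have close: "dist (?q h) (G' v) < e" if h: "0 < h" "h < d" for h
  proof -
    have small: "norm (t *\<^sub>R u + s *\<^sub>R v) \<le> t + s" if "0 \<le> t" "0 \<le> s" for t s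
      using norm_triangle_ineq[of "t *\<^sub>R u" "s *\<^sub>R v"] that uv by simp
    have near: "norm (t *\<^sub>R u + s *\<^sub>R v) < d1" "y + t *\<^sub>R u + s *\<^sub>R v \<in> V"
      if "0 \<le> t" "t \<le> h" "0 \<le> s" "s \<le> h" for t s
    proof -
      have "norm (t *\<^sub>R u + s *\<^sub>R v) < 2 * d" using small[of t s] that h by linarith
      then have "norm (t *\<^sub>R u + s *\<^sub>R v) < d1" and *: "norm (t *\<^sub>R u + s *\<^sub>R v) < d2"
        by (auto simp: d_def)
      then show "norm (t *\<^sub>R u + s *\<^sub>R v) < d1" by simp
      have dist_add: "dist y (y + w) = norm w" for w by (simp add: dist_norm)
      have "dist y (y + t *\<^sub>R u + s *\<^sub>R v) = norm (t *\<^sub>R u + s *\<^sub>R v)"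
        using dist_add[of "t *\<^sub>R u + s *\<^sub>R v"] by (simp only: add.assoc)
      then show "y + t *\<^sub>R u + s *\<^sub>R v \<in> V" using * d2(2) by (auto simp: subset_iff)
    qed
    let ?\<phi> = "\<lambda>t. f (y + h *\<^sub>R v + t *\<^sub>R u) - f (y + t *\<^sub>R u)"
    let ?\<phi>' = "\<lambda>t. ?G (y + h *\<^sub>R v + t *\<^sub>R u) - ?G (y + t *\<^sub>R u)"
    have "\<exists>t. 0 < t \<and> t < h \<and> ?\<phi> h - ?\<phi> 0 = (h - 0) * ?\<phi>' t"
    proof (rule MVT2[OF h(1)])
      fix t assume t: "0 \<le> t" "t \<le> h"
      have "y + h *\<^sub>R v + t *\<^sub>R u \<in> V" "y + t *\<^sub>R u \<in> V"
        using near(2)[of t h] near(2)[of t 0] t h by (simp_all add: algebra_simps)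
      then show "(?\<phi> has_real_derivative ?\<phi>' t) (at t)"
        by (intro DERIV_diff has_derivative_along_line f)
    qed
    then obtain t where t: "0 < t" "t < h" "?\<phi> h - ?\<phi> 0 = h * ?\<phi>' t" by auto
    have q: "?q h = ?\<phi>' t / h"
    proof -
      have "f (y + h *\<^sub>R u + h *\<^sub>R v) - f (y + h *\<^sub>R u) - f (y + h *\<^sub>R v) + f y = ?\<phi> h - ?\<phi> 0"
        by (simp add: algebra_simps)
      also have "\<dots> = h * ?\<phi>' t" by (rule t(3))
      finally show ?thesis using h(1) by (simp only: power2_eq_square) simp
    qed
    let ?a = "t *\<^sub>R u + h *\<^sub>R v" and ?b = "t *\<^sub>R u"
    have a: "norm (?G (y + ?a) - ?G y - G' ?a) \<le> e' * (2 * h)"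
    proof -
      have "norm (?G (y + ?a) - ?G y - G' ?a) \<le> e' * norm ?a"
        using d1(2)[of "y + ?a"] near(1)[of t h] t h by simp
      also have "\<dots> \<le> e' * (2 * h)" using small[of t h] t h e' by (intro mult_left_mono) auto
      finally show ?thesis .
    qed
    have b: "norm (?G (y + ?b) - ?G y - G' ?b) \<le> e' * h"
    proof -
      have "norm (?G (y + ?b) - ?G y - G' ?b) \<le> e' * norm ?b"
        using d1(2)[of "y + ?b"] near(1)[of t 0] t h by simp
      also have "\<dots> \<le> e' * h" using t e' uv by (intro mult_left_mono) auto
      finally show ?thesis .
    qed
    have "G' ?a = G' ?b + h * G' v" using lin by (simp add: linear_add linear_cmul)
    then have eq: "?\<phi>' t - h * G' v = (?G (y + ?a) - ?G y - G' ?a) - (?G (y + ?b) - ?G y - G' ?b)"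
      by (simp add: algebra_simps)
    have "norm (?\<phi>' t - h * G' v) \<le> e' * (2 * h) + e' * h"
      unfolding eq by (rule order_trans[OF norm_triangle_ineq4 add_mono[OF a b]])
    moreover have "0 < e * h" using h(1) \<open>0 < e\<close> by simp
    then have "e' * (2 * h) + e' * h < e * h" by (simp add: e'_def)
    ultimately have less: "norm (?\<phi>' t - h * G' v) < e * h" by (rule le_less_trans)
    have "A / h - B = (A - h * B) / h" for A B
      using h(1) by (simp add: diff_divide_distrib)
    then have "dist (?q h) (G' v) = norm (?\<phi>' t - h * G' v) / norm h"
      by (simp only: q dist_norm norm_divide)
    also have "\<dots> < e" using less h(1) by (simp only: pos_divide_less_eq real_norm_def abs_of_pos)
    finally show "dist (?q h) (G' v) < e" .
  qed
  show "\<forall>\<^sub>F h in at_right 0. dist (?q h) (G' v) < e"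
  proof (rule eventually_at_rightI[OF _ d])
    fix h assume "h \<in> {0<..<d}"
    then have "0 < h" "h < d" by simp_all
    then show "dist (?q h) (G' v) < e" by (rule close)
  qed
qed

theorem pderiv_at_commute:
  fixes f :: "real^'k::finite \<Rightarrow> real"
  assumes V: "open V" "y \<in> V" and f: "f differentiable_on V"
    "pderiv_at i f differentiable_on V" "pderiv_at j f differentiable_on V"
  shows "pderiv_at i (pderiv_at j f) y = pderiv_at j (pderiv_at i f) y"
proof -
  have at: "g differentiable (at z)" if "g differentiable_on V" "z \<in> V" for g :: "real^'k \<Rightarrow> real" and z
    using that differentiable_on_eq_differentiable_at[OF V(1), of g] by blast
  let ?D = "\<lambda>g. frechet_derivative g (at y)"
  have *: "(pderiv_at l f has_derivative ?D (pderiv_at l f)) (at y)" if "pderiv_at l f differentiable_on V" for l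
    using at[OF that V(2)] by (simp add: frechet_derivative_works)
  let ?q = "\<lambda>u v h. (f (y + h *\<^sub>R u + h *\<^sub>R v) - f (y + h *\<^sub>R u) - f (y + h *\<^sub>R v) + f y) / h^2"
  let ?u = "axis i 1 :: real^'k" and ?v = "axis j 1 :: real^'k"
  have 1: "(?q ?u ?v \<longlongrightarrow> ?D (pderiv_at i f) ?v) (at_right 0)"
    using second_difference_tendsto[OF V at[OF f(1)] *[OF f(2), unfolded pderiv_at_def], of ?v]
    by (simp add: pderiv_at_def)
  have 2: "(?q ?v ?u \<longlongrightarrow> ?D (pderiv_at j f) ?u) (at_right 0)"
    using second_difference_tendsto[OF V at[OF f(1)] *[OF f(3), unfolded pderiv_at_def], of ?u]
    by (simp add: pderiv_at_def)
  have "?q ?v ?u = ?q ?u ?v" by (simp add: fun_eq_iff algebra_simps)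
  then have "?D (pderiv_at i f) ?v = ?D (pderiv_at j f) ?u"
    using tendsto_unique[OF _ 1, of "?D (pderiv_at j f) ?u"] 2 by simp
  then show ?thesis by (simp add: pderiv_at_def)
qed

lemma pderivs_simps: "pderivs [] f = f" "pderivs (i # is) f = pderiv_at i (pderivs is f)"
  by (simp_all add: pderivs_def)

lemma pderivs_append: "pderivs (is @ js) f = pderivs is (pderivs js f)"
  by (simp add: pderivs_def)

lemma pderiv_at_cong:
  assumes "open V" "y \<in> V" "\<And>z. z \<in> V \<Longrightarrow> f z = g z" "f differentiable_on V"
  shows "pderiv_at i f y = pderiv_at i g y"
proof -
  have "f differentiable (at y)"
    using assms(2,4) differentiable_on_eq_differentiable_at[OF assms(1), of f] by blast
  then show ?thesis
    unfolding pderiv_at_def using assms frechet_derivative_transform_within_open[of f y V g] by simp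
qed

theorem pderivs_perm:
  fixes f :: "real^'k::finite \<Rightarrow> real"
  assumes V: "open V" and f: "smooth_fun_on V f" and "mset is = mset js" "y \<in> V"
  shows "pderivs is f y = pderivs js f y"
proof -
  have diff: "pderivs is f differentiable_on V" for "is" using f by (simp add: smooth_fun_on_def)
  have front: "pderivs (ks @ i # ls) f z = pderivs (i # ks @ ls) f z" if "z \<in> V" for ks i ls z
    using that
  proof (induction ks arbitrary: z)
    case (Cons k ks)
    have "pderivs ((k # ks) @ i # ls) f z = pderiv_at k (pderivs (i # ks @ ls) f) z"
      using pderiv_at_cong[OF V Cons.prems Cons.IH diff] by (simp add: pderivs_simps)
    also have "\<dots> = pderiv_at i (pderiv_at k (pderivs (ks @ ls) f)) z"
      using pderiv_at_commute[OF V Cons.prems, of "pderivs (ks @ ls) f" k i]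
        diff[of "ks @ ls"] diff[of "k # ks @ ls"] diff[of "i # ks @ ls"] by (simp add: pderivs_simps)
    finally show ?case by (simp add: pderivs_simps)
  qed simp
  show ?thesis using assms(3,4)
  proof (induction "is" arbitrary: js y)
    case (Cons i "is")
    have "i \<in> set js" using Cons.prems(1) by (metis list.set_intros(1) set_mset_mset)
    then obtain ks ls where js: "js = ks @ i # ls" by (meson split_list)
    have "mset is = mset (ks @ ls)" using Cons.prems(1) js by simp
    then have "pderiv_at i (pderivs is f) y = pderiv_at i (pderivs (ks @ ls) f) y"
      by (intro pderiv_at_cong[OF V Cons.prems(2) _ diff] Cons.IH)
    then show ?case using front[OF Cons.prems(2)] js by (simp add: pderivs_simps)
  qed simp
qed

section \<open>Acyclicity and bridges\<close>

fun path_edges :: "int list \<Rightarrow> (int \<times> int) list" where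
  "path_edges (x # y # zs) = edge x y # path_edges (y # zs)"
| "path_edges _ = []"

lemma cycle_edges:
  assumes "p \<noteq> []"
  shows "map (\<lambda>(u, v). (max u v, min u v)) (zip p (rotate1 p)) = path_edges p @ [edge (last p) (hd p)]"
proof -
  have *: "map (\<lambda>(u, v). (max u v, min u v)) (zip p (tl p @ [h])) = path_edges p @ [edge (last p) h]"
    if "p \<noteq> []" for h and p :: "int list"
    using that by (induction p rule: path_edges.induct) (auto simp: edge_def)
  show ?thesis using *[OF assms, of "hd p"] assms by (cases p) auto
qed

lemma path_edges_vertices: "e \<in> set (path_edges p) \<Longrightarrow> fst e \<in> set p \<and> snd e \<in> set p"
  by (induction p rule: path_edges.induct) (auto simp: edge_def max_def min_def split: if_splits)

lemma distinct_path_edges: "distinct p \<Longrightarrow> distinct (path_edges p)"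
proof (induction p rule: path_edges.induct)
  case (1 x y zs)
  have "x = fst (edge x y) \<or> x = snd (edge x y)" by (auto simp: edge_def)
  then have "edge x y \<notin> set (path_edges (y # zs))"
    using path_edges_vertices[of "edge x y" "y # zs"] 1(2) by auto
  then show ?case using 1 by simp
qed auto

lemma path_edges_rtrancl: "p \<noteq> [] \<Longrightarrow> set (path_edges p) \<subseteq> F \<Longrightarrow> (hd p, last p) \<in> (adj F)\<^sup>*"
proof (induction p rule: path_edges.induct)
  case (1 x y zs)
  have "edge x y \<in> F" using 1(3) by simp
  then have "(x, y) \<in> adj F" by (auto simp: adj_def edge_def max_def min_def split: if_splits)
  moreover have "(y, last (y # zs)) \<in> (adj F)\<^sup>*" using 1 by simp
  ultimately show ?case by (simp add: converse_rtrancl_into_rtrancl)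
qed auto

lemma rtrancl_simple_path:
  assumes "(u, v) \<in> (adj F)\<^sup>*" "F \<subseteq> edges_on V"
  obtains p where "distinct p" "p \<noteq> []" "hd p = u" "last p = v" "set (path_edges p) \<subseteq> F"
proof -
  have suffix: "set (path_edges q) \<subseteq> set (path_edges (xs @ q))" for xs q
  proof (induction xs)
    case (Cons x xs)
    then show ?case by (cases "xs @ q") auto
  qed simp
  have "\<exists>p. distinct p \<and> p \<noteq> [] \<and> hd p = u \<and> last p = v \<and> set (path_edges p) \<subseteq> F"
    using assms(1)
  proof (induction rule: converse_rtrancl_induct)
    case base
    then show ?case by (intro exI[of _ "[v]"]) simp
  next
    case (step x y)
    then obtain p where p: "distinct p" "p \<noteq> []" "hd p = y" "last p = v" "set (path_edges p) \<subseteq> F" by blast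
    show ?case
    proof (cases "x \<in> set p")
      case True
      then obtain xs ys where "p = xs @ x # ys" by (meson split_list)
      then show ?thesis using p suffix[of "x # ys" xs] by (intro exI[of _ "x # ys"]) auto
    next
      case False
      have "edge x y \<in> F"
        using step(1) assms(2) by (auto simp: adj_def edge_def edges_on_def)
      then show ?thesis using p False by (cases p) (auto intro!: exI[of _ "x # p"])
    qed
  qed
  then show thesis using that by blast
qed

lemma mset_subset_mset_set:
  assumes "mset xs \<subseteq># mset_set A" 
  shows "distinct xs" "set xs \<subseteq> A"
proof -
  have "count (mset xs) x \<le> count (mset_set A) x" for x using assms by (simp add: mset_subset_eq_count)
  then have "count (mset xs) x \<le> 1" for x
    by (metis count_mset_set' order_trans le_refl zero_le_one)
  then have "count (mset xs) x = (if x \<in> set xs then 1 else 0)" for x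
    using count_greater_eq_one_iff[of "mset xs" x] by (auto intro: le_antisym simp: not_in_iff)
  then show "distinct xs" by (simp add: distinct_count_atmost_1)
  show "set xs \<subseteq> A" using set_mset_mono[OF assms] by (cases "finite A") auto
qed

lemma std_blacks_whites: "std (nblack t) (nwhite t) = blacks t \<union> whites t"
  by (simp add: std_def blacks_def whites_def)

lemma coloured_vertices: "coloured True (std (nblack t) (nwhite t)) = blacks t"
    "coloured False (std (nblack t) (nwhite t)) = whites t"
  by (simp_all add: coloured_std blacks_def whites_def)

lemma edges_on_vertices: "edges_on (std (nblack t) (nwhite t)) = blacks t \<times> whites t"
  by (auto simp: edges_on_def std_def blacks_def whites_def)

text \<open>A double edge, or an edge whose ends remain connected without it, closes a cycle; conversely
  the rest of a cycle connects the ends of each of its edges.\<close>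

theorem bitree_iff:
  "bitree t \<longleftrightarrow> (\<exists>E. bedges t = mset_set E \<and> tree (std (nblack t) (nwhite t)) E)"
proof
  let ?V = "std (nblack t) (nwhite t)"
  assume t: "bitree t"
  let ?E = "set_mset (bedges t)"
  have sub: "?E \<subseteq> edges_on ?V" using t by (simp add: bitree_def wf_bigraph_def edges_on_vertices)
  have no_cycle: "\<not> is_cycle t vs" for vs using t by (simp add: bitree_def)
  have simple: "count (bedges t) e = 1" if "e \<in> ?E" for e
  proof (rule ccontr)
    assume n: "count (bedges t) e \<noteq> 1"
    have "count (bedges t) e \<noteq> 0" using that by simp
    then have ge: "2 \<le> count (bedges t) e" using n by linarith
    obtain b w where e: "e = (b, w)" by force
    then have bw: "0 < b" "\<not> 0 < w" using sub that by (auto simp: edges_on_def)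
    have "{#(b, w), (b, w)#} \<subseteq># bedges t" using ge e by (auto simp: subseteq_mset_def numeral_2_eq_2)
    then have "is_cycle t [b, w]" using bw by (auto simp: is_cycle_def max_def min_def)
    then show False using no_cycle by blast
  qed
  have "bedges t = mset_set ?E"
    by (rule multiset_eqI) (use simple in \<open>auto simp: count_mset_set' not_in_iff\<close>)
  moreover have "tree ?V ?E" unfolding tree_def
  proof (intro conjI allI impI)
    show "finite ?V" by simp
    show "?V \<noteq> {}" using t by (simp add: bitree_def std_blacks_whites)
    show "?E \<subseteq> edges_on ?V" by (rule sub)
    show "\<forall>u\<in>?V. \<forall>v\<in>?V. (u, v) \<in> (adj ?E)\<^sup>*"
      using t by (simp add: bitree_def connected_bigraph_def adjacency_def adj_def std_blacks_whites)
    fix u v assume uv: "(u, v) \<in> ?E"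
    show "(u, v) \<notin> (adj (?E - {(u, v)}))\<^sup>*"
    proof
      let ?F = "?E - {(u, v)}"
      assume "(u, v) \<in> (adj ?F)\<^sup>*"
      then obtain p where p: "distinct p" "p \<noteq> []" "hd p = u" "last p = v" "set (path_edges p) \<subseteq> ?F"
        by (rule rtrancl_simple_path[where V = ?V]) (use sub in auto)
      have bw: "0 < u" "\<not> 0 < v" using uv sub by (auto simp: edges_on_def)
      have cl: "edge (last p) (hd p) = (u, v)" using bw p(3,4) by (simp add: edge_def)
      have "2 \<le> length p" using p(2-4) bw by (cases p; cases "tl p") auto
      moreover have "distinct (path_edges p @ [(u, v)])" using distinct_path_edges[OF p(1)] p(5) by auto
      then have "mset (path_edges p @ [(u, v)]) = mset_set (set (path_edges p @ [(u, v)]))"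
        by (simp only: mset_set_set)
      then have "mset (path_edges p @ [(u, v)]) \<subseteq># mset_set ?E"
        using p(5) uv by (simp only:) (rule subset_imp_msubset_mset_set, auto)
      ultimately have "is_cycle t p"
        using p(1,2) \<open>bedges t = mset_set ?E\<close> by (simp only: is_cycle_def cycle_edges cl simp_thms)
      then show False using no_cycle by blast
    qed
  qed
  ultimately show "\<exists>E. bedges t = mset_set E \<and> tree ?V E" by blast
next
  let ?V = "std (nblack t) (nwhite t)"
  assume "\<exists>E. bedges t = mset_set E \<and> tree ?V E"
  then obtain E where E: "bedges t = mset_set E" and T: "tree ?V E" by blast
  have finE: "finite E" by (rule tree_finite_edges[OF T])
  have "\<not> is_cycle t vs" for vs
  proof
    assume c: "is_cycle t vs"
    then have ne: "vs \<noteq> []" and len: "2 \<le> length vs" by (auto simp: is_cycle_def)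
    let ?e = "edge (last vs) (hd vs)"
    have "mset (path_edges vs @ [?e]) \<subseteq># mset_set E"
      using c E unfolding is_cycle_def cycle_edges[OF ne] by simp
    note m = mset_subset_mset_set[OF this]
    have "set (path_edges vs) \<subseteq> E - {?e}" using m by auto
    then have "(hd vs, last vs) \<in> (adj (E - {?e}))\<^sup>*" by (rule path_edges_rtrancl[OF ne])
    moreover have "?e \<in> E" using m(2) by simp
    moreover have "?e = (last vs, hd vs) \<or> ?e = (hd vs, last vs)" by (auto simp: edge_def)
    ultimately show False using T adj_rtrancl_sym unfolding tree_def by metis
  qed
  moreover have "connected_bigraph t"
    using T E finE by (simp add: tree_def connected_bigraph_def adjacency_def adj_def std_blacks_whites)
  moreover have "E \<subseteq> blacks t \<times> whites t"
    using T unfolding tree_def edges_on_vertices by blast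
  moreover have "blacks t \<union> whites t \<noteq> {}"
    using T unfolding tree_def std_blacks_whites by blast
  ultimately show "bitree t"
    using E finE by (simp add: bitree_def wf_bigraph_def)
qed


section \<open>Trees with white leaves\<close>

lemma vdegree_card: "bedges t = mset_set E \<Longrightarrow> finite E \<Longrightarrow> vdegree t v = card (inc E v)"
  by (simp add: vdegree_def incident_def inc_def filter_mset_mset_set)

text \<open>The isolated black vertex is the only element of \<open>Tcirc\<close> with a black vertex of degree below
  two. It contributes \<open>S\<^sub>0\<close> and is kept apart, since the black tensors of the enumeration vanish on
  fewer than two indices.\<close>

definition bullet :: bigraph where
  "bullet = Bigraph 1 0 {#}"

definition pruned :: "int set \<Rightarrow> (int \<times> int) set set" where
  "pruned V = {E \<in> trees V. \<forall>b\<in>coloured True V. 2 \<le> card (inc E b)}"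

lemma Tcirc_iff:
  "t \<in> Tcirc \<longleftrightarrow> t = bullet \<or> (\<exists>n m E. t = Bigraph n m (mset_set E) \<and> E \<in> pruned (std n m))"
proof
  assume t: "t \<in> Tcirc"
  let ?V = "std (nblack t) (nwhite t)"
  obtain E where E: "bedges t = mset_set E" "tree ?V E"
    using t by (auto simp: Tcirc_def bitree_iff)
  have finE: "finite E" by (rule tree_finite_edges[OF E(2)])
  show "t = bullet \<or> (\<exists>n m E. t = Bigraph n m (mset_set E) \<and> E \<in> pruned (std n m))"
  proof (cases "\<exists>b\<in>blacks t. card (inc E b) = 0")
    case True
    then obtain b where b: "b \<in> blacks t" "card (inc E b) = 0" by blast
    have V: "?V = {b}" by (rule tree_root_degree_0[OF E(2)]) (use b in \<open>auto simp: std_blacks_whites\<close>)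
    then have "blacks t = {b}" "whites t = {}"
      using b(1) coloured_vertices[of t] by (auto simp: coloured_def)
    then have "nblack t = 1" "nwhite t = 0"
      using card_coloured_std[of "nblack t" "nwhite t"] by (simp_all add: coloured_vertices)
    moreover have "E = {}" using E(2) trees_singleton[of b] V by (auto simp: trees_def)
    ultimately have "t = bullet" using E(1) by (cases t) (simp add: bullet_def)
    then show ?thesis by simp
  next
    case False
    have "2 \<le> card (inc E b)" if b: "b \<in> blacks t" for b
    proof -
      have "b \<notin> whites t" using b by (auto simp: blacks_def whites_def)
      then have "vdegree t b \<noteq> 1" using t b by (auto simp: Tcirc_def)
      then have "card (inc E b) \<noteq> 1" by (simp only: vdegree_card[OF E(1) finE] not_False_eq_True)
      moreover have "card (inc E b) \<noteq> 0" using False b by auto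
      ultimately show ?thesis by linarith
    qed
    then have "E \<in> pruned ?V" using E(2) by (simp add: pruned_def trees_def coloured_vertices)
    moreover have "t = Bigraph (nblack t) (nwhite t) (mset_set E)" using E(1) by (cases t) simp
    ultimately show ?thesis by blast
  qed
next
  assume "t = bullet \<or> (\<exists>n m E. t = Bigraph n m (mset_set E) \<and> E \<in> pruned (std n m))"
  then show "t \<in> Tcirc"
  proof
    assume t: "t = bullet"
    have "std 1 0 = {1}" by (auto simp: std_def)
    then have "tree (std 1 0) {}" by (simp add: tree_no_edges)
    then have "bitree t" by (auto simp: bitree_iff t bullet_def intro!: exI[of _ "{}"])
    moreover have "vdegree t v = 0" for v by (simp add: t bullet_def vdegree_def incident_def)
    ultimately show ?thesis by (simp add: Tcirc_def)
  next
    assume "\<exists>n m E. t = Bigraph n m (mset_set E) \<and> E \<in> pruned (std n m)"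
    then obtain n m E where t: "t = Bigraph n m (mset_set E)" and E: "E \<in> pruned (std n m)" by blast
    have T: "tree (std n m) E" using E by (simp add: pruned_def trees_def)
    then have "bitree t" by (auto simp: bitree_iff t)
    moreover have "v \<in> whites t" if v: "v \<in> blacks t \<union> whites t" "vdegree t v = 1" for v
    proof (rule ccontr)
      assume "v \<notin> whites t"
      then have "v \<in> coloured True (std n m)" using v(1) coloured_vertices(1)[of t] by (simp add: t)
      then have "2 \<le> card (inc E v)" using E by (simp add: pruned_def)
      then show False using v(2) vdegree_card[of t E v] tree_finite_edges[OF T] by (simp add: t)
    qed
    ultimately show ?thesis unfolding Tcirc_def by blast
  qed
qed


section \<open>The series of a symmetric system of tensors\<close>

text \<open>An ordering of a multiset of indices, through which symmetric tensors become functions of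
  multisets.\<close>

definition word :: "'k multiset \<Rightarrow> 'k list" where
  "word \<mu> = (SOME is. mset is = \<mu>)"

lemma mset_word [simp]: "mset (word \<mu>) = \<mu>"
  unfolding word_def by (rule someI_ex) (rule ex_mset)

definition vertex_tensor :: "('k::finite list \<Rightarrow> real^'n::finite \<Rightarrow> real) \<Rightarrow> (real^'k \<Rightarrow> real^'k) \<Rightarrow> real^'n \<Rightarrow>
    bool \<Rightarrow> 'k multiset \<Rightarrow> 'k mps" where
  "vertex_tensor S y' x c \<mu> =
     (if c then mps_const (if 2 \<le> size \<mu> then fact (size \<mu>) * S (word \<mu>) x else 0)
      else \<Sum>a\<in>UNIV. mps_const (pderivs (word \<mu>) (\<lambda>y. y' y $ a) (base_map S x)) * mps_var a)"

lemma admissible_vertex_tensor: "admissible (vertex_tensor S y' x)"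
  unfolding admissible_def
proof (intro conjI allI impI)
  fix \<mu> \<nu>
  show "\<nu> = {#}" "2 \<le> size \<mu>" if "mps_coeff (vertex_tensor S y' x True \<mu>) \<nu> \<noteq> 0"
    using that by (auto simp: vertex_tensor_def coeff_const split: if_splits)
  assume "mps_coeff (vertex_tensor S y' x False \<mu>) \<nu> \<noteq> 0"
  then have "mps_coeff (\<Sum>a\<in>UNIV. mps_const (pderivs (word \<mu>) (\<lambda>y. y' y $ a) (base_map S x)) * mps_var a) \<nu> \<noteq> 0"
    by (simp add: vertex_tensor_def)
  then obtain a where "mps_coeff (mps_const (pderivs (word \<mu>) (\<lambda>y. y' y $ a) (base_map S x)) * mps_var a) \<nu> \<noteq> 0"
    by (rule coeff_sum_nonzero)
  then show "size \<nu> = 1" by (auto simp: coeff_var split: if_splits)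
qed

definition symmetric_data :: "('k::finite list \<Rightarrow> real^'n::finite \<Rightarrow> real) \<Rightarrow> (real^'k \<Rightarrow> real^'k) \<Rightarrow> real^'n \<Rightarrow> bool" where
  "symmetric_data S y' x \<longleftrightarrow> (\<forall>is js. mset is = mset js \<longrightarrow> S is x = S js x \<and>
     (\<forall>a. pderivs is (\<lambda>y. y' y $ a) (base_map S x) = pderivs js (\<lambda>y. y' y $ a) (base_map S x)))"

text \<open>Symmetry makes the chosen order of the edges at a vertex irrelevant, and the labels of the
  white vertices are summed independently of each other.\<close>

theorem tree_term_eq_wt:
  assumes sym: "symmetric_data S y' x" and E: "E \<in> pruned (std n m)"
  shows "tree_term S y' (Bigraph n m (mset_set E)) x = wt (vertex_tensor S y' x) (std n m) E (\<lambda>_. {#})"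
proof -
  let ?t = "Bigraph n m (mset_set E)"
  let ?B = "blacks ?t" and ?W = "whites ?t"
  have T: "tree (std n m) E" using E by (simp add: pruned_def trees_def)
  have finE: "finite E" by (rule tree_finite_edges[OF T])
  let ?I = "\<lambda>e v. image_mset e (mset_set (inc E v))"
  have "incident ?t v = mset_set (inc E v)" for v
    using finE by (simp add: incident_def inc_def filter_mset_mset_set)
  then have "mset (edge_list ?t v) = mset_set (inc E v)" for v
    unfolding edge_list_def using someI_ex[OF ex_mset[of "incident ?t v"]] by simp
  then have mset_e: "mset (map e (edge_list ?t v)) = mset (word (?I e v))" for e :: "int \<times> int \<Rightarrow> 'a" and v
    by simp
  let ?p = "\<lambda>e w a. pderivs (word (?I e w)) (\<lambda>y. y' y $ a) (base_map S x)"
  have S_word: "S (map e (edge_list ?t v)) x = S (word (?I e v)) x" for e v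
    using sym mset_e unfolding symmetric_data_def by blast
  have p_word: "pderivs (map e (edge_list ?t w)) (\<lambda>y. y' y $ a) (base_map S x) = ?p e w a" for e w a
    using sym mset_e unfolding symmetric_data_def by blast
  have deg: "vdegree ?t v = card (inc E v)" for v by (rule vdegree_card) (use finE in auto)
  let ?b = "\<lambda>e. \<Prod>v\<in>?B. fact (card (inc E v)) * S (word (?I e v)) x"
  have fin: "finite ?B" "finite ?W" by (simp_all add: blacks_def whites_def)
  have "tree_term S y' ?t x =
    (\<Sum>a\<in>?W \<rightarrow>\<^sub>E UNIV. \<Sum>e\<in>E \<rightarrow>\<^sub>E UNIV. mps_const (?b e) * (\<Prod>w\<in>?W. mps_const (?p e w (a w)) * mps_var (a w)))"
    unfolding tree_term_def tree_bracket_def S_word p_word deg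
    by (simp add: finE mps_const_sum mps_const_mult mps_const_prod prod.distrib sum_distrib_right mult.assoc)
  also have "\<dots> = (\<Sum>e\<in>E \<rightarrow>\<^sub>E UNIV. mps_const (?b e) * (\<Sum>a\<in>?W \<rightarrow>\<^sub>E UNIV. \<Prod>w\<in>?W. mps_const (?p e w (a w)) * mps_var (a w)))"
    unfolding sum_distrib_left by (rule sum.swap)
  also have "\<dots> = (\<Sum>e\<in>E \<rightarrow>\<^sub>E UNIV. mps_const (?b e) * (\<Prod>w\<in>?W. \<Sum>a\<in>UNIV. mps_const (?p e w a) * mps_var a))"
    by (subst prod_sum_PiE) (use fin in auto)
  also have "\<dots> = wt (vertex_tensor S y' x) (std n m) E (\<lambda>_. {#})"
    unfolding wt_def
  proof (rule sum.cong[OF refl])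
    fix e
    let ?h = "\<lambda>v. vertex_tensor S y' x (0 < v) ({#} + ?I e v)"
    have "std n m = ?B \<union> ?W" using std_blacks_whites[of ?t] by simp
    moreover have "?B \<inter> ?W = {}" by (auto simp: blacks_def whites_def)
    ultimately have "prod ?h (std n m) = prod ?h ?B * prod ?h ?W"
      using fin by (simp only: prod.union_disjoint)
    moreover have "prod ?h ?B = mps_const (?b e)"
      unfolding mps_const_prod
    proof (rule prod.cong[OF refl])
      fix v assume v: "v \<in> ?B"
      then have "0 < v" by (simp add: blacks_def)
      moreover have "2 \<le> card (inc E v)"
        using E v coloured_vertices(1)[of ?t] by (simp add: pruned_def)
      ultimately show "?h v = mps_const (fact (card (inc E v)) * S (word (?I e v)) x)"
        by (simp add: vertex_tensor_def)
    qed
    moreover have "prod ?h ?W = (\<Prod>w\<in>?W. \<Sum>a\<in>UNIV. mps_const (?p e w a) * mps_var a)"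
      by (rule prod.cong[OF refl]) (auto simp: vertex_tensor_def whites_def)
    ultimately show "mps_const (?b e) * (\<Prod>w\<in>?W. \<Sum>a\<in>UNIV. mps_const (?p e w a) * mps_var a) = prod ?h (std n m)"
      by simp
  qed
  finally show ?thesis .
qed

lemma tree_term_bullet:
  "tree_term S y' bullet x = mps_const (S [] x)"
proof -
  have "edge_list bullet v = []" for v
    by (simp add: edge_list_def incident_def bullet_def)
  then show ?thesis
    by (simp add: tree_term_def tree_bracket_def bullet_def blacks_def whites_def vdegree_def incident_def)
qed

lemma formal_has_sum_insert:
  assumes "formal_has_sum f A s" "x \<notin> A"
  shows "formal_has_sum f (insert x A) (f x + s)"
proof -
  let ?g = "\<lambda>t. if t = x then f x else 0" and ?h = "\<lambda>t. if t \<in> A then f t else 0"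
  have "formal_has_sum ?g {x} (f x)" using formal_has_sum_finite[of "{x}" ?g] by simp
  then have g: "formal_has_sum ?g (insert x A) (f x)"
    using formal_has_sum_neutral[of "{x}" "insert x A" ?g] by auto
  have "formal_has_sum ?h A s" by (rule formal_has_sum_cong[OF _ assms(1)]) simp
  then have h: "formal_has_sum ?h (insert x A) s"
    using formal_has_sum_neutral[of A "insert x A" ?h] assms(2) by auto
  show ?thesis
    by (rule formal_has_sum_cong[OF _ formal_has_sum_add[OF g h]]) (use assms(2) in auto)
qed

definition labelled_term :: "('k::finite list \<Rightarrow> real^'n::finite \<Rightarrow> real) \<Rightarrow> (real^'k \<Rightarrow> real^'k) \<Rightarrow> real^'n \<Rightarrow> bigraph \<Rightarrow> 'k mps" where
  "labelled_term S y' x t = mps_const (1 / (fact (nwhite t) * fact (nblack t))) * tree_term S y' t x"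

text \<open>Trees with a black vertex of degree below two have weight zero, so the sum over all trees is
  the sum over \<open>Tcirc\<close> without the isolated black vertex.\<close>

theorem sum_Tcirc:
  assumes sym: "symmetric_data S y' x"
  shows "formal_has_sum (labelled_term S y' x) Tcirc (mps_const (S [] x) + egf (unrooted (vertex_tensor S y' x)))"
proof -
  let ?\<tau> = "vertex_tensor S y' x"
  note ad = admissible_vertex_tensor[of S y' x]
  let ?f = "\<lambda>(p, E). mps_const (1 / (fact (fst p) * fact (snd p))) * wt ?\<tau> (std (fst p) (snd p)) E (\<lambda>_. {#})"
  let ?A = "Sigma UNIV (\<lambda>p. trees (std (fst p) (snd p)))"
  let ?D = "Sigma UNIV (\<lambda>p. pruned (std (fst p) (snd p)))"
  have nz: "snd p = size \<mu> \<and> fst p < size \<mu> \<and> E \<in> pruned (std (fst p) (snd p))"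
    if "(p, E) \<in> ?A" "mps_coeff (?f (p, E)) \<mu> \<noteq> 0" for p E \<mu>
  proof -
    have T: "tree (std (fst p) (snd p)) E" using that(1) by (simp add: trees_def)
    have "mps_coeff (wt ?\<tau> (std (fst p) (snd p)) E (\<lambda>_. {#})) \<mu> \<noteq> 0" using that(2) by auto
    note w = wt_nonzero[OF ad T this]
    show ?thesis using w(1,2,3) T by (auto simp: pruned_def trees_def)
  qed
  have "formally_summable ?f ?A"
    unfolding formally_summable_def
  proof
    fix \<mu>
    have "{t \<in> ?A. mps_coeff (?f t) \<mu> \<noteq> 0} \<subseteq> Sigma ({..<size \<mu>} \<times> {size \<mu>}) (\<lambda>p. trees (std (fst p) (snd p)))"
    proof
      fix t assume t: "t \<in> {t \<in> ?A. mps_coeff (?f t) \<mu> \<noteq> 0}"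
      obtain p E where pE: "t = (p, E)" by (cases t) blast
      then have "snd p = size \<mu>" "fst p < size \<mu>" using t nz[of p E \<mu>] by auto
      then show "t \<in> Sigma ({..<size \<mu>} \<times> {size \<mu>}) (\<lambda>p. trees (std (fst p) (snd p)))"
        using t pE by (cases p) auto
    qed
    then show "finite {t \<in> ?A. mps_coeff (?f t) \<mu> \<noteq> 0}"
      by (rule finite_subset) (auto simp: finite_trees)
  qed
  then obtain s where s: "formal_has_sum ?f ?A s" using formal_has_sum_summable by blast
  have "formal_has_sum (egf_term (unrooted ?\<tau>)) UNIV s"
  proof (rule formal_has_sum_Sigma[OF s])
    fix p :: "nat \<times> nat"
    have "egf_term (unrooted ?\<tau>) p = (\<Sum>E\<in>trees (std (fst p) (snd p)). ?f (p, E))"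
      by (simp add: egf_term_def unrooted_def sum_distrib_left)
    then show "formal_has_sum (\<lambda>E. ?f (p, E)) (trees (std (fst p) (snd p))) (egf_term (unrooted ?\<tau>) p)"
      by (simp only:) (rule formal_has_sum_finite[OF finite_trees])
  qed
  then have s_eq: "egf (unrooted ?\<tau>) = s" by (rule egf_eqI[OF graded_unrooted[OF ad]])
  have "formal_has_sum ?f ?D s"
  proof (rule formal_has_sum_neutral[THEN iffD1, OF _ _ s])
    show "?D \<subseteq> ?A" by (auto simp: pruned_def)
    fix t assume t: "t \<in> ?A - ?D"
    show "?f t = 0"
    proof (rule mps_eqI, rule ccontr)
      fix \<mu> assume "mps_coeff (?f t) \<mu> \<noteq> mps_coeff 0 \<mu>"
      then show False using nz[of "fst t" "snd t" \<mu>] t by (cases t) auto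
    qed
  qed
  moreover let ?h = "\<lambda>(p, E). Bigraph (fst p) (snd p) (mset_set E)"
  have fE: "finite E" if "E \<in> pruned V" for E V
    using that tree_finite_edges by (auto simp: pruned_def trees_def)
  have "bij_betw ?h ?D (Tcirc - {bullet})"
  proof (rule bij_betw_imageI)
    show "inj_on ?h ?D"
    proof (rule inj_onI)
      fix s t assume st: "s \<in> ?D" "t \<in> ?D" "?h s = ?h t"
      then have "finite (snd s)" "finite (snd t)" using fE by auto
      then have "snd s = snd t" using st(3) by (cases s; cases t) (auto dest: mset_set_eq_iff[THEN iffD1, rotated 2])
      then show "s = t" using st(3) by (cases s; cases t) (auto intro: prod_eqI)
    qed
    have "?h t \<noteq> bullet" if "t \<in> ?D" for t
    proof
      assume b: "?h t = bullet"
      obtain n m E where t: "t = ((n, m), E)" by (cases t) auto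
      then have nm: "n = 1" "m = 0" "mset_set E = {#}" using b by (simp_all add: bullet_def)
      then have "E = {}" using fE[of E] that t by (auto simp: mset_set_empty_iff)
      moreover have "1 \<in> coloured True (std n m)" using nm by (simp add: coloured_std)
      ultimately show False using that t by (auto simp: pruned_def inc_def)
    qed
    then show "?h ` ?D = Tcirc - {bullet}"
      by (force simp: Tcirc_iff image_iff)
  qed
  moreover have "labelled_term S y' x (?h t) = ?f t" if "t \<in> ?D" for t
  proof (cases t)
    case (Pair p E)
    then have "E \<in> pruned (std (fst p) (snd p))" using that by auto
    then show ?thesis using Pair by (simp add: labelled_term_def tree_term_eq_wt[OF sym] mult.commute)
  qed
  ultimately have "formal_has_sum (labelled_term S y' x) (Tcirc - {bullet}) s"
    using formal_has_sum_cong[of ?D ?f "\<lambda>t. labelled_term S y' x (?h t)" s]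
    by (subst formal_has_sum_reindex[where h = ?h and A = ?D]) auto
  then have "formal_has_sum (labelled_term S y' x) (insert bullet (Tcirc - {bullet})) (labelled_term S y' x bullet + s)"
    by (rule formal_has_sum_insert) simp
  moreover have "insert bullet (Tcirc - {bullet}) = Tcirc" using Tcirc_iff by auto
  moreover have "labelled_term S y' x bullet = mps_const (S [] x)"
    unfolding labelled_term_def tree_term_bullet by (simp add: bullet_def)
  ultimately show ?thesis by (simp only: s_eq)
qed

section \<open>Isomorphism classes\<close>

definition vertex_perms :: "bigraph \<Rightarrow> ((int \<Rightarrow> int) \<times> (int \<Rightarrow> int)) set" where
  "vertex_perms t = {\<sigma>. \<sigma> permutes blacks t} \<times> {\<pi>. \<pi> permutes whites t}"

definition act :: "(int \<Rightarrow> int) \<times> (int \<Rightarrow> int) \<Rightarrow> bigraph \<Rightarrow> bigraph" where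
  "act p t = Bigraph (nblack t) (nwhite t) (image_mset (map_prod (fst p) (snd p)) (bedges t))"

lemma isos_eq: "bigraph_isos s t = {p \<in> vertex_perms s. act p s = t}"
  by (cases t) (auto simp: bigraph_isos_def vertex_perms_def act_def)

lemma vertices_act [simp]: "blacks (act p t) = blacks t" "whites (act p t) = whites t"
  "vertex_perms (act p t) = vertex_perms t" "nblack (act p t) = nblack t" "nwhite (act p t) = nwhite t"
  by (simp_all add: act_def blacks_def whites_def vertex_perms_def)

lemma act_act: "act p (act q t) = act (fst p \<circ> fst q, snd p \<circ> snd q) t"
  by (simp add: act_def multiset.map_comp map_prod_compose comp_def map_prod_def split_def)

lemma act_id: "act (id, id) t = t"
proof -
  have "map_prod id id = (id :: int \<times> int \<Rightarrow> int \<times> int)" by (simp add: fun_eq_iff)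
  then show ?thesis by (cases t) (simp add: act_def)
qed

lemma vertex_perms_comp:
  "p \<in> vertex_perms t \<Longrightarrow> q \<in> vertex_perms t \<Longrightarrow> (fst p \<circ> fst q, snd p \<circ> snd q) \<in> vertex_perms t"
  by (auto simp: vertex_perms_def permutes_compose)

lemma vertex_perms_inv:
  assumes "p \<in> vertex_perms t"
  shows "(inv (fst p), inv (snd p)) \<in> vertex_perms t"
    "inv (fst p) \<circ> fst p = id" "fst p \<circ> inv (fst p) = id" "inv (snd p) \<circ> snd p = id" "snd p \<circ> inv (snd p) = id"
  using assms by (auto simp: vertex_perms_def permutes_inv permutes_inv_o)

lemma card_vertex_perms: "card (vertex_perms t) = fact (nblack t) * fact (nwhite t)" "finite (vertex_perms t)"
proof -
  have fin: "finite (blacks t)" "finite (whites t)" by (simp_all add: blacks_def whites_def)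
  show "card (vertex_perms t) = fact (nblack t) * fact (nwhite t)"
    unfolding vertex_perms_def card_cartesian_product
      card_permutations[OF refl fin(1)] card_permutations[OF refl fin(2)]
    by (simp add: blacks_def whites_def)
  show "finite (vertex_perms t)"
    unfolding vertex_perms_def using fin by (intro finite_cartesian_product finite_permutations)
qed

lemma act_bullet: "act p bullet = bullet"
  by (simp add: act_def bullet_def)

lemma act_pruned:
  assumes p: "p \<in> vertex_perms (Bigraph n m (mset_set E))" and E: "E \<in> pruned (std n m)"
  obtains f where "relabelling f (std n m)" "f ` std n m = std n m"
    "map_prod f f ` E \<in> pruned (std n m)"
    "act p (Bigraph n m (mset_set E)) = Bigraph n m (mset_set (map_prod f f ` E))"
proof -
  let ?t = "Bigraph n m (mset_set E)" and ?V = "std n m"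
  let ?f = "\<lambda>v. if 0 < v then fst p v else snd p v"
  have T: "tree ?V E" using E by (simp add: pruned_def trees_def)
  have sub: "E \<subseteq> edges_on ?V" using T by (simp add: tree_def)
  have s: "fst p permutes blacks ?t" "snd p permutes whites ?t" using p by (auto simp: vertex_perms_def)
  have V: "?V = blacks ?t \<union> whites ?t" using std_blacks_whites[of ?t] by simp
  have fb: "?f v = fst p v \<and> fst p v \<in> blacks ?t" if "v \<in> blacks ?t" for v
    using permutes_in_image[OF s(1)] that by (simp add: blacks_def)
  have fw: "?f v = snd p v \<and> snd p v \<in> whites ?t" if "v \<in> whites ?t" for v
    using permutes_in_image[OF s(2)] that by (auto simp: whites_def)
  have sgn: "?f v \<in> ?V \<and> (0 < ?f v) = (0 < v)" if "v \<in> ?V" for v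
  proof (cases "v \<in> blacks ?t")
    case True
    then show ?thesis using fb[OF True] V by (auto simp: blacks_def)
  next
    case False
    then have "v \<in> whites ?t" using that V by auto
    then show ?thesis using fw[of v] V by (auto simp: whites_def)
  qed
  have inj: "inj_on ?f ?V"
  proof (rule inj_onI)
    fix u v assume uv: "u \<in> ?V" "v \<in> ?V" "?f u = ?f v"
    then have "(0 < u) = (0 < v)" using sgn by metis
    then show "u = v"
      using uv(3) inj_eq[OF permutes_inj[OF s(1)], of u v] inj_eq[OF permutes_inj[OF s(2)], of u v]
      by (cases "0 < u") simp_all
  qed
  have rel: "relabelling ?f ?V" using inj sgn by (auto simp: relabelling_def)
  have img: "?f ` ?V = ?V"
    by (rule endo_inj_surj[OF finite_std _ inj]) (use sgn in blast)
  let ?E = "map_prod ?f ?f ` E"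
  have "tree ?V ?E" using tree_relabel[OF rel T] by (simp only: img)
  moreover have "2 \<le> card (inc ?E b)" if b: "b \<in> coloured True ?V" for b
  proof -
    have "b \<in> ?f ` ?V" using b unfolding img by (simp add: coloured_def)
    then obtain v where v: "v \<in> ?V" "b = ?f v" by blast
    then have "v \<in> coloured True ?V" using b sgn[OF v(1)] unfolding coloured_def by blast
    then have "2 \<le> card (inc E v)" using E unfolding pruned_def by blast
    then show ?thesis
      unfolding v(2) by (simp only: card_inc_relabel[OF inj tree_edges_subset[OF T] v(1)])
  qed
  ultimately have pr: "?E \<in> pruned ?V" by (simp add: pruned_def trees_def)
  have eq: "map_prod (fst p) (snd p) e = map_prod ?f ?f e" if "e \<in> E" for e
    using sub that by (auto simp: edges_on_def)
  have "image_mset (map_prod (fst p) (snd p)) (mset_set E) = image_mset (map_prod ?f ?f) (mset_set E)"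
    by (rule image_mset_cong) (use eq tree_finite_edges[OF T] in simp)
  also have "\<dots> = mset_set ?E"
    by (rule image_mset_mset_set[OF inj_on_map_prod[OF inj tree_edges_subset[OF T]]])
  finally have "act p ?t = Bigraph n m (mset_set ?E)" by (simp add: act_def)
  then show thesis using that rel img pr by blast
qed

lemma act_Tcirc:
  assumes "t \<in> Tcirc" "p \<in> vertex_perms t"
  shows "act p t \<in> Tcirc"
proof (cases "t = bullet")
  case False
  then obtain n m E where t: "t = Bigraph n m (mset_set E)" "E \<in> pruned (std n m)"
    using assms(1) Tcirc_iff by auto
  show ?thesis
    by (rule act_pruned[OF assms(2)[unfolded t(1)] t(2)]) (auto simp: t(1) Tcirc_iff)
qed (use assms in \<open>simp add: act_bullet\<close>)

lemma tree_term_act: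
  assumes sym: "symmetric_data S y' x" and t: "t \<in> Tcirc" and p: "p \<in> vertex_perms t"
  shows "tree_term S y' (act p t) x = tree_term S y' t x"
proof (cases "t = bullet")
  case False
  then obtain n m E where t: "t = Bigraph n m (mset_set E)" and E: "E \<in> pruned (std n m)"
    using t Tcirc_iff by auto
  obtain f where f: "relabelling f (std n m)" "f ` std n m = std n m"
    "map_prod f f ` E \<in> pruned (std n m)" "act p t = Bigraph n m (mset_set (map_prod f f ` E))"
    using act_pruned[OF p[unfolded t] E] t by metis
  have "E \<subseteq> std n m \<times> std n m" using E tree_edges_subset by (auto simp: pruned_def trees_def)
  then have "wt (vertex_tensor S y' x) (std n m) (map_prod f f ` E) (\<lambda>_. {#}) =
      wt (vertex_tensor S y' x) (std n m) E (\<lambda>_. {#})"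
    using wt_relabel[OF f(1), of E _ "\<lambda>_. {#}"] f(2) by simp
  moreover have "tree_term S y' (act p t) x = wt (vertex_tensor S y' x) (std n m) (map_prod f f ` E) (\<lambda>_. {#})"
    by (simp only: f(4) tree_term_eq_wt[OF sym f(3)])
  moreover have "tree_term S y' t x = wt (vertex_tensor S y' x) (std n m) E (\<lambda>_. {#})"
    by (simp only: t tree_term_eq_wt[OF sym E])
  ultimately show ?thesis by simp
qed (simp add: act_bullet)

lemma Tcirc_iso_iff: "(s, t) \<in> Tcirc_iso \<longleftrightarrow> s \<in> Tcirc \<and> (\<exists>p\<in>vertex_perms s. t = act p s)"
  unfolding Tcirc_iso_def isos_eq using act_Tcirc by auto

lemma equiv_Tcirc_iso: "equiv Tcirc Tcirc_iso"
proof (rule equivI)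
  show "Tcirc_iso \<subseteq> Tcirc \<times> Tcirc" by (auto simp: Tcirc_iso_def)
  have "(id, id) \<in> vertex_perms t" for t by (simp add: vertex_perms_def permutes_id)
  then show "refl_on Tcirc Tcirc_iso"
    using act_id by (auto simp: refl_on_def Tcirc_iso_iff intro!: bexI[of _ "(id, id)"])
  show "sym Tcirc_iso"
  proof (rule symI)
    fix s t assume "(s, t) \<in> Tcirc_iso"
    then obtain p where p: "s \<in> Tcirc" "p \<in> vertex_perms s" "t = act p s" by (auto simp: Tcirc_iso_iff)
    note i = vertex_perms_inv[OF p(2)]
    have "act (inv (fst p), inv (snd p)) t = s" by (simp add: p(3) act_act i act_id)
    then show "(t, s) \<in> Tcirc_iso" using act_Tcirc[OF p(1,2)] i(1) p(3) by (force simp: Tcirc_iso_iff)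
  qed
  show "trans Tcirc_iso"
  proof (rule transI)
    fix s t u assume "(s, t) \<in> Tcirc_iso" "(t, u) \<in> Tcirc_iso"
    then obtain p q where p: "s \<in> Tcirc" "p \<in> vertex_perms s" "t = act p s"
      and q: "q \<in> vertex_perms t" "u = act q t" by (auto simp: Tcirc_iso_iff)
    then have "(fst q \<circ> fst p, snd q \<circ> snd p) \<in> vertex_perms s" using vertex_perms_comp[of q s p] by simp
    then show "(s, u) \<in> Tcirc_iso" using p q by (auto simp: Tcirc_iso_iff act_act)
  qed
qed

text \<open>Renumbering the vertices in all \<open>n! m!\<close> ways runs through the class, and the renumberings with
  a given result form a coset of the symmetry group.\<close>

theorem card_iso_class:
  assumes t: "t \<in> Tcirc"
  shows "finite (Tcirc_iso `` {t})"
    "card (Tcirc_iso `` {t}) * card (sym_group t) = fact (nblack t) * fact (nwhite t)"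
proof -
  let ?P = "vertex_perms t" and ?C = "Tcirc_iso `` {t}"
  have C: "?C = (\<lambda>p. act p t) ` ?P" using t by (auto simp: Tcirc_iso_iff)
  show finC: "finite ?C" unfolding C using card_vertex_perms(2) by simp
  have fibre: "card {p \<in> ?P. act p t = s} = card (sym_group t)" if "s \<in> ?C" for s
  proof -
    obtain q where q: "q \<in> ?P" "s = act q t" using \<open>s \<in> ?C\<close> C by auto
    note i = vertex_perms_inv[OF q(1)]
    let ?q = "(inv (fst q), inv (snd q))"
    let ?f = "\<lambda>p. (fst q \<circ> fst p, snd q \<circ> snd p)" and ?g = "\<lambda>p. (inv (fst q) \<circ> fst p, inv (snd q) \<circ> snd p)"
    have return: "act ?q s = t" using q(2) by (simp add: act_act i act_id)
    have "bij_betw ?f {p \<in> ?P. act p t = t} {p \<in> ?P. act p t = s}"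
    proof (rule bij_betwI[of _ _ _ ?g])
      show "?f \<in> {p \<in> ?P. act p t = t} \<rightarrow> {p \<in> ?P. act p t = s}"
        using vertex_perms_comp[OF q(1)] q(2) by (auto simp flip: act_act)
      show "?g \<in> {p \<in> ?P. act p t = s} \<rightarrow> {p \<in> ?P. act p t = t}"
      proof
        fix p assume p: "p \<in> {p \<in> ?P. act p t = s}"
        then have "act (?g p) t = t" using return act_act[of ?q p t] by simp
        then show "?g p \<in> {p \<in> ?P. act p t = t}" using vertex_perms_comp[OF i(1), of p] p by simp
      qed
      show "?g (?f p) = p" "?f (?g p) = p" for p
        using i by (simp_all flip: comp_assoc)
    qed
    then show ?thesis by (simp add: sym_group_def isos_eq bij_betw_same_card)
  qed
  have "fact (nblack t) * fact (nwhite t) = card ?P" by (rule card_vertex_perms(1)[symmetric])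
  also have "\<dots> = (\<Sum>s\<in>?C. card {p \<in> ?P. act p t = s})"
    using sum.group[OF card_vertex_perms(2) finC, where g = "\<lambda>p. act p t" and h = "\<lambda>_. 1 :: nat"] C by simp
  also have "\<dots> = card ?C * card (sym_group t)" by (simp add: fibre)
  finally show "card ?C * card (sym_group t) = fact (nblack t) * fact (nwhite t)" by simp
qed

text \<open>The terms are constant on a class, whose size is \<open>n! m!\<close> divided by the order of the symmetry
  group.\<close>

theorem sum_iso_classes:
  assumes sym: "symmetric_data S y' x"
    and s: "formal_has_sum (labelled_term S y' x) Tcirc s"
    and rep: "\<And>c. c \<in> Tcirc // Tcirc_iso \<Longrightarrow> rep c \<in> c"
  shows "formal_has_sum (\<lambda>c. mps_const (1 / real (card (sym_group (rep c)))) * tree_term S y' (rep c) x)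
      (Tcirc // Tcirc_iso) s"
proof -
  let ?Q = "Tcirc // Tcirc_iso"
  let ?f = "labelled_term S y' x"
  have "bij_betw snd (Sigma ?Q (\<lambda>c. c)) Tcirc"
  proof (rule bij_betw_imageI)
    show "inj_on snd (Sigma ?Q (\<lambda>c. c))"
      using quotient_disj[OF equiv_Tcirc_iso] by (fastforce simp: inj_on_def)
    have "snd ` Sigma ?Q (\<lambda>c. c) = \<Union> ?Q" by force
    then show "snd ` Sigma ?Q (\<lambda>c. c) = Tcirc" by (simp only: Union_quotient[OF equiv_Tcirc_iso])
  qed
  then have "formal_has_sum (\<lambda>z. ?f (snd z)) (Sigma ?Q (\<lambda>c. c)) s"
    using s by (rule formal_has_sum_reindex[of _ _ _ ?f, THEN iffD1])
  then show ?thesis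
  proof (rule formal_has_sum_Sigma)
    fix c assume c: "c \<in> ?Q"
    let ?r = "rep c"
    have r: "?r \<in> c" by (rule rep[OF c])
    then have rT: "?r \<in> Tcirc" using Union_quotient[OF equiv_Tcirc_iso] c by blast
    have c_eq: "c = Tcirc_iso `` {?r}"
    proof (rule quotientE[OF c])
      fix a assume "c = Tcirc_iso `` {a}"
      then show ?thesis using r equiv_class_eq[OF equiv_Tcirc_iso, of a ?r] by simp
    qed
    note cc = card_iso_class[OF rT, folded c_eq]
    have const: "?f t = ?f ?r" if "t \<in> c" for t
    proof -
      have "(?r, t) \<in> Tcirc_iso" using that c_eq by blast
      then obtain p where "p \<in> vertex_perms ?r" "t = act p ?r" by (auto simp: Tcirc_iso_iff)
      then show ?thesis using tree_term_act[OF sym rT] by (simp add: labelled_term_def)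
    qed
    have "real (card c) * real (card (sym_group ?r)) = fact (nblack ?r) * fact (nwhite ?r)"
      using cc(2) by (metis of_nat_fact of_nat_mult)
    moreover have "(fact (nblack ?r) * fact (nwhite ?r) :: real) \<noteq> 0" by simp
    ultimately have "real (card c) * (1 / (fact (nwhite ?r) * fact (nblack ?r))) = 1 / real (card (sym_group ?r))"
      by (cases "card (sym_group ?r) = 0") (simp_all add: field_simps)
    then have "mps_const (1 / real (card (sym_group ?r))) * tree_term S y' ?r x = of_nat (card c) * ?f ?r"
      unfolding labelled_term_def mps_const_of_nat[symmetric] mult.assoc[symmetric] mps_const_mult[symmetric]
      by simp
    also have "\<dots> = (\<Sum>t\<in>c. ?f t)" using const by simp
    finally have eq: "mps_const (1 / real (card (sym_group ?r))) * tree_term S y' ?r x = (\<Sum>t\<in>c. ?f t)" .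
    show "formal_has_sum (\<lambda>t. ?f (snd (c, t))) c (mps_const (1 / real (card (sym_group ?r))) * tree_term S y' ?r x)"
      unfolding eq snd_conv by (rule formal_has_sum_finite[OF cc(1)])
  qed
qed

section \<open>Uniqueness of the solution\<close>

definition agree :: "nat \<Rightarrow> 'w mps \<Rightarrow> 'w mps \<Rightarrow> bool" where
  "agree N f g \<longleftrightarrow> (\<forall>\<mu>. size \<mu> \<le> N \<longrightarrow> mps_coeff f \<mu> = mps_coeff g \<mu>)"

lemma agree_refl [simp]: "agree N f f"
  by (simp add: agree_def)

lemma agree_mult:
  assumes "agree N f f'" "agree N g g'"
  shows "agree N (f * g) (f' * g')"
  unfolding agree_def coeff_mult
  by (intro allI impI sum.cong refl arg_cong2[where f = "(*)"]) (use assms in \<open>auto simp: agree_def\<close>)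

lemma agree_diff: "agree N f f' \<Longrightarrow> agree N g g' \<Longrightarrow> agree N (f - g) (f' - g')"
  by (simp add: agree_def)

lemma agree_sum: "(\<And>i. i \<in> I \<Longrightarrow> agree N (f i) (f' i)) \<Longrightarrow> agree N (\<Sum>i\<in>I. f i) (\<Sum>i\<in>I. f' i)"
  by (simp add: agree_def)

lemma agree_prod_mset: "(\<And>i. agree N (g i) (g' i)) \<Longrightarrow> agree N (\<Prod>i\<in>#\<nu>. g i) (\<Prod>i\<in>#\<nu>. g' i)"
  by (induction \<nu>) (auto intro: agree_mult)

lemma agree_compose:
  assumes "\<And>i. agree N (g i) (g' i)"
  shows "agree N (mps_compose f g) (mps_compose f g')"
  unfolding agree_def
proof (intro allI impI)
  fix \<mu> :: "'b multiset" assume \<mu>: "size \<mu> \<le> N"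
  have "mps_coeff (mps_const c * (\<Prod>i\<in>#\<nu>. g i)) \<mu> = mps_coeff (mps_const c * (\<Prod>i\<in>#\<nu>. g' i)) \<mu>" for c \<nu>
    using agree_prod_mset[of N g g' \<nu>] assms \<mu> by (simp add: agree_def)
  then show "mps_coeff (mps_compose f g) \<mu> = mps_coeff (mps_compose f g') \<mu>"
    by (simp only: mps_compose_def formal_sum_def coeff_Abs_mps)
qed

lemma agree_mult_var:
  fixes f f' :: "'w mps"
  assumes "agree N f f'"
  shows "agree (Suc N) (f * mps_var a) (f' * mps_var a)"
  unfolding agree_def coeff_mult
proof (intro allI impI sum.cong refl)
  fix \<mu> and p :: "'w multiset \<times> 'w multiset"
  assume "size \<mu> \<le> Suc N" "p \<in> {p. fst p + snd p = \<mu>}"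
  then show "mps_coeff f (fst p) * mps_coeff (mps_var a) (snd p) = mps_coeff f' (fst p) * mps_coeff (mps_var a) (snd p)"
    using assms by (auto simp: coeff_var agree_def)
qed

text \<open>The equation for \<open>qbar\<close> raises the order of agreement because of the factor \<open>mps_var\<close>, and the
  equation for \<open>ybar\<close> preserves it.\<close>

theorem solution_unique:
  assumes "coordinate_system_solution S y' x (ybar, qbar)" "coordinate_system_solution S y' x (ybar', qbar')"
  shows "ybar = ybar'" "qbar = qbar'"
proof -
  have y: "ybar \<alpha> = mps_compose (mps_deriv \<alpha> (gen_series S x)) qbar"
    "ybar' \<alpha> = mps_compose (mps_deriv \<alpha> (gen_series S x)) qbar'" for \<alpha>
    using assms by (auto simp: coordinate_system_solution_def)
  have q: "qbar \<alpha> = (\<Sum>\<alpha>'\<in>UNIV. taylor_expand (pderiv_at \<alpha> (\<lambda>y. y' y $ \<alpha>')) (base_map S x) ybar * mps_var \<alpha>')"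
    "qbar' \<alpha> = (\<Sum>\<alpha>'\<in>UNIV. taylor_expand (pderiv_at \<alpha> (\<lambda>y. y' y $ \<alpha>')) (base_map S x) ybar' * mps_var \<alpha>')" for \<alpha>
    using assms by (auto simp: coordinate_system_solution_def)
  have "\<forall>\<alpha>. agree N (ybar \<alpha>) (ybar' \<alpha>) \<and> agree N (qbar \<alpha>) (qbar' \<alpha>)" for N
  proof (induction N)
    case 0
    then show ?case using assms by (auto simp: coordinate_system_solution_def agree_def)
  next
    case (Suc N)
    have "agree (Suc N) (qbar \<alpha>) (qbar' \<alpha>)" for \<alpha>
      unfolding q taylor_expand_def
      by (intro agree_sum agree_mult_var agree_compose agree_diff) (use Suc in auto)
    moreover from this have "agree (Suc N) (ybar \<alpha>) (ybar' \<alpha>)" for \<alpha>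
      unfolding y by (intro agree_compose)
    ultimately show ?case by blast
  qed
  then show "ybar = ybar'" "qbar = qbar'"
    by (auto simp: agree_def fun_eq_iff intro!: mps_eqI)
qed


section \<open>Rooted trees solve the system\<close>

lemma compose_tensor_add:
  fixes g :: "'v::finite \<Rightarrow> 'w mps"
  assumes "no_const g"
  shows "mps_compose (tensor_series (\<lambda>is. T is + T' is)) g
    = mps_compose (tensor_series T) g + mps_compose (tensor_series T') g"
proof (rule formal_has_sum_unique[OF compose_tensor_series[OF assms]])
  show "formal_has_sum (\<lambda>is. mps_const (T is + T' is) * (\<Prod>i\<leftarrow>is. g i)) UNIV
      (mps_compose (tensor_series T) g + mps_compose (tensor_series T') g)"
    using formal_has_sum_add[OF compose_tensor_series[OF assms, of T] compose_tensor_series[OF assms, of T']]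
    by (simp add: mps_const_add distrib_right)
qed

lemma compose_tensor_finite:
  fixes g :: "'v::finite \<Rightarrow> 'w mps"
  assumes "no_const g" "finite W" "\<And>is. is \<notin> W \<Longrightarrow> T is = 0"
  shows "mps_compose (tensor_series T) g = (\<Sum>is\<in>W. mps_const (T is) * (\<Prod>i\<leftarrow>is. g i))"
proof (rule formal_has_sum_unique[OF compose_tensor_series[OF assms(1)]])
  show "formal_has_sum (\<lambda>is. mps_const (T is) * (\<Prod>i\<leftarrow>is. g i)) UNIV (\<Sum>is\<in>W. mps_const (T is) * (\<Prod>i\<leftarrow>is. g i))"
    by (subst formal_has_sum_neutral[of W]) (use assms in \<open>auto intro: formal_has_sum_finite\<close>)
qed

context
  fixes S :: "'k::finite list \<Rightarrow> real^'n::finite \<Rightarrow> real" and y' :: "real^'k \<Rightarrow> real^'k" and x :: "real^'n"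
  assumes sym: "symmetric_data S y' x"
begin

private abbreviation "Z i \<equiv> rooted_gf (vertex_tensor S y' x) True {#i#}"
private abbreviation "Q i \<equiv> rooted_gf (vertex_tensor S y' x) False {#i#}"
private abbreviation "Y i \<equiv> mps_const (base_map S x $ i) + Z i"

lemma no_const_Z_Q: "no_const Z" "no_const Q"
  by (rule no_const_rooted_gf[OF admissible_vertex_tensor])+

text \<open>A white root contributes a derivative of \<open>y'\<close>, so attaching any number of black-rooted
  subtrees produces the Taylor series of \<open>y'\<close> around \<open>base_map S x\<close> evaluated at \<open>Y\<close>.\<close>

lemma white_rooted_gf:
  "rooted_gf (vertex_tensor S y' x) False (mset js) =
    (\<Sum>a\<in>UNIV. taylor_expand (pderivs js (\<lambda>y. y' y $ a)) (base_map S x) Y * mps_var a)"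
proof -
  let ?T = "\<lambda>a is. pderivs is (pderivs js (\<lambda>y. y' y $ a)) (base_map S x) / fact (length is)"
  have word: "pderivs (word (mset js + mset is)) (\<lambda>y. y' y $ a) (base_map S x)
      = pderivs is (pderivs js (\<lambda>y. y' y $ a)) (base_map S x)" for "is" a
    using sym by (auto simp: symmetric_data_def add.commute simp flip: pderivs_append)
  have "formal_has_sum (\<lambda>d. \<Sum>a\<in>UNIV. mps_var a * (\<Sum>is | length is = d. mps_const (?T a is) * (\<Prod>i\<leftarrow>is. Z i))) UNIV
      (\<Sum>a\<in>UNIV. mps_var a * mps_compose (tensor_series (?T a)) Z)"
    by (intro formal_has_sum_sum formal_has_sum_cmult compose_tensor_series_by_degree no_const_Z_Q) simp
  then have "formal_has_sum (\<lambda>d. \<Sum>is | length is = d.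
      mps_const (1 / fact d) * vertex_tensor S y' x False (mset js + mset is) * (\<Prod>i\<leftarrow>is. Z i)) UNIV
      (\<Sum>a\<in>UNIV. mps_var a * mps_compose (tensor_series (?T a)) Z)"
  proof (rule formal_has_sum_cong[rotated])
    fix d :: nat
    have "(\<Sum>is | length is = d. mps_const (1 / fact d) * vertex_tensor S y' x False (mset js + mset is) * (\<Prod>i\<leftarrow>is. Z i))
      = (\<Sum>is | length is = d. \<Sum>a\<in>UNIV. mps_var a * (mps_const (?T a is) * (\<Prod>i\<leftarrow>is. Z i)))"
    proof (rule sum.cong[OF refl])
      fix "is" :: "'k list" assume "is \<in> {is. length is = d}"
      then have c: "mps_const (?T a is) = mps_const (1 / fact d) * mps_const (pderivs is (pderivs js (\<lambda>y. y' y $ a)) (base_map S x))" for a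
        by (simp flip: mps_const_mult)
      show "mps_const (1 / fact d) * vertex_tensor S y' x False (mset js + mset is) * (\<Prod>i\<leftarrow>is. Z i)
          = (\<Sum>a\<in>UNIV. mps_var a * (mps_const (?T a is) * (\<Prod>i\<leftarrow>is. Z i)))"
        by (simp add: vertex_tensor_def word c sum_distrib_left sum_distrib_right mult_ac)
    qed
    also have "\<dots> = (\<Sum>a\<in>UNIV. mps_var a * (\<Sum>is | length is = d. mps_const (?T a is) * (\<Prod>i\<leftarrow>is. Z i)))"
      unfolding sum_distrib_left by (rule sum.swap)
    finally show "(\<Sum>a\<in>UNIV. mps_var a * (\<Sum>is | length is = d. mps_const (?T a is) * (\<Prod>i\<leftarrow>is. Z i)))
      = (\<Sum>is | length is = d. mps_const (1 / fact d) * vertex_tensor S y' x False (mset js + mset is) * (\<Prod>i\<leftarrow>is. Z i))" ..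
  qed
  then have "rooted_gf (vertex_tensor S y' x) False (mset js) = (\<Sum>a\<in>UNIV. mps_var a * mps_compose (tensor_series (?T a)) Z)"
    using formal_has_sum_unique[OF rooted_gf_words[OF admissible_vertex_tensor, where c = False]] by simp
  then show ?thesis by (simp add: taylor_expand_def taylor_series_def mult.commute)
qed

text \<open>Likewise a black root with white-rooted subtrees gives a derivative of \<open>S\<close> at \<open>Q\<close>, with the
  terms in which the root has fewer than two indices left out.\<close>

lemma black_rooted_gf:
  "rooted_gf (vertex_tensor S y' x) True (mset js) = mps_compose (tensor_series (\<lambda>is.
     (if 2 \<le> length js + length is then fact (length js + length is) * S (js @ is) x else 0) / fact (length is))) Q"
  (is "_ = mps_compose (tensor_series ?T) Q")
proof -
  have word: "S (word (mset js + mset is)) x = S (js @ is) x" for "is"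
    using sym by (auto simp: symmetric_data_def)
  have "formal_has_sum (\<lambda>d. \<Sum>is | length is = d.
      mps_const (1 / fact d) * vertex_tensor S y' x True (mset js + mset is) * (\<Prod>i\<leftarrow>is. Q i)) UNIV
      (mps_compose (tensor_series ?T) Q)"
  proof (rule formal_has_sum_cong[OF _ compose_tensor_series_by_degree[OF no_const_Z_Q(2)]])
    fix d :: nat
    show "(\<Sum>is | length is = d. mps_const (?T is) * (\<Prod>i\<leftarrow>is. Q i)) =
      (\<Sum>is | length is = d. mps_const (1 / fact d) * vertex_tensor S y' x True (mset js + mset is) * (\<Prod>i\<leftarrow>is. Q i))"
      by (rule sum.cong[OF refl]) (auto simp: vertex_tensor_def word simp flip: mps_const_mult)
  qed
  then show ?thesis
    using formal_has_sum_unique[OF rooted_gf_words[OF admissible_vertex_tensor, where c = True]] by simp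
qed

text \<open>The term left out by the trees is the constant term of the derivative, which is the base map.\<close>

lemma Y_eq: "mps_compose (mps_deriv \<alpha> (gen_series S x)) Q = Y \<alpha>"
proof -
  let ?T = "\<lambda>is. (if 2 \<le> length [\<alpha>] + length is then fact (length [\<alpha>] + length is) * S ([\<alpha>] @ is) x else 0) / fact (length is)"
  let ?C = "\<lambda>is. if is = [] then S [\<alpha>] x else 0"
  have "mps_deriv \<alpha> (gen_series S x) = tensor_series (\<lambda>is. real (Suc (length is)) * S (\<alpha> # is) x)"
    unfolding gen_series_def
  proof (rule deriv_tensor_series)
    show "S is x = S js x" if "mset is = mset js" for "is" js
      using sym that unfolding symmetric_data_def by blast
  qed
  also have "(\<lambda>is. real (Suc (length is)) * S (\<alpha> # is) x) = (\<lambda>is. ?C is + ?T is)"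
  proof
    fix "is" show "real (Suc (length is)) * S (\<alpha> # is) x = ?C is + ?T is"
    proof (cases "is")
      case (Cons i js)
      have cancel: "c * f * s / f = c * s" if "f \<noteq> 0" for c f s :: real
        using that by simp
      have "?C is + ?T is = fact (Suc (length is)) * S (\<alpha> # is) x / fact (length is)"
        using Cons by (simp del: fact_Suc)
      then show ?thesis by (simp only: fact_Suc cancel[OF fact_nonzero])
    qed simp
  qed
  finally have "mps_compose (mps_deriv \<alpha> (gen_series S x)) Q = mps_compose (tensor_series ?C) Q + mps_compose (tensor_series ?T) Q"
    by (simp only: compose_tensor_add[OF no_const_Z_Q(2)])
  moreover have "mps_compose (tensor_series ?C) Q = mps_const (base_map S x $ \<alpha>)"
    using compose_tensor_finite[OF no_const_Z_Q(2), of "{[]}" ?C] by (simp add: base_map_def)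
  moreover have "mps_compose (tensor_series ?T) Q = Z \<alpha>"
    using black_rooted_gf[of "[\<alpha>]"] by simp
  ultimately show ?thesis by simp
qed

lemma gen_series_at_Q:
  "mps_compose (gen_series S x) Q = mps_const (S [] x) + (\<Sum>i\<in>UNIV. mps_const (base_map S x $ i) * Q i)
     + rooted_gf (vertex_tensor S y' x) True {#}"
proof -
  let ?T = "\<lambda>is. (if 2 \<le> length ([] :: 'k list) + length is then fact (length ([] :: 'k list) + length is) * S ([] @ is) x else 0) / fact (length is)"
  let ?C = "\<lambda>is. if length is < 2 then S is x else 0"
  let ?W = "insert [] ((\<lambda>i. [i]) ` (UNIV :: 'k set))"
  have "(\<lambda>is. S is x) = (\<lambda>is. ?C is + ?T is)" by (auto simp: fun_eq_iff)
  then have "mps_compose (gen_series S x) Q = mps_compose (tensor_series ?C) Q + mps_compose (tensor_series ?T) Q"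
    unfolding gen_series_def by (simp only: compose_tensor_add[OF no_const_Z_Q(2)])
  moreover have "mps_compose (tensor_series ?C) Q = (\<Sum>is\<in>?W. mps_const (?C is) * (\<Prod>i\<leftarrow>is. Q i))"
  proof (rule compose_tensor_finite[OF no_const_Z_Q(2)])
    fix "is" :: "'k list" assume "is \<notin> ?W"
    then show "?C is = 0" by (cases "is"; cases "tl is") auto
  qed simp
  then have "mps_compose (tensor_series ?C) Q = mps_const (S [] x) + (\<Sum>i\<in>UNIV. mps_const (base_map S x $ i) * Q i)"
    by (subst (asm) sum.insert) (auto simp: sum.reindex inj_on_def base_map_def)
  moreover have "mps_compose (tensor_series ?T) Q = rooted_gf (vertex_tensor S y' x) True {#}"
    using black_rooted_gf[of "[]"] by simp
  ultimately show ?thesis by simp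
qed

lemma trees_solve: "coordinate_system_solution S y' x (Y, Q)"
proof -
  have "mps_coeff (Y \<alpha>) {#} = base_map S x $ \<alpha>" "mps_coeff (Q \<alpha>) {#} = 0" for \<alpha>
    using no_const_Z_Q by (auto simp: no_const_def coeff_const)
  moreover have "Q \<alpha> = (\<Sum>\<alpha>'\<in>UNIV. taylor_expand (pderiv_at \<alpha> (\<lambda>y. y' y $ \<alpha>')) (base_map S x) Y * mps_var \<alpha>')" for \<alpha>
    using white_rooted_gf[of "[\<alpha>]"] by (simp add: pderivs_simps)
  ultimately show ?thesis
    unfolding coordinate_system_solution_def prod.case Y_eq by blast
qed

lemma solution_iff: "coordinate_system_solution S y' x p \<longleftrightarrow> p = (Y, Q)"
  using trees_solve solution_unique[of S y' x "fst p" "snd p" Y Q] by (cases p) auto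

text \<open>The terms of \<open>S\<close> that are linear in \<open>Q\<close> cancel against the constant part of \<open>Y\<close> in the last
  sum; what remains is the count of vertices minus edges.\<close>

lemma new_generating_function_eq:
  assumes "x = \<xi> x'"
  shows "new_generating_function S \<xi> y' x' = mps_const (S [] x) + egf (unrooted (vertex_tensor S y' x))"
proof -
  have the: "(THE p. coordinate_system_solution S y' x p) = (Y, Q)"
    by (simp add: solution_iff)
  have "new_generating_function S \<xi> y' x' = mps_compose (gen_series S x) Q
      + (\<Sum>a\<in>UNIV. taylor_expand (\<lambda>y. y' y $ a) (base_map S x) Y * mps_var a) - (\<Sum>\<alpha>\<in>UNIV. Y \<alpha> * Q \<alpha>)"
    unfolding new_generating_function_def assms[symmetric] the by simp
  also have "\<dots> = mps_const (S [] x) + (rooted_gf (vertex_tensor S y' x) True {#}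
      + rooted_gf (vertex_tensor S y' x) False {#} - (\<Sum>\<alpha>\<in>UNIV. Z \<alpha> * Q \<alpha>))"
    using white_rooted_gf[of "[]"] by (simp add: gen_series_at_Q pderivs_simps distrib_right sum.distrib)
  finally show ?thesis by (simp only: unrooted_gf[OF admissible_vertex_tensor])
qed

end

section \<open>The generating function in new coordinates\<close>

theorem mainTheorem5:
  fixes S :: "'k::finite list \<Rightarrow> real^'n::finite \<Rightarrow> real"
    and U U' :: "(real^'n) set" and V V' :: "(real^'k) set"
    and x x_inv :: "real^'n \<Rightarrow> real^'n"
    and y y' :: "real^'k \<Rightarrow> real^'k"
  assumes "thick_morphism_generating_function U V S"
    and "coordinate_change U' U x x_inv"
    and "coordinate_change V' V y y'"
  shows "\<forall>x'\<in>U'.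
    (\<exists>!p. coordinate_system_solution S y' (x x') p) \<and>
    formal_has_sum
      (\<lambda>t. mps_const (1 / (fact (nwhite t) * fact (nblack t))) * tree_term S y' t (x x'))
      Tcirc (new_generating_function S x y' x') \<and>
    (\<forall>rep. (\<forall>c \<in> Tcirc // Tcirc_iso. rep c \<in> c) \<longrightarrow>
      formal_has_sum
        (\<lambda>c. mps_const (1 / real (card (sym_group (rep c)))) * tree_term S y' (rep c) (x x'))
        (Tcirc // Tcirc_iso) (new_generating_function S x y' x'))"
proof (intro ballI conjI allI impI)
  fix x' assume "x' \<in> U'"
  then have xU: "x x' \<in> U" using assms(2) by (simp add: coordinate_change_def)
  have V: "open V" "base_map S (x x') \<in> V"
    using assms(1) xU unfolding thick_morphism_generating_function_def by blast+
  have symS: "S is (x x') = S js (x x')" if "mset is = mset js" for "is" js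
    using assms(1) xU that unfolding thick_morphism_generating_function_def by blast
  have smooth: "smooth_fun_on V (\<lambda>y. y' y $ a)" for a
    using assms(3) unfolding coordinate_change_def smooth_map_on_def by blast
  have sym: "symmetric_data S y' (x x')"
    unfolding symmetric_data_def using symS pderivs_perm[OF V(1) smooth _ V(2)] by blast
  have S': "new_generating_function S x y' x' =
      mps_const (S [] (x x')) + egf (unrooted (vertex_tensor S y' (x x')))"
    by (rule new_generating_function_eq[OF sym]) simp
  show "\<exists>!p. coordinate_system_solution S y' (x x') p"
    by (simp add: solution_iff[OF sym])
  have sum: "formal_has_sum (labelled_term S y' (x x')) Tcirc (new_generating_function S x y' x')"
    unfolding S' by (rule sum_Tcirc[OF sym])
  then show "formal_has_sum
      (\<lambda>t. mps_const (1 / (fact (nwhite t) * fact (nblack t))) * tree_term S y' t (x x'))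
      Tcirc (new_generating_function S x y' x')"
    by (simp only: labelled_term_def[abs_def])
  fix rep assume "\<forall>c \<in> Tcirc // Tcirc_iso. rep c \<in> c"
  then show "formal_has_sum
        (\<lambda>c. mps_const (1 / real (card (sym_group (rep c)))) * tree_term S y' (rep c) (x x'))
        (Tcirc // Tcirc_iso) (new_generating_function S x y' x')"
    by (intro sum_iso_classes[OF sym sum]) blast
qed

end
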